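(* For each relation $\bowtie$ among simulation preorder $\sqsubseteq_s$ and equivalence $=_s$, completed simulation preorder $\sqsubseteq_{cs}$ and equivalence $=_{cs}$, ready simulation preorder $\sqsubseteq_{rs}$ and equivalence $=_{rs}$, 2-nested simulation preorder $\sqsubseteq_{2s}$ and equivalence $=_{2s}$, and bisimulation equivalence $\sim$, the problem of deciding, given a visibly one-counter automaton and two of its configurations, whether they are related by $\bowtie$ is PSPACE-complete.
   Context: A labelled transition system (LTS) is $(S,\mathit{Act},\to)$ with $\to\subseteq S\times\mathit{Act}\times S$; $I(s)=\{a\mid \exists s'.\,s\xrightarrow{a}s'\}$. A relation $R\subseteq S\times S$ is a simulation if for all $(s,t)\in R$ and $s\xrightarrow{a}s'$ there is $t\xrightarrow{a}t'$ with $(s',t')\in R$; a completed simulation if it is a simulation and for all $(s,t)\in R$, $I(s)=\emptyset$ iff $I(t)=\emptyset$; a ready simulation if it is a simulation with $I(s)=I(t)$ for all $(s,t)\in R$; a 2-nested simulation if it is a simulation and $R^{-1}\subseteq R'$ for some simulation $R'$; a bisimulation if it is a simulation and $R^{-1}=R$. The preorders $\sqsubseteq_s,\sqsubseteq_{cs},\sqsubseteq_{rs},\sqsubseteq_{2s}$ and $\sim$ relate $s,t$ iff some relation of the respective kind contains $(s,t)$; the equivalences $=_s,=_{cs},=_{rs},=_{2s}$ relate $s,t$ iff $s$ and $t$ are related by the corresponding preorder in both directions. A pushdown automaton over finite action set $\mathit{Act}$, stack alphabet $\Gamma$, control states $Q$ is a finite set of rules $pX\xrightarrow{a}q\alpha$,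 generating the LTS on configurations $p\alpha\in Q\times\Gamma^*$ (top of stack leftmost) with $pX\gamma\xrightarrow{a}q\alpha\gamma$ for each rule and each $\gamma$. It is visibly pushdown if $\mathit{Act}$ is partitioned into call, return, internal actions $\mathit{Act}_c,\mathit{Act}_r,\mathit{Act}_i$ and each rule $pX\xrightarrow{a}q\alpha$ has $|\alpha|=2,0,1$ for $a\in\mathit{Act}_c,\mathit{Act}_r,\mathit{Act}_i$ respectively. A one-counter automaton is a pushdown automaton with $\Gamma=\{I,Z\}$ whose rules all have the form $pI\xrightarrow{a}q\alpha$ or $pZ\xrightarrow{a}q\alpha Z$ with $\alpha\in\{I\}^*$; the configuration $pI^nZ$ is written $p(n)$. A visibly one-counter automaton (v1CA) is a one-counter automaton that is visibly pushdown. *)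

theory Defs
  imports "HOL-Computational_Algebra.Polynomial"
begin

section \<open>Labelled transition systems and simulation-like relations\<close>

record ('s, 'a) lts =
  states :: "'s set"
  labels :: "'a set"
  transitions :: "('s \<times> 'a \<times> 's) set"

definition enabled :: "('s, 'a) lts \<Rightarrow> 's \<Rightarrow> 'a set" where
  "enabled T s = {a. \<exists>s'. (s, a, s') \<in> transitions T}"

definition simulation :: "('s, 'a) lts \<Rightarrow> ('s \<times> 's) set \<Rightarrow> bool" where
  "simulation T R \<longleftrightarrow> R \<subseteq> states T \<times> states T \<and>
     (\<forall>(s, t) \<in> R. \<forall>a s'. (s, a, s') \<in> transitions T \<longrightarrow>
        (\<exists>t'. (t, a, t') \<in> transitions T \<and> (s', t') \<in> R))"

definition completed_simulation :: "('s, 'a) lts \<Rightarrow> ('s \<times> 's) set \<Rightarrow> bool" where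
  "completed_simulation T R \<longleftrightarrow> simulation T R \<and>
     (\<forall>(s, t) \<in> R. enabled T s = {} \<longleftrightarrow> enabled T t = {})"

definition ready_simulation :: "('s, 'a) lts \<Rightarrow> ('s \<times> 's) set \<Rightarrow> bool" where
  "ready_simulation T R \<longleftrightarrow> simulation T R \<and>
     (\<forall>(s, t) \<in> R. enabled T s = enabled T t)"

definition two_nested_simulation :: "('s, 'a) lts \<Rightarrow> ('s \<times> 's) set \<Rightarrow> bool" where
  "two_nested_simulation T R \<longleftrightarrow> simulation T R \<and> (\<exists>R'. simulation T R' \<and> R\<inverse> \<subseteq> R')"

definition bisimulation :: "('s, 'a) lts \<Rightarrow> ('s \<times> 's) set \<Rightarrow> bool" where
  "bisimulation T R \<longleftrightarrow> simulation T R \<and> R\<inverse> = R"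

type_synonym ('s, 'a) behavioural_relation = "('s, 'a) lts \<Rightarrow> 's \<Rightarrow> 's \<Rightarrow> bool"

definition sim_preorder :: "('s, 'a) behavioural_relation" where
  "sim_preorder T s t \<longleftrightarrow> (\<exists>R. simulation T R \<and> (s, t) \<in> R)"

definition completed_sim_preorder :: "('s, 'a) behavioural_relation" where
  "completed_sim_preorder T s t \<longleftrightarrow> (\<exists>R. completed_simulation T R \<and> (s, t) \<in> R)"

definition ready_sim_preorder :: "('s, 'a) behavioural_relation" where
  "ready_sim_preorder T s t \<longleftrightarrow> (\<exists>R. ready_simulation T R \<and> (s, t) \<in> R)"

definition two_nested_sim_preorder :: "('s, 'a) behavioural_relation" where
  "two_nested_sim_preorder T s t \<longleftrightarrow> (\<exists>R. two_nested_simulation T R \<and> (s, t) \<in> R)"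

definition bisimilar :: "('s, 'a) behavioural_relation" where
  "bisimilar T s t \<longleftrightarrow> (\<exists>R. bisimulation T R \<and> (s, t) \<in> R)"

definition sim_equiv :: "('s, 'a) behavioural_relation" where
  "sim_equiv T s t \<longleftrightarrow> sim_preorder T s t \<and> sim_preorder T t s"

definition completed_sim_equiv :: "('s, 'a) behavioural_relation" where
  "completed_sim_equiv T s t \<longleftrightarrow> completed_sim_preorder T s t \<and> completed_sim_preorder T t s"

definition ready_sim_equiv :: "('s, 'a) behavioural_relation" where
  "ready_sim_equiv T s t \<longleftrightarrow> ready_sim_preorder T s t \<and> ready_sim_preorder T t s"

definition two_nested_sim_equiv :: "('s, 'a) behavioural_relation" where
  "two_nested_sim_equiv T s t \<longleftrightarrow> two_nested_sim_preorder T s t \<and> two_nested_sim_preorder T t s"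


section \<open>Pushdown automata\<close>

text \<open>The tuple \<open>(p, X, a, q, \<alpha>)\<close> is the rule \<open>pX \<rightarrow>\<^sup>a q\<alpha>\<close>; the head of a stack
  word is the top of the stack.\<close>

type_synonym ('q, 'x, 'a) rule = "'q \<times> 'x \<times> 'a \<times> 'q \<times> 'x list"

type_synonym ('q, 'x) pda_config = "'q \<times> 'x list"

record ('q, 'x, 'a) pda =
  control :: "'q set"
  stack_alphabet :: "'x set"
  actions :: "'a set"
  rules :: "('q, 'x, 'a) rule set"

definition pushdown_automaton :: "('q, 'x, 'a) pda \<Rightarrow> bool" where
  "pushdown_automaton P \<longleftrightarrow>
     finite (control P) \<and> finite (stack_alphabet P) \<and> finite (actions P) \<and> finite (rules P) \<and>
     (\<forall>(p, X, a, q, \<alpha>) \<in> rules P. p \<in> control P \<and> X \<in> stack_alphabet P \<and> a \<in> actions P \<and>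
        q \<in> control P \<and> \<alpha> \<in> lists (stack_alphabet P))"

definition configurations :: "('q, 'x, 'a) pda \<Rightarrow> ('q, 'x) pda_config set" where
  "configurations P = control P \<times> lists (stack_alphabet P)"

definition pda_lts :: "('q, 'x, 'a) pda \<Rightarrow> (('q, 'x) pda_config, 'a) lts" where
  "pda_lts P = \<lparr> states = configurations P, labels = actions P,
     transitions = {((p, X # \<gamma>), a, (q, \<alpha> @ \<gamma>)) | p X a q \<alpha> \<gamma>.
       (p, X, a, q, \<alpha>) \<in> rules P \<and> \<gamma> \<in> lists (stack_alphabet P)} \<rparr>"

definition visibly_pushdown ::
    "'a set \<Rightarrow> 'a set \<Rightarrow> 'a set \<Rightarrow> ('q, 'x, 'a) pda \<Rightarrow> bool" where
  "visibly_pushdown Act\<^sub>c Act\<^sub>r Act\<^sub>i P \<longleftrightarrow> pushdown_automaton P \<and>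
     actions P = Act\<^sub>c \<union> Act\<^sub>r \<union> Act\<^sub>i \<and>
     Act\<^sub>c \<inter> Act\<^sub>r = {} \<and> Act\<^sub>c \<inter> Act\<^sub>i = {} \<and> Act\<^sub>r \<inter> Act\<^sub>i = {} \<and>
     (\<forall>(p, X, a, q, \<alpha>) \<in> rules P.
        (a \<in> Act\<^sub>c \<longrightarrow> length \<alpha> = 2) \<and>
        (a \<in> Act\<^sub>r \<longrightarrow> length \<alpha> = 0) \<and>
        (a \<in> Act\<^sub>i \<longrightarrow> length \<alpha> = 1))"

datatype counter_symbol = sym_I | sym_Z

definition one_counter_automaton :: "('q, counter_symbol, 'a) pda \<Rightarrow> bool" where
  "one_counter_automaton P \<longleftrightarrow> pushdown_automaton P \<and> stack_alphabet P = {sym_I, sym_Z} \<and>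
     (\<forall>(p, X, a, q, \<beta>) \<in> rules P. \<exists>\<alpha> \<in> lists {sym_I}.
        X = sym_I \<and> \<beta> = \<alpha> \<or> X = sym_Z \<and> \<beta> = \<alpha> @ [sym_Z])"

definition visibly_one_counter_automaton ::
    "'a set \<Rightarrow> 'a set \<Rightarrow> 'a set \<Rightarrow> ('q, counter_symbol, 'a) pda \<Rightarrow> bool" where
  "visibly_one_counter_automaton Act\<^sub>c Act\<^sub>r Act\<^sub>i P \<longleftrightarrow>
     one_counter_automaton P \<and> visibly_pushdown Act\<^sub>c Act\<^sub>r Act\<^sub>i P"


section \<open>Polynomial space and polynomial-time reductions\<close>

text \<open>Deterministic multi-tape Turing machines whose tapes are infinite to the right only; a
  left move on cell 0 leaves the head in place. States and symbols are the numbers below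
  \<open>nstates\<close> and \<open>nsyms\<close>. Symbol 0 is the blank, and 1 and 2 represent the bits
  \<open>False\<close> and \<open>True\<close>. The input is on the first tape and the output of a machine
  that computes a function is on the last one.\<close>

datatype head_move = Move_Left | Move_Stay | Move_Right

record tm =
  ntapes :: nat
  nstates :: nat
  nsyms :: nat
  start_state :: nat
  accept_state :: nat
  reject_state :: nat
  delta :: "nat \<Rightarrow> nat list \<Rightarrow> nat \<times> (nat \<times> head_move) list"

definition turing_machine :: "tm \<Rightarrow> bool" where
  "turing_machine M \<longleftrightarrow> ntapes M \<ge> 1 \<and> nsyms M \<ge> 3 \<and>
     start_state M < nstates M \<and> accept_state M < nstates M \<and> reject_state M < nstates M \<and>
     accept_state M \<noteq> reject_state M \<and>
     (\<forall>q xs. q < nstates M \<and> length xs = ntapes M \<and> (\<forall>x \<in> set xs. x < nsyms M) \<longrightarrow>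
        fst (delta M q xs) < nstates M \<and>
        length (snd (delta M q xs)) = ntapes M \<and>
        (\<forall>(y, d) \<in> set (snd (delta M q xs)). y < nsyms M))"

text \<open>A tape is its contents together with the position of the head.\<close>

type_synonym tape = "(nat \<Rightarrow> nat) \<times> nat"

type_synonym tm_config = "nat \<times> tape list"

fun move_head :: "head_move \<Rightarrow> nat \<Rightarrow> nat" where
  "move_head Move_Left i = i - 1"
| "move_head Move_Stay i = i"
| "move_head Move_Right i = i + 1"

fun tape_action :: "nat \<times> head_move \<Rightarrow> tape \<Rightarrow> tape" where
  "tape_action (y, d) (f, i) = (f(i := y), move_head d i)"

definition halted :: "tm \<Rightarrow> tm_config \<Rightarrow> bool" where
  "halted M c \<longleftrightarrow> fst c \<in> {accept_state M, reject_state M}"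

definition tm_step :: "tm \<Rightarrow> tm_config \<Rightarrow> tm_config" where
  "tm_step M c =
     (if halted M c then c
      else let (q, acts) = delta M (fst c) (map (\<lambda>(f, i). f i) (snd c))
           in (q, map2 tape_action acts (snd c)))"

definition bit_symbol :: "bool \<Rightarrow> nat" where
  "bit_symbol b = (if b then 2 else 1)"

definition initial_config :: "tm \<Rightarrow> bool list \<Rightarrow> tm_config" where
  "initial_config M w =
     (start_state M,
      (\<lambda>i. if i < length w then bit_symbol (w ! i) else 0, 0) #
        replicate (ntapes M - 1) (\<lambda>i. 0, 0))"

definition tm_run :: "tm \<Rightarrow> bool list \<Rightarrow> nat \<Rightarrow> tm_config" where
  "tm_run M w t = (tm_step M ^^ t) (initial_config M w)"

definition decides :: "tm \<Rightarrow> bool list set \<Rightarrow> bool" where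
  "decides M L \<longleftrightarrow> (\<forall>w. \<exists>t. halted M (tm_run M w t) \<and>
     (fst (tm_run M w t) = accept_state M \<longleftrightarrow> w \<in> L))"

definition runs_in_space :: "tm \<Rightarrow> (nat \<Rightarrow> nat) \<Rightarrow> bool" where
  "runs_in_space M s \<longleftrightarrow> (\<forall>w t. \<forall>(f, i) \<in> set (snd (tm_run M w t)). i < s (length w))"

definition PSPACE :: "bool list set set" where
  "PSPACE = {L. \<exists>M (p :: nat poly).
     turing_machine M \<and> decides M L \<and> runs_in_space M (poly p)}"

definition output_is :: "tm_config \<Rightarrow> bool list \<Rightarrow> bool" where
  "output_is c v \<longleftrightarrow> (let f = fst (last (snd c)) in
     (\<forall>i < length v. f i = bit_symbol (v ! i)) \<and> f (length v) = 0)"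

definition polytime_computable :: "(bool list \<Rightarrow> bool list) \<Rightarrow> bool" where
  "polytime_computable g \<longleftrightarrow> (\<exists>M (p :: nat poly). turing_machine M \<and>
     (\<forall>w. \<exists>t \<le> poly p (length w).
        halted M (tm_run M w t) \<and> output_is (tm_run M w t) (g w)))"

definition polytime_reducible :: "bool list set \<Rightarrow> bool list set \<Rightarrow> bool" where
  "polytime_reducible L L' \<longleftrightarrow> (\<exists>g. polytime_computable g \<and> (\<forall>w. w \<in> L \<longleftrightarrow> g w \<in> L'))"

definition PSPACE_hard :: "bool list set \<Rightarrow> bool" where
  "PSPACE_hard L \<longleftrightarrow> (\<forall>L' \<in> PSPACE. polytime_reducible L' L)"

definition PSPACE_complete :: "bool list set \<Rightarrow> bool" where
  "PSPACE_complete L \<longleftrightarrow> L \<in> PSPACE \<and> PSPACE_hard L"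


section \<open>The decision problems\<close>

text \<open>Control states and actions of an automaton that is given as an input are named by
  arbitrary bit strings, and its finite sets are listed in any order. The stack word of a
  configuration is written out symbol by symbol, so \<open>p I\<^sup>n Z\<close> has size linear in \<open>n\<close>.\<close>

type_synonym name = "bool list"

record v1ca_presentation =
  control_list :: "name list"
  call_list :: "name list"
  return_list :: "name list"
  internal_list :: "name list"
  rule_list :: "(name, counter_symbol, name) rule list"

definition presented_pda :: "v1ca_presentation \<Rightarrow> (name, counter_symbol, name) pda" where
  "presented_pda D = \<lparr> control = set (control_list D), stack_alphabet = {sym_I, sym_Z},
     actions = set (call_list D) \<union> set (return_list D) \<union> set (internal_list D),
     rules = set (rule_list D) \<rparr>"

definition presents_v1ca :: "v1ca_presentation \<Rightarrow> bool" where
  "presents_v1ca D \<longleftrightarrow> visibly_one_counter_automaton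
     (set (call_list D)) (set (return_list D)) (set (internal_list D)) (presented_pda D)"

text \<open>Each list entry is preceded by \<open>True\<close> and the list is closed by \<open>False\<close>, which
  makes all the codes below self-delimiting (see \<open>enc_instance_inj\<close>).\<close>

fun enc_list :: "('b \<Rightarrow> bool list) \<Rightarrow> 'b list \<Rightarrow> bool list" where
  "enc_list e [] = [False]"
| "enc_list e (x # xs) = True # e x @ enc_list e xs"

definition enc_name :: "name \<Rightarrow> bool list" where
  "enc_name = enc_list (\<lambda>b. [b])"

fun enc_symbol :: "counter_symbol \<Rightarrow> bool list" where
  "enc_symbol sym_I = [True]"
| "enc_symbol sym_Z = [False]"

fun enc_rule :: "(name, counter_symbol, name) rule \<Rightarrow> bool list" where
  "enc_rule (p, X, a, q, \<alpha>) =
     enc_name p @ enc_symbol X @ enc_name a @ enc_name q @ enc_list enc_symbol \<alpha>"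

fun enc_config :: "(name, counter_symbol) pda_config \<Rightarrow> bool list" where
  "enc_config (p, \<alpha>) = enc_name p @ enc_list enc_symbol \<alpha>"

definition enc_presentation :: "v1ca_presentation \<Rightarrow> bool list" where
  "enc_presentation D =
     enc_list enc_name (control_list D) @ enc_list enc_name (call_list D) @
     enc_list enc_name (return_list D) @ enc_list enc_name (internal_list D) @
     enc_list enc_rule (rule_list D)"

definition enc_instance :: "v1ca_presentation \<Rightarrow> (name, counter_symbol) pda_config \<Rightarrow>
    (name, counter_symbol) pda_config \<Rightarrow> bool list" where
  "enc_instance D c d = enc_presentation D @ enc_config c @ enc_config d"

definition v1ca_problem ::
    "((name, counter_symbol) pda_config, name) behavioural_relation \<Rightarrow> bool list set" where
  "v1ca_problem rel = {enc_instance D c d | D c d. presents_v1ca D \<and>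
     c \<in> configurations (presented_pda D) \<and> d \<in> configurations (presented_pda D) \<and>
     rel (pda_lts (presented_pda D)) c d}"

definition self_delimiting :: "('b \<Rightarrow> bool list) \<Rightarrow> bool" where
  "self_delimiting e \<longleftrightarrow> (\<forall>x y u v. e x @ u = e y @ v \<longrightarrow> x = y \<and> u = v)"

lemma self_delimitingD: "self_delimiting e \<Longrightarrow> e x @ u = e y @ v \<longleftrightarrow> x = y \<and> u = v"
  by (auto simp: self_delimiting_def)

lemma self_delimiting_enc_list:
  assumes "self_delimiting e"
  shows "self_delimiting (enc_list e)"
proof -
  have "enc_list e xs @ u = enc_list e ys @ v \<longrightarrow> xs = ys \<and> u = v" for xs ys u v
  proof (induction xs arbitrary: ys)
    case Nil
    show ?case by (cases ys) auto
  next
    case (Cons x xs)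
    show ?case using Cons.IH by (cases ys) (auto simp: self_delimitingD[OF assms])
  qed
  then show ?thesis by (simp add: self_delimiting_def)
qed

lemma self_delimiting_enc_name: "self_delimiting enc_name"
  unfolding enc_name_def by (rule self_delimiting_enc_list) (simp add: self_delimiting_def)

lemma self_delimiting_enc_symbol: "self_delimiting enc_symbol"
proof -
  have "enc_symbol x @ u = enc_symbol y @ v \<longrightarrow> x = y \<and> u = v" for x y u v
    by (cases x; cases y) auto
  then show ?thesis by (simp add: self_delimiting_def)
qed

lemmas self_delimiting_basic =
  self_delimitingD[OF self_delimiting_enc_name]
  self_delimitingD[OF self_delimiting_enc_symbol]
  self_delimitingD[OF self_delimiting_enc_list[OF self_delimiting_enc_name]]
  self_delimitingD[OF self_delimiting_enc_list[OF self_delimiting_enc_symbol]]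

lemma self_delimiting_enc_rule: "self_delimiting enc_rule"
  by (auto simp: self_delimiting_def self_delimiting_basic)

lemma self_delimiting_enc_config: "self_delimiting enc_config"
  by (auto simp: self_delimiting_def self_delimiting_basic)

lemma enc_instance_inj:
  assumes "enc_instance D c d = enc_instance D' c' d'"
  shows "D = D' \<and> c = c' \<and> d = d'"
proof -
  have "enc_config c @ enc_config d = enc_config c' @ enc_config d' \<longleftrightarrow> c = c' \<and> d = d'"
    using self_delimitingD[OF self_delimiting_enc_config, of d "[]" d' "[]"]
    by (simp add: self_delimitingD[OF self_delimiting_enc_config])
  then show ?thesis
    using assms by (cases D; cases D')
      (simp add: enc_instance_def enc_presentation_def self_delimiting_basic
        self_delimitingD[OF self_delimiting_enc_list[OF self_delimiting_enc_rule]])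
qed

end

theory Submission
  imports Defs
begin

text \<open>Actions determine how the counter changes, so two related configurations keep the difference of
  their counters constant. A relation of one of the nine kinds is therefore a sequence of sets of pairs of
  control states, one for each counter value, subject to conditions on three consecutive sets; such a
  sequence is an infinite path in a graph of exponential size with edges that are easy to check, and
  Savitch's algorithm decides its existence in polynomial space.

  Conversely, "cell \<open>j\<close> contains \<open>x\<close> at time \<open>n\<close>" is a claim about a space-bounded computation
  that reduces to finitely many claims about time \<open>n - 1\<close>. The attacker sets the counter to a time
  at which the machine is claimed to reject and defends this claim by choosing justifications, the
  defender chooses the part to be checked next, and each such round decrements the counter. If the
  machine accepts, the initial configurations are bisimilar, otherwise the first one is not simulated
  by the second one, which settles all nine relations at once.

  Turing machines are obtained from a stack language whose continuations are the control states; on top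
  of it, polynomial-time functions between types encoded by binary trees are closed under composition,
  case distinction and size-bounded folds.\<close>

section \<open>A stack language compiled to Turing machines\<close>

text \<open>Levels are unbounded, but the conditions on them are local. With at most 2^n nodes, an
  infinite path exists iff there is a walk of 2^(n+1) steps between two added end points, and walks
  of power-of-two length are what midpoint recursion decides without storing them. The lowest level
  is special: the common symbols I of the two stacks are used up, and no return can be answered
  there.

  A space-bounded machine may run for exponentially many steps, but the automaton describes a single
  step, since the counter holds the time. The claim concerns rejection because an attacker can
  exhibit a time, not the absence of one; for a decider, no rejecting time means acceptance. The
  defender can choose in a game in which it merely answers because every attacker move that ignores
  its choice can be answered so that both sides become equal.

  On the machine side two interfaces hide the tapes: a program on trees is a polynomial-time
  function, and a loop around such a function decides a language in polynomial space as long as its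
  states stay small, however often it is repeated.\<close>

text \<open>Tape 0 is the input, from which one can only pop; tapes 1 to 4 are stacks; tape 5 is the
  output, to which one can only push. \<open>Poke\<close> is the second half of \<open>Push\<close> (move right,
  then write) and occurs in continuations only.\<close>

datatype com =
    Push nat nat | Poke nat nat | Pop nat | Seq com com
  | Cond nat "nat set" com com | Loop nat "nat set" com | Accept | Reject

type_synonym store = "nat \<Rightarrow> nat list"

fun top_sym :: "nat list \<Rightarrow> nat" where
  "top_sym [] = 0"
| "top_sym (x # _) = x"

inductive bs :: "com \<Rightarrow> store \<Rightarrow> nat \<Rightarrow> store \<Rightarrow> bool" where
  bs_Push: "bs (Push x y) S 2 (S(x := y # S x))"
| bs_Pop: "bs (Pop x) S 1 (S(x := tl (S x)))"
| bs_Seq: "bs c1 S t1 S1 \<Longrightarrow> bs c2 S1 t2 S2 \<Longrightarrow> bs (Seq c1 c2) S (Suc (t1 + t2)) S2"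
| bs_CondT: "top_sym (S x) \<in> P \<Longrightarrow> bs c1 S t S' \<Longrightarrow> bs (Cond x P c1 c2) S (Suc t) S'"
| bs_CondF: "top_sym (S x) \<notin> P \<Longrightarrow> bs c2 S t S' \<Longrightarrow> bs (Cond x P c1 c2) S (Suc t) S'"
| bs_LoopF: "top_sym (S x) \<notin> P \<Longrightarrow> bs (Loop x P c) S 1 S"
| bs_LoopT: "top_sym (S x) \<in> P \<Longrightarrow> bs c S t1 S1 \<Longrightarrow> bs (Loop x P c) S1 t2 S2 \<Longrightarrow>
    bs (Loop x P c) S (Suc (t1 + t2)) S2"

fun wf_com :: "com \<Rightarrow> bool" where
  "wf_com (Push x y) \<longleftrightarrow> 1 \<le> x \<and> x \<le> 5 \<and> y < 4"
| "wf_com (Poke x y) \<longleftrightarrow> 1 \<le> x \<and> x \<le> 5 \<and> y < 4"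
| "wf_com (Pop x) \<longleftrightarrow> x < 5"
| "wf_com (Seq c1 c2) \<longleftrightarrow> wf_com c1 \<and> wf_com c2"
| "wf_com (Cond x P c1 c2) \<longleftrightarrow> x < 5 \<and> wf_com c1 \<and> wf_com c2"
| "wf_com (Loop x P c) \<longleftrightarrow> x < 5 \<and> wf_com c"
| "wf_com Accept \<longleftrightarrow> True"
| "wf_com Reject \<longleftrightarrow> True"

text \<open>The control states of the compiled machine are continuations, of which a command has only
  finitely many.\<close>

fun nxt :: "com list \<Rightarrow> (nat \<Rightarrow> nat) \<Rightarrow> com list \<times> (nat \<times> nat \<times> head_move) option" where
  "nxt [] r = ([Reject], None)"
| "nxt (Push x y # \<kappa>) r =
     (if x = 5 then (\<kappa>, Some (x, y, Move_Right)) else (Poke x y # \<kappa>, Some (x, r x, Move_Right)))"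
| "nxt (Poke x y # \<kappa>) r = (\<kappa>, Some (x, y, Move_Stay))"
| "nxt (Pop x # \<kappa>) r =
     (\<kappa>, Some (if x = 0 then (x, r x, if r x = 0 then Move_Stay else Move_Right)
       else (x, 0, Move_Left)))"
| "nxt (Seq c1 c2 # \<kappa>) r = (c1 # c2 # \<kappa>, None)"
| "nxt (Cond x P c1 c2 # \<kappa>) r = ((if r x \<in> P then c1 else c2) # \<kappa>, None)"
| "nxt (Loop x P c # \<kappa>) r = (if r x \<in> P then c # Loop x P c # \<kappa> else \<kappa>, None)"
| "nxt (Accept # \<kappa>) r = ([Accept], None)"
| "nxt (Reject # \<kappa>) r = ([Reject], None)"

text \<open>The continuations met while \<open>c\<close> runs on top of \<open>\<kappa>\<close>. The
  exit \<open>\<kappa>\<close> is included, although its own successors are not: closure under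
  \<open>nxt\<close> holds up to this exit, and \<open>cstates\<close> closes the gap at the
  outermost level, where the exit is \<open>[]\<close>.\<close>

fun conts :: "com \<Rightarrow> com list \<Rightarrow> com list set" where
  "conts (Push x y) \<kappa> = {Push x y # \<kappa>, Poke x y # \<kappa>, \<kappa>}"
| "conts (Poke x y) \<kappa> = {Poke x y # \<kappa>, \<kappa>}"
| "conts (Pop x) \<kappa> = {Pop x # \<kappa>, \<kappa>}"
| "conts (Seq c1 c2) \<kappa> = insert (Seq c1 c2 # \<kappa>) (conts c1 (c2 # \<kappa>) \<union> conts c2 \<kappa>)"
| "conts (Cond x P c1 c2) \<kappa> = insert (Cond x P c1 c2 # \<kappa>) (conts c1 \<kappa> \<union> conts c2 \<kappa>)"
| "conts (Loop x P c) \<kappa> = insert (Loop x P c # \<kappa>) (insert \<kappa> (conts c (Loop x P c # \<kappa>)))"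
| "conts Accept \<kappa> = {Accept # \<kappa>, [Accept], \<kappa>}"
| "conts Reject \<kappa> = {Reject # \<kappa>, [Reject], \<kappa>}"

lemma finite_conts: "finite (conts c \<kappa>)"
  by (induction c arbitrary: \<kappa>) auto

lemma conts_self: "c # \<kappa> \<in> conts c \<kappa>"
  by (cases c) auto

lemma conts_closed: "k \<in> conts c \<kappa> \<Longrightarrow> k \<noteq> \<kappa> \<Longrightarrow> fst (nxt k r) \<in> conts c \<kappa>"
proof (induction c arbitrary: \<kappa>)
  case (Seq c1 c2)
  then show ?case using conts_self[of c1 "c2 # \<kappa>"]
    by (cases "k = c2 # \<kappa>") (auto simp: conts_self)
next
  case (Cond x P c1 c2)
  then show ?case using conts_self by auto
next
  case (Loop x P c)
  then show ?case using conts_self by (cases "k = Loop x P c # \<kappa>") auto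
qed auto

lemma wf_conts: "k \<in> conts c \<kappa> \<Longrightarrow> wf_com c \<Longrightarrow> list_all wf_com \<kappa> \<Longrightarrow> list_all wf_com k"
  by (induction c arbitrary: \<kappa>) fastforce+

text \<open>The two halting continuations are added even if \<open>c\<close> never mentions them,
  since a machine needs distinct accepting and rejecting states; the empty continuation steps to
  \<open>[Reject]\<close>.\<close>

definition cstates :: "com \<Rightarrow> com list set" where
  "cstates c = conts c [] \<union> {[], [Accept], [Reject]}"

text \<open>Machine states have to be numbers below \<open>nstates\<close>. Any bijection serves,
  because the numbers are only compared for equality and decoded again.\<close>

definition cnum :: "com \<Rightarrow> com list \<Rightarrow> nat" where
  "cnum c = (SOME h. bij_betw h (cstates c) {0..<card (cstates c)})"

definition compile :: "com \<Rightarrow> tm" where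
  "compile c =
     \<lparr> ntapes = 6, nstates = card (cstates c), nsyms = 4, start_state = cnum c [c],
       accept_state = cnum c [Accept], reject_state = cnum c [Reject],
       delta = (\<lambda>q syms.
         let (\<kappa>, a) = nxt (inv_into (cstates c) (cnum c) q) (\<lambda>i. syms ! i)
         in (cnum c \<kappa>,
             map (\<lambda>i. case a of None \<Rightarrow> (syms ! i, Move_Stay)
                 | Some (x, y, d) \<Rightarrow> if i = x then (y, d) else (syms ! i, Move_Stay)) [0..<6])) \<rparr>"

lemma finite_cstates: "finite (cstates c)"
  by (simp add: cstates_def finite_conts)

lemma cnum_bij: "bij_betw (cnum c) (cstates c) {0..<card (cstates c)}"
  unfolding cnum_def by (rule someI_ex[OF ex_bij_betw_finite_nat[OF finite_cstates]])

lemma cnum_inj: "\<kappa> \<in> cstates c \<Longrightarrow> \<kappa>' \<in> cstates c \<Longrightarrow> cnum c \<kappa> = cnum c \<kappa>' \<longleftrightarrow> \<kappa> = \<kappa>'"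
  using cnum_bij[of c] by (auto simp: bij_betw_def inj_on_eq_iff)

lemma cnum_less: "\<kappa> \<in> cstates c \<Longrightarrow> cnum c \<kappa> < card (cstates c)"
  using cnum_bij[of c] by (auto simp: bij_betw_def)

lemma cnum_inv: "\<kappa> \<in> cstates c \<Longrightarrow> inv_into (cstates c) (cnum c) (cnum c \<kappa>) = \<kappa>"
  using cnum_bij[of c] by (auto simp: bij_betw_def)

lemma cstates_basic [simp]:
  "[] \<in> cstates c" "[Accept] \<in> cstates c" "[Reject] \<in> cstates c" "[c] \<in> cstates c"
  by (auto simp: cstates_def conts_self)

lemma cstates_closed: "\<kappa> \<in> cstates c \<Longrightarrow> fst (nxt \<kappa> r) \<in> cstates c"
  using conts_closed[of \<kappa> c "[]" r] by (cases "\<kappa> = []") (auto simp: cstates_def)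

lemma wf_cstates: "wf_com c \<Longrightarrow> \<kappa> \<in> cstates c \<Longrightarrow> list_all wf_com \<kappa>"
  using wf_conts[of \<kappa> c "[]"] by (auto simp: cstates_def)

lemma nxt_sym_bound:
  assumes "nxt \<kappa> r = (\<kappa>', Some (x, y, d))" "list_all wf_com \<kappa>" "\<forall>x<6. r x < 4"
  shows "x < 6 \<and> y < 4"
  using assms by (cases "(\<kappa>, r)" rule: nxt.cases) (auto split: if_splits)

lemma turing_machine_compile:
  assumes "wf_com c"
  shows "turing_machine (compile c)"
proof -
  have "fst (delta (compile c) q xs) < nstates (compile c) \<and>
        length (snd (delta (compile c) q xs)) = 6 \<and>
        (\<forall>(y, d) \<in> set (snd (delta (compile c) q xs)). y < 4)"
    if q: "q < card (cstates c)" and len: "length xs = 6" and sy: "\<forall>x\<in>set xs. x < 4" for q xs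
  proof -
    define \<kappa> where "\<kappa> = inv_into (cstates c) (cnum c) q"
    have \<kappa>: "\<kappa> \<in> cstates c"
      using q cnum_bij[of c] unfolding \<kappa>_def
      by (metis atLeastLessThan_iff bij_betw_def inv_into_into le0)
    obtain \<kappa>' a where n: "nxt \<kappa> ((!) xs) = (\<kappa>', a)" by fastforce
    have \<kappa>': "\<kappa>' \<in> cstates c" using cstates_closed[OF \<kappa>, of "(!) xs"] n by simp
    have r: "\<forall>x<6. xs ! x < 4" using sy len by (metis nth_mem)
    have a: "a = Some (x, y, d) \<Longrightarrow> x < 6 \<and> y < 4" for x y d
      using nxt_sym_bound[of \<kappa> "(!) xs" \<kappa>' x y d] n wf_cstates[OF assms \<kappa>] r by simp
    show ?thesis
      using n \<kappa>' a r
      by (auto simp: compile_def \<kappa>_def[symmetric] cnum_less split: option.splits if_splits)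
  qed
  moreover have "cnum c [Accept] \<noteq> cnum c [Reject]" by (simp add: cnum_inj)
  moreover have "ntapes (compile c) = 6" "nsyms (compile c) = 4"
      "nstates (compile c) = card (cstates c)" "start_state (compile c) = cnum c [c]"
      "accept_state (compile c) = cnum c [Accept]" "reject_state (compile c) = cnum c [Reject]"
    by (simp_all add: compile_def)
  ultimately show ?thesis
    unfolding turing_machine_def by (auto simp: cnum_less; blast)
qed

section \<open>Stores represented on tapes\<close>

definition rd :: "tape list \<Rightarrow> nat \<Rightarrow> nat" where
  "rd T i = fst (T ! i) (snd (T ! i))"

lemma halted_compile:
  "\<kappa> \<in> cstates c \<Longrightarrow> halted (compile c) (cnum c \<kappa>, T) \<longleftrightarrow> \<kappa> = [Accept] \<or> \<kappa> = [Reject]"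
  by (simp add: halted_def compile_def cnum_inj)

text \<open>The transition function sees the list of six scanned symbols, and the simulation uses
  \<open>rd\<close>; the two agree below 6 only, and a well-formed command inspects no other
  tape.\<close>

lemma nxt_cong: "list_all wf_com \<kappa> \<Longrightarrow> (\<And>i. i < 6 \<Longrightarrow> r i = r' i) \<Longrightarrow> nxt \<kappa> r = nxt \<kappa> r'"
  by (cases "(\<kappa>, r)" rule: nxt.cases) auto

lemma step_compile:
  assumes "wf_com c" "\<kappa> \<in> cstates c" "\<kappa> \<noteq> [Accept]" "\<kappa> \<noteq> [Reject]" "length T = 6"
    "nxt \<kappa> (rd T) = (\<kappa>', a)"
  shows "tm_step (compile c) (cnum c \<kappa>, T) =
    (cnum c \<kappa>', case a of None \<Rightarrow> T | Some (x, y, d) \<Rightarrow> T[x := tape_action (y, d) (T ! x)])"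
proof -
  let ?syms = "map (\<lambda>(f, i). f i) T"
  have sy: "?syms ! i = rd T i" if "i < 6" for i
    using that assms(5) by (simp add: rd_def case_prod_beta)
  have "nxt \<kappa> ((!) ?syms) = (\<kappa>', a)"
    using nxt_cong[OF wf_cstates[OF assms(1,2)], of "(!) ?syms" "rd T"] sy assms(6) by simp
  then have d: "delta (compile c) (cnum c \<kappa>) ?syms = (cnum c \<kappa>',
      map (\<lambda>i. case a of None \<Rightarrow> (?syms ! i, Move_Stay)
        | Some (x, y, d) \<Rightarrow> if i = x then (y, d) else (?syms ! i, Move_Stay)) [0..<6])"
    by (simp add: compile_def cnum_inv[OF assms(2)])
  have stay: "tape_action (rd T i, Move_Stay) (T ! i) = T ! i" for i
    by (cases "T ! i") (simp add: rd_def)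
  have "map2 tape_action (map (\<lambda>i. case a of None \<Rightarrow> (?syms ! i, Move_Stay)
        | Some (x, y, d) \<Rightarrow> if i = x then (y, d) else (?syms ! i, Move_Stay)) [0..<6]) T =
      (case a of None \<Rightarrow> T | Some (x, y, d) \<Rightarrow> T[x := tape_action (y, d) (T ! x)])"
    using assms(5) stay sy
    by (intro nth_equalityI) (auto simp: nth_list_update split: option.splits)
  then show ?thesis
    using halted_compile[OF assms(2), of T] assms(3,4) by (simp add: tm_step_def d)
qed

text \<open>The equation \<open>i + length xs = n\<close> fixes the head position, so the head on
  the input never exceeds the input length. As \<open>0\<close> does not occur in the input, a blank
  under the head signals that it has been used up.\<close>

fun in_rep :: "nat \<Rightarrow> nat list \<Rightarrow> tape \<Rightarrow> bool" where
  "in_rep n xs (f, i) \<longleftrightarrow> i + length xs = n \<and> 0 \<notin> set xs \<and>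
     (\<forall>j. f (i + j) = (if j < length xs then xs ! j else 0))"

text \<open>Cell 0 stays blank and serves as bottom marker: an empty stack is read as
  \<open>0\<close>, and a pop there writes a blank and stays in place. Cells beyond the head are
  unconstrained, because a push overwrites them before they are read.\<close>

fun stack_rep :: "nat list \<Rightarrow> tape \<Rightarrow> bool" where
  "stack_rep xs (f, i) \<longleftrightarrow> i = length xs \<and> f 0 = 0 \<and> (\<forall>j<length xs. f (Suc j) = rev xs ! j)"

text \<open>The head rests on the next free cell, so a push takes one step. This cell and everything
  to its right are blank, which supplies the terminator that \<open>output_is\<close> asks
  for.\<close>

fun out_rep :: "nat list \<Rightarrow> tape \<Rightarrow> bool" where
  "out_rep xs (f, i) \<longleftrightarrow> i = length xs \<and> (\<forall>j. f j = (if j < length xs then rev xs ! j else 0))"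

definition rep :: "nat \<Rightarrow> store \<Rightarrow> tape list \<Rightarrow> bool" where
  "rep n S T \<longleftrightarrow> length T = 6 \<and> in_rep n (S 0) (T ! 0) \<and>
     (\<forall>x\<in>{1..4}. stack_rep (S x) (T ! x)) \<and> out_rep (S 5) (T ! 5)"

lemma in_rep_top: "in_rep n xs (f, i) \<Longrightarrow> f i = top_sym xs"
  by (cases xs) (auto dest: spec[of _ 0])

lemma stack_rep_top: "stack_rep xs (f, i) \<Longrightarrow> f i = top_sym xs"
  by (cases xs) (auto simp: nth_append)

lemma rep_top:
  assumes "rep n S T" "x < 5"
  shows "rd T x = top_sym (S x)"
proof (cases "x = 0")
  case True
  then show ?thesis using assms in_rep_top[of n "S 0" "fst (T ! 0)" "snd (T ! 0)"]
    by (simp add: rep_def rd_def)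
next
  case False
  then show ?thesis using assms stack_rep_top[of "S x" "fst (T ! x)" "snd (T ! x)"]
    by (auto simp: rep_def rd_def)
qed

lemma in_rep_pop:
  assumes "in_rep n xs t"
  shows "in_rep n (tl xs)
    (tape_action (fst t (snd t), if fst t (snd t) = 0 then Move_Stay else Move_Right) t)"
proof (cases t)
  case (Pair f i)
  show ?thesis
  proof (cases xs)
    case Nil
    then show ?thesis using assms Pair in_rep_top[of n xs f i] by auto
  next
    case (Cons y ys)
    have "f (i + Suc j) = (if Suc j < length xs then xs ! Suc j else 0)" for j
      using assms Pair by (simp only: in_rep.simps)
    then show ?thesis using assms Pair Cons in_rep_top[of n xs f i] by auto
  qed
qed

lemma stack_rep_pop: "stack_rep xs t \<Longrightarrow> stack_rep (tl xs) (tape_action (0, Move_Left) t)"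
  by (cases t; cases xs) (auto simp: nth_append)

lemma stack_rep_push:
  "stack_rep xs t \<Longrightarrow>
    stack_rep (y # xs) (tape_action (y, Move_Stay) (tape_action (fst t (snd t), Move_Right) t))"
  by (cases t) (auto simp: nth_append less_Suc_eq)

lemma out_rep_push: "out_rep xs t \<Longrightarrow> out_rep (y # xs) (tape_action (y, Move_Right) t)"
  by (cases t) (auto simp: nth_append less_Suc_eq)

text \<open>Induction on the derivation with an arbitrary continuation: a command runs until its
  continuation is all that remains. The cost of each rule covers the machine steps that it causes.
  The inclusion in \<open>cstates c0\<close> guarantees that all intermediate continuations are
  states of the machine compiled from \<open>c0\<close>.\<close>

lemma bs_compile:
  assumes "bs c S t S'" "wf_com c0" "wf_com c" "conts c \<kappa> \<subseteq> cstates c0" "rep n S T"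
  shows "\<exists>t' T'. t' \<le> t \<and> (tm_step (compile c0) ^^ t') (cnum c0 (c # \<kappa>), T) = (cnum c0 \<kappa>, T') \<and>
    rep n S' T'"
  using assms
proof (induction arbitrary: \<kappa> T rule: bs.induct)
  case (bs_Push x y S)
  let ?M = "tm_step (compile c0)"
  have len: "length T = 6" using bs_Push by (simp add: rep_def)
  show ?case
  proof (cases "x = 5")
    case True
    have "?M (cnum c0 (Push x y # \<kappa>), T) = (cnum c0 \<kappa>, T[x := tape_action (y, Move_Right) (T ! x)])"
      using bs_Push True len by (subst step_compile) auto
    moreover have "rep n (S(x := y # S x)) (T[x := tape_action (y, Move_Right) (T ! x)])"
      using bs_Push(4) True out_rep_push by (auto simp: rep_def)
    ultimately show ?thesis
      by (intro exI[of _ 1] exI[of _ "T[x := tape_action (y, Move_Right) (T ! x)]"])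
        (simp add: fun_upd_def)
  next
    case False
    define T1 where "T1 = T[x := tape_action (rd T x, Move_Right) (T ! x)]"
    have x: "1 \<le> x" "x \<le> 4" using bs_Push(2) False by auto
    have 1: "?M (cnum c0 (Push x y # \<kappa>), T) = (cnum c0 (Poke x y # \<kappa>), T1)"
      using bs_Push False len by (subst step_compile) (auto simp: T1_def)
    have 2: "?M (cnum c0 (Poke x y # \<kappa>), T1) =
        (cnum c0 \<kappa>, T1[x := tape_action (y, Move_Stay) (T1 ! x)])"
      using bs_Push len by (subst step_compile) (auto simp: T1_def)
    have "rep n (S(x := y # S x)) (T1[x := tape_action (y, Move_Stay) (T1 ! x)])"
      using bs_Push(4) x stack_rep_push[of "S x" "T ! x" y]
      by (auto simp: rep_def T1_def rd_def nth_list_update)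
    then show ?thesis using 1 2 by (intro exI[of _ 2]) (auto simp: numeral_2_eq_2 fun_upd_def)
  qed
next
  case (bs_Pop x S)
  have len: "length T = 6" using bs_Pop by (simp add: rep_def)
  have x: "x < 5" using bs_Pop by simp
  define act where "act = (if x = 0 then (rd T x, if rd T x = 0 then Move_Stay else Move_Right)
    else (0, Move_Left))"
  have "tm_step (compile c0) (cnum c0 (Pop x # \<kappa>), T) = (cnum c0 \<kappa>, T[x := tape_action act (T ! x)])"
    using bs_Pop len by (subst step_compile) (auto simp: act_def)
  moreover have "rep n (S(x := tl (S x))) (T[x := tape_action act (T ! x)])"
    using bs_Pop(4) x in_rep_pop[of n "S x" "T ! x"] stack_rep_pop[of "S x" "T ! x"]
    by (auto simp: rep_def act_def rd_def nth_list_update)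
  ultimately show ?case by (intro exI[of _ 1]) (auto simp: fun_upd_def)
next
  case (bs_Seq c1 S t1 S1 c2 t2 S2)
  let ?M = "tm_step (compile c0)"
  have sub: "conts c1 (c2 # \<kappa>) \<subseteq> cstates c0" "conts c2 \<kappa> \<subseteq> cstates c0" using bs_Seq.prems by auto
  have len: "length T = 6" using bs_Seq by (simp add: rep_def)
  have 0: "?M (cnum c0 (Seq c1 c2 # \<kappa>), T) = (cnum c0 (c1 # c2 # \<kappa>), T)"
    using bs_Seq.prems len by (subst step_compile) auto
  obtain t' T1 where 1: "t' \<le> t1" "(?M ^^ t') (cnum c0 (c1 # c2 # \<kappa>), T) = (cnum c0 (c2 # \<kappa>), T1)"
      "rep n S1 T1"
    using bs_Seq.IH(1)[OF _ _ sub(1) bs_Seq.prems(4)] bs_Seq.prems by auto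
  obtain t'' T2 where 2: "t'' \<le> t2" "(?M ^^ t'') (cnum c0 (c2 # \<kappa>), T1) = (cnum c0 \<kappa>, T2)" "rep n S2 T2"
    using bs_Seq.IH(2)[OF _ _ sub(2) 1(3)] bs_Seq.prems by auto
  have "(?M ^^ (t'' + t' + 1)) (cnum c0 (Seq c1 c2 # \<kappa>), T) = (cnum c0 \<kappa>, T2)"
    unfolding funpow_add using 0 1(2) 2(2) by simp
  then show ?case using 1(1) 2(1,3) by (intro exI[of _ "t'' + t' + 1"] exI[of _ T2]) auto
next
  case (bs_CondT S x P c1 t S' c2)
  let ?M = "tm_step (compile c0)"
  have 0: "?M (cnum c0 (Cond x P c1 c2 # \<kappa>), T) = (cnum c0 (c1 # \<kappa>), T)"
    using bs_CondT.prems bs_CondT.hyps rep_top[OF bs_CondT.prems(4), of x]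
    by (subst step_compile) (auto simp: rep_def)
  obtain t' T1 where 1: "t' \<le> t" "(?M ^^ t') (cnum c0 (c1 # \<kappa>), T) = (cnum c0 \<kappa>, T1)" "rep n S' T1"
    using bs_CondT.IH[OF _ _ _ bs_CondT.prems(4), of \<kappa>] bs_CondT.prems by auto
  have "(?M ^^ (t' + 1)) (cnum c0 (Cond x P c1 c2 # \<kappa>), T) = (cnum c0 \<kappa>, T1)"
    unfolding funpow_add using 0 1(2) by simp
  then show ?case using 1 by (intro exI[of _ "t' + 1"] exI[of _ T1]) auto
next
  case (bs_CondF S x P c2 t S' c1)
  let ?M = "tm_step (compile c0)"
  have 0: "?M (cnum c0 (Cond x P c1 c2 # \<kappa>), T) = (cnum c0 (c2 # \<kappa>), T)"
    using bs_CondF.prems bs_CondF.hyps rep_top[OF bs_CondF.prems(4), of x]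
    by (subst step_compile) (auto simp: rep_def)
  obtain t' T1 where 1: "t' \<le> t" "(?M ^^ t') (cnum c0 (c2 # \<kappa>), T) = (cnum c0 \<kappa>, T1)" "rep n S' T1"
    using bs_CondF.IH[OF _ _ _ bs_CondF.prems(4), of \<kappa>] bs_CondF.prems by auto
  have "(?M ^^ (t' + 1)) (cnum c0 (Cond x P c1 c2 # \<kappa>), T) = (cnum c0 \<kappa>, T1)"
    unfolding funpow_add using 0 1(2) by simp
  then show ?case using 1 by (intro exI[of _ "t' + 1"] exI[of _ T1]) auto
next
  case (bs_LoopF S x P c)
  have "tm_step (compile c0) (cnum c0 (Loop x P c # \<kappa>), T) = (cnum c0 \<kappa>, T)"
    using bs_LoopF rep_top[OF bs_LoopF.prems(4), of x]
    by (subst step_compile) (auto simp: rep_def)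
  then show ?case using bs_LoopF.prems(4) by (intro exI[of _ 1] exI[of _ T]) auto
next
  case (bs_LoopT S x P c t1 S1 t2 S2)
  let ?M = "tm_step (compile c0)" and ?L = "Loop x P c # \<kappa>"
  have sub: "conts c ?L \<subseteq> cstates c0" using bs_LoopT.prems by auto
  have 0: "?M (cnum c0 ?L, T) = (cnum c0 (c # ?L), T)"
    using bs_LoopT.prems bs_LoopT.hyps rep_top[OF bs_LoopT.prems(4), of x]
    by (subst step_compile) (auto simp: rep_def)
  obtain t' T1 where 1: "t' \<le> t1" "(?M ^^ t') (cnum c0 (c # ?L), T) = (cnum c0 ?L, T1)" "rep n S1 T1"
    using bs_LoopT.IH(1)[OF _ _ sub bs_LoopT.prems(4)] bs_LoopT.prems by auto
  obtain t'' T2 where 2: "t'' \<le> t2" "(?M ^^ t'') (cnum c0 ?L, T1) = (cnum c0 \<kappa>, T2)" "rep n S2 T2"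
    using bs_LoopT.IH(2)[OF _ _ _ 1(3)] bs_LoopT.prems by blast
  have "(?M ^^ (t'' + t' + 1)) (cnum c0 ?L, T) = (cnum c0 \<kappa>, T2)"
    unfolding funpow_add using 0 1(2) 2(2) by simp
  then show ?case using 1(1) 2(1,3) by (intro exI[of _ "t'' + t' + 1"] exI[of _ T2]) auto
qed

section \<open>Head positions as a measure of space\<close>

definition heads_le :: "nat \<Rightarrow> tape list \<Rightarrow> bool" where
  "heads_le B T \<longleftrightarrow> (\<forall>(f, i) \<in> set T. i \<le> B)"

lemma heads_le_mono: "heads_le B T \<Longrightarrow> B \<le> B' \<Longrightarrow> heads_le B' T"
  by (fastforce simp: heads_le_def)

lemma heads_le_step:
  assumes "heads_le B (snd c)"
  shows "heads_le (Suc B) (snd (tm_step M c))"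
proof (cases "halted M c")
  case True
  then show ?thesis using heads_le_mono[OF assms] by (simp add: tm_step_def)
next
  case False
  obtain q acts where d: "delta M (fst c) (map (\<lambda>(f, i). f i) (snd c)) = (q, acts)" by fastforce
  have "snd (tape_action a t) \<le> Suc (snd t)" for a t
    by (cases a; cases t; cases "snd a") auto
  moreover have "snd t \<le> B" if "(a, t) \<in> set (zip acts (snd c))" for a t
    using that assms by (cases t) (auto simp: heads_le_def dest!: set_zip_rightD)
  ultimately have "snd (tape_action a t) \<le> Suc B" if "(a, t) \<in> set (zip acts (snd c))" for a t
    using that by (meson Suc_le_mono le_trans)
  then show ?thesis using False
    by (force simp: tm_step_def d heads_le_def)
qed

lemma heads_le_steps: "heads_le B (snd c) \<Longrightarrow> heads_le (B + n) (snd ((tm_step M ^^ n) c))"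
proof (induction n)
  case (Suc n)
  then show ?case using heads_le_step[of "B + n" "(tm_step M ^^ n) c"] by simp
qed simp

definition initial_store :: "bool list \<Rightarrow> store" where
  "initial_store w = (\<lambda>_. [])(0 := map bit_symbol w)"

lemma rep_initial: "rep (length w) (initial_store w) (snd (initial_config (compile c) w))"
  by (auto simp: rep_def initial_config_def initial_store_def compile_def nth_Cons' bit_symbol_def)

lemma rep_heads:
  assumes "rep n S T" "n \<le> B" "\<forall>x\<in>{1..5}. length (S x) \<le> B"
  shows "heads_le B T"
proof -
  have "snd (T ! x) \<le> B" if "x < 6" for x
  proof -
    have 0: "snd (T ! 0) \<le> B" using assms by (cases "T ! 0") (auto simp: rep_def)
    have 5: "snd (T ! 5) \<le> B" using assms by (cases "T ! 5") (auto simp: rep_def)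
    have st: "snd (T ! x) \<le> B" if "x \<in> {1..4}"
    proof -
      have "stack_rep (S x) (T ! x)" "length (S x) \<le> B" using assms that by (auto simp: rep_def)
      then show ?thesis by (cases "T ! x") auto
    qed
    have "x = 0 \<or> x \<in> {1..4} \<or> x = 5" using that by auto
    then show ?thesis using 0 5 st by blast
  qed
  then show ?thesis using assms(1)
    by (auto simp: heads_le_def rep_def in_set_conv_nth) (metis snd_conv)
qed

lemma heads_initial: "heads_le 0 (snd (initial_config M w))"
  by (auto simp: heads_le_def initial_config_def)

section \<open>Polynomial-time functions on binary trees\<close>

subsection \<open>Polynomial bounds\<close>

text \<open>The base \<open>n + 2\<close> is at least 2, so constants and coefficients are absorbed
  into the exponent and the closure properties need no side conditions on \<open>n\<close>.\<close>

definition polyb :: "(nat \<Rightarrow> nat) \<Rightarrow> bool" where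
  "polyb f \<longleftrightarrow> (\<exists>k. \<forall>n. f n \<le> (n + 2) ^ k)"

lemma polybI: "(\<And>n. f n \<le> (n + 2) ^ k) \<Longrightarrow> polyb f"
  by (auto simp: polyb_def)

lemma polyb_le: "polyb g \<Longrightarrow> (\<And>n. f n \<le> g n) \<Longrightarrow> polyb f"
  unfolding polyb_def by (meson le_trans)

lemma polyb_const: "polyb (\<lambda>n. c)"
proof (rule polybI)
  fix n
  have "c \<le> 2 ^ c" by (rule less_imp_le[OF less_exp])
  also have "\<dots> \<le> (n + 2) ^ c" by (rule power_mono) auto
  finally show "c \<le> (n + 2) ^ c" .
qed

lemma polyb_id: "polyb (\<lambda>n. n)"
  by (rule polybI[of _ 1]) simp

lemma polyb_mult: "polyb f \<Longrightarrow> polyb g \<Longrightarrow> polyb (\<lambda>n. f n * g n)"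
  unfolding polyb_def by (metis mult_le_mono power_add)

lemma polyb_add: "polyb f \<Longrightarrow> polyb g \<Longrightarrow> polyb (\<lambda>n. f n + g n)"
proof -
  assume "polyb f" "polyb g"
  then obtain k m where km: "\<And>n. f n \<le> (n + 2) ^ k" "\<And>n. g n \<le> (n + 2) ^ m"
    unfolding polyb_def by blast
  show ?thesis
  proof (rule polybI)
    fix n :: nat
    have "(n + 2) ^ k \<le> (n + 2) ^ (k + m)" "(n + 2) ^ m \<le> (n + 2) ^ (k + m)"
      by (auto intro: power_increasing)
    then have "f n + g n \<le> 2 * (n + 2) ^ (k + m)" using km[of n] by linarith
    also have "\<dots> \<le> (n + 2) ^ Suc (k + m)" by simp
    finally show "f n + g n \<le> (n + 2) ^ Suc (k + m)" .
  qed
qed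

lemma polyb_Suc: "polyb f \<Longrightarrow> polyb (\<lambda>n. Suc (f n))"
  using polyb_add[OF _ polyb_const[of 1]] by simp

lemma polyb_power: "polyb f \<Longrightarrow> polyb (\<lambda>n. f n ^ k)"
  by (induction k) (auto intro: polyb_const polyb_mult)

lemma polyb_comp:
  assumes "polyb f" "polyb g"
  shows "polyb (\<lambda>n. f (g n))"
proof -
  obtain k where k: "\<And>n. f n \<le> (n + 2) ^ k" using assms(1) unfolding polyb_def by blast
  have "polyb (\<lambda>n. (g n + 2) ^ k)" by (intro polyb_power polyb_add assms polyb_const)
  then show ?thesis by (rule polyb_le) (rule k)
qed

lemmas polyb_intros = polyb_const polyb_id polyb_add polyb_mult polyb_Suc polyb_power

subsection \<open>Execution with a time bound\<close>

definition bsle :: "com \<Rightarrow> store \<Rightarrow> nat \<Rightarrow> store \<Rightarrow> bool" where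
  "bsle c S t S' \<longleftrightarrow> (\<exists>t'\<le>t. bs c S t' S')"

lemma bsle_weaken: "bsle c S t S' \<Longrightarrow> t \<le> t' \<Longrightarrow> S' = S'' \<Longrightarrow> bsle c S t' S''"
  unfolding bsle_def by (meson le_trans)

lemma bsle_Push: "bsle (Push x y) S 2 (S(x := y # S x))"
  using bs_Push unfolding bsle_def by blast

lemma bsle_Pop: "bsle (Pop x) S 1 (S(x := tl (S x)))"
  using bs_Pop unfolding bsle_def by blast

lemma bsle_Seq: "bsle c1 S t1 S1 \<Longrightarrow> bsle c2 S1 t2 S2 \<Longrightarrow> bsle (Seq c1 c2) S (Suc (t1 + t2)) S2"
  unfolding bsle_def by (meson Suc_le_mono add_mono bs_Seq)

lemma bsle_CondT: "bsle c1 S t S' \<Longrightarrow> top_sym (S x) \<in> P \<Longrightarrow> bsle (Cond x P c1 c2) S (Suc t) S'"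
  unfolding bsle_def by (meson Suc_le_mono bs_CondT)

lemma bsle_CondF: "bsle c2 S t S' \<Longrightarrow> top_sym (S x) \<notin> P \<Longrightarrow> bsle (Cond x P c1 c2) S (Suc t) S'"
  unfolding bsle_def by (meson Suc_le_mono bs_CondF)

lemma bsle_Cond:
  "bsle (if top_sym (S x) \<in> P then c1 else c2) S t S' \<Longrightarrow> bsle (Cond x P c1 c2) S (Suc t) S'"
  by (cases "top_sym (S x) \<in> P") (auto intro: bsle_CondT bsle_CondF)

lemma bsle_LoopF: "top_sym (S x) \<notin> P \<Longrightarrow> bsle (Loop x P c) S 1 S"
  unfolding bsle_def by (meson bs_LoopF order_refl)

lemma bsle_LoopT:
  "bsle c S t1 S1 \<Longrightarrow> bsle (Loop x P c) S1 t2 S2 \<Longrightarrow> top_sym (S x) \<in> P \<Longrightarrow>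
    bsle (Loop x P c) S (Suc (t1 + t2)) S2"
  unfolding bsle_def by (meson Suc_le_mono add_mono bs_LoopT)

text \<open>Each stack grows by at most one symbol per unit of time. Hence a time bound for a
  program is also a bound on the size of its result, which \<open>PTE\<close> provides for
  compositions.\<close>

lemma bs_length: "bs c S t S' \<Longrightarrow> length (S' x) \<le> length (S x) + t"
  by (induction rule: bs.induct) auto

lemma bsle_length: "bsle c S t S' \<Longrightarrow> length (S' x) \<le> length (S x) + t"
  unfolding bsle_def using bs_length by (meson add_left_mono le_trans)

subsection \<open>Trees on the stack\<close>

datatype tree = Leaf | Node tree tree

fun code :: "tree \<Rightarrow> nat list" where
  "code Leaf = [2]"
| "code (Node a b) = 1 # code a @ code b"

fun tsize :: "tree \<Rightarrow> nat" where
  "tsize Leaf = 1"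
| "tsize (Node a b) = Suc (tsize a + tsize b)"

lemma length_code [simp]: "length (code x) = tsize x"
  by (induction x) auto

lemma tsize_pos: "1 \<le> tsize x"
  by (cases x) auto

lemma set_code: "set (code x) \<subseteq> {1, 2}"
  by (induction x) auto

lemma code_append_inj: "code x @ u = code y @ v \<longleftrightarrow> x = y \<and> u = v"
proof (induction x arbitrary: y u v)
  case Leaf
  then show ?case by (cases y) auto
next
  case (Node a b)
  then show ?case by (cases y) auto
qed

lemma code_inj: "code x = code y \<longleftrightarrow> x = y"
  using code_append_inj[of x "[]" y "[]"] by simp

fun left :: "tree \<Rightarrow> tree" where
  "left Leaf = Leaf"
| "left (Node a b) = a"

fun right :: "tree \<Rightarrow> tree" where
  "right Leaf = Leaf"
| "right (Node a b) = b"

text \<open>The stack 4 counts in unary, with symbol 3, the trees that remain to be moved.\<close>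

definition move_loop :: "nat \<Rightarrow> com" where
  "move_loop x = Loop 4 {3} (Cond 1 {1} (Seq (Pop 1) (Seq (Push x 1) (Push 4 3)))
      (Seq (Pop 1) (Seq (Push x 2) (Pop 4))))"

definition move_tree :: "nat \<Rightarrow> com" where
  "move_tree x = Seq (Push 4 3) (move_loop x)"

text \<open>The statement is in continuation style: it assumes the rest of the loop from
  \<open>S0\<close> on and prefixes the work for \<open>a\<close>. For a node, this lets the two
  subtrees be chained, the second one first. Each symbol costs one iteration of at most 9 units, 8
  for the body and 1 for the loop.\<close>

lemma move_loop:
  assumes "S 1 = code a @ r" "S 4 = 3 # C" "x \<in> {2, 3}"
    "bsle (move_loop x) S0 t S'" "S0 = S(1 := r, x := rev (code a) @ S x, 4 := C)"
  shows "bsle (move_loop x) S (9 * tsize a + t) S'"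
  using assms
proof (induction a arbitrary: S S0 r C t)
  case Leaf
  have "bsle (Cond 1 {1} (Seq (Pop 1) (Seq (Push x 1) (Push 4 3)))
      (Seq (Pop 1) (Seq (Push x 2) (Pop 4)))) S 8 (S(1 := r, x := rev (code Leaf) @ S x, 4 := C))"
    by (rule bsle_weaken, rule bsle_CondF, (rule bsle_Seq bsle_Push bsle_Pop)+)
      (use Leaf(1-3) in \<open>auto simp: fun_eq_iff\<close>)
  also have "S(1 := r, x := rev (code Leaf) @ S x, 4 := C) = S0"
    using Leaf(5) by (simp add: fun_upd_def)
  finally have "bsle (Cond 1 {1} (Seq (Pop 1) (Seq (Push x 1) (Push 4 3)))
      (Seq (Pop 1) (Seq (Push x 2) (Pop 4)))) S 8 S0" .
  from bsle_LoopT[OF this Leaf(4)[unfolded move_loop_def]] show ?case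
    unfolding move_loop_def by (rule bsle_weaken) (use Leaf(2) in auto)
next
  case (Node a b)
  define S1 where "S1 = S(1 := code a @ code b @ r, x := 1 # S x, 4 := 3 # 3 # C)"
  have 1: "bsle (Cond 1 {1} (Seq (Pop 1) (Seq (Push x 1) (Push 4 3)))
      (Seq (Pop 1) (Seq (Push x 2) (Pop 4)))) S 8 S1"
    by (rule bsle_weaken, rule bsle_CondT, (rule bsle_Seq bsle_Push bsle_Pop)+)
      (use Node.prems(1-3) in \<open>auto simp: fun_eq_iff S1_def\<close>)
  define S2 where "S2 = S1(1 := code b @ r, x := rev (code a) @ S1 x, 4 := 3 # C)"
  have "S0 = S2(1 := r, x := rev (code b) @ S2 x, 4 := C)"
    using Node.prems(3,5) by (auto simp: S1_def S2_def fun_eq_iff)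
  then have "bsle (move_loop x) S2 (9 * tsize b + t) S'"
    using Node.prems(3) by (intro Node.IH(2)[OF _ _ _ Node.prems(4)]) (auto simp: S2_def)
  then have "bsle (move_loop x) S1 (9 * tsize a + (9 * tsize b + t)) S'"
    by - (rule Node.IH(1), use Node.prems(3) in \<open>auto simp: S1_def S2_def fun_eq_iff\<close>)
  from bsle_LoopT[OF 1 this[unfolded move_loop_def]] show ?case
    unfolding move_loop_def by (rule bsle_weaken) (use Node.prems(2) in auto)
qed

lemma move_tree:
  assumes "S 1 = code a @ r" "S 4 = []" "x \<in> {2, 3}"
  shows "bsle (move_tree x) S (9 * tsize a + 4) (S(1 := r, x := rev (code a) @ S x))"
proof -
  define S1 where "S1 = S(4 := [3])"
  have "bsle (move_loop x) (S1(1 := r, x := rev (code a) @ S1 x, 4 := [])) 1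
      (S1(1 := r, x := rev (code a) @ S1 x, 4 := []))"
    unfolding move_loop_def by (rule bsle_LoopF) simp
  then have "bsle (move_loop x) S1 (9 * tsize a + 1) (S1(1 := r, x := rev (code a) @ S1 x, 4 := []))"
    by - (rule move_loop[OF _ _ _ _ refl], use assms in \<open>auto simp: S1_def\<close>)
  moreover have "bsle (Push 4 3) S 2 S1" using bsle_Push[of 4 3 S] assms by (simp add: S1_def)
  ultimately show ?thesis unfolding move_tree_def
    by - (rule bsle_weaken[OF bsle_Seq], assumption, assumption, use assms in \<open>auto simp: S1_def fun_eq_iff\<close>)
qed

definition move_all :: "nat \<Rightarrow> nat \<Rightarrow> com" where
  "move_all x y = Loop x {1, 2} (Cond x {1} (Seq (Pop x) (Push y 1)) (Seq (Pop x) (Push y 2)))"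

lemma move_all:
  assumes "set xs \<subseteq> {1, 2}" "S x = xs" "x \<noteq> y"
  shows "bsle (move_all x y) S (6 * length xs + 1) (S(x := [], y := rev xs @ S y))"
  using assms
proof (induction xs arbitrary: S)
  case Nil
  then have "S(x := [], y := rev [] @ S y) = S" by (auto simp: fun_eq_iff)
  then show ?case unfolding move_all_def using Nil by (intro bsle_weaken[OF bsle_LoopF]) auto
next
  case (Cons v xs)
  define S1 where "S1 = S(x := xs, y := v # S y)"
  have "bsle (Cond x {1} (Seq (Pop x) (Push y 1)) (Seq (Pop x) (Push y 2))) S 5 S1"
  proof (cases "v = 1")
    case True
    show ?thesis by (rule bsle_weaken, rule bsle_CondT, (rule bsle_Seq bsle_Push bsle_Pop)+)
      (use Cons.prems True in \<open>auto simp: fun_eq_iff S1_def\<close>)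
  next
    case False
    then have "v = 2" using Cons.prems by auto
    show ?thesis by (rule bsle_weaken, rule bsle_CondF, (rule bsle_Seq bsle_Push bsle_Pop)+)
      (use Cons.prems False \<open>v = 2\<close> in \<open>auto simp: fun_eq_iff S1_def\<close>)
  qed
  moreover have "bsle (move_all x y) S1 (6 * length xs + 1) (S1(x := [], y := rev xs @ S1 y))"
    using Cons by (intro Cons.IH) (auto simp: S1_def)
  ultimately have "bsle (move_all x y) S (Suc (5 + (6 * length xs + 1)))
      (S1(x := [], y := rev xs @ S1 y))"
    unfolding move_all_def using Cons.prems by (intro bsle_LoopT) auto
  then show ?case
    by (rule bsle_weaken) (use Cons.prems in \<open>auto simp: S1_def fun_eq_iff\<close>)
qed

definition move_both :: "nat \<Rightarrow> nat \<Rightarrow> nat \<Rightarrow> com" where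
  "move_both x y z = Loop x {1, 2} (Cond x {1} (Seq (Pop x) (Seq (Push y 1) (Push z 1)))
      (Seq (Pop x) (Seq (Push y 2) (Push z 2))))"

lemma move_both:
  assumes "set xs \<subseteq> {1, 2}" "S x = xs" "distinct [x, y, z]"
  shows "bsle (move_both x y z) S (9 * length xs + 1)
    (S(x := [], y := rev xs @ S y, z := rev xs @ S z))"
  using assms
proof (induction xs arbitrary: S)
  case Nil
  then have "S(x := [], y := rev [] @ S y, z := rev [] @ S z) = S" by (auto simp: fun_eq_iff)
  then show ?case unfolding move_both_def using Nil by (intro bsle_weaken[OF bsle_LoopF]) auto
next
  case (Cons v xs)
  define S1 where "S1 = S(x := xs, y := v # S y, z := v # S z)"
  have "bsle (Cond x {1} (Seq (Pop x) (Seq (Push y 1) (Push z 1)))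
      (Seq (Pop x) (Seq (Push y 2) (Push z 2)))) S 8 S1"
  proof (cases "v = 1")
    case True
    show ?thesis by (rule bsle_weaken, rule bsle_CondT, (rule bsle_Seq bsle_Push bsle_Pop)+)
      (use Cons.prems True in \<open>auto simp: fun_eq_iff S1_def\<close>)
  next
    case False
    then have "v = 2" using Cons.prems by auto
    show ?thesis by (rule bsle_weaken, rule bsle_CondF, (rule bsle_Seq bsle_Push bsle_Pop)+)
      (use Cons.prems False \<open>v = 2\<close> in \<open>auto simp: fun_eq_iff S1_def\<close>)
  qed
  moreover have "bsle (move_both x y z) S1 (9 * length xs + 1)
      (S1(x := [], y := rev xs @ S1 y, z := rev xs @ S1 z))"
    using Cons by (intro Cons.IH) (auto simp: S1_def)
  ultimately have "bsle (move_both x y z) S (Suc (8 + (9 * length xs + 1)))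
      (S1(x := [], y := rev xs @ S1 y, z := rev xs @ S1 z))"
    unfolding move_both_def using Cons.prems by (intro bsle_LoopT) auto
  then show ?case
    by (rule bsle_weaken) (use Cons.prems in \<open>auto simp: S1_def fun_eq_iff\<close>)
qed

definition clear :: "nat \<Rightarrow> com" where
  "clear x = Loop x {1, 2} (Pop x)"

lemma clear:
  assumes "set xs \<subseteq> {1, 2}" "S x = xs"
  shows "bsle (clear x) S (2 * length xs + 1) (S(x := []))"
  using assms
proof (induction xs arbitrary: S)
  case Nil
  then have "S(x := []) = S" by (auto simp: fun_eq_iff)
  then show ?case unfolding clear_def using Nil by (intro bsle_weaken[OF bsle_LoopF]) auto
next
  case (Cons v xs)
  have "bsle (clear x) (S(x := xs)) (2 * length xs + 1) (S(x := xs, x := []))"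
    using Cons by (intro Cons.IH) auto
  moreover have "bsle (Pop x) S 1 (S(x := xs))" using bsle_Pop[of x S] Cons.prems by simp
  ultimately have "bsle (clear x) S (Suc (1 + (2 * length xs + 1))) (S(x := xs, x := []))"
    unfolding clear_def using Cons.prems by (intro bsle_LoopT) auto
  then show ?case by (rule bsle_weaken) auto
qed

text \<open>Stacks 2, 3 and 4 are scratch space, empty between operations; the values themselves
  live on stack 1.\<close>

definition clean :: "store \<Rightarrow> bool" where
  "clean S \<longleftrightarrow> S 2 = [] \<and> S 3 = [] \<and> S 4 = []"

lemma clean_upd [simp]: "clean S \<Longrightarrow> clean (S(Suc 0 := r))"
  by (simp add: clean_def)

definition drop_tree :: com where
  "drop_tree = Seq (move_tree 2) (clear 2)"

definition dup_tree :: com where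
  "dup_tree = Seq (move_tree 2) (Seq (move_both 2 1 3) (Seq (move_all 3 2) (move_all 2 1)))"

definition swap_trees :: com where
  "swap_trees = Seq (move_tree 2) (Seq (move_tree 3) (Seq (move_all 2 1) (move_all 3 1)))"

lemma drop_tree:
  assumes "clean S" "S 1 = code a @ r"
  shows "bsle drop_tree S (11 * tsize a + 6) (S(1 := r))"
proof -
  have "bsle (move_tree 2) S (9 * tsize a + 4) (S(1 := r, 2 := rev (code a)))"
    using move_tree[of S a r 2] assms by (simp add: clean_def)
  moreover have "bsle (clear 2) (S(1 := r, 2 := rev (code a))) (2 * length (rev (code a)) + 1)
      (S(1 := r, 2 := rev (code a), 2 := []))"
    using set_code by (intro clear) auto
  ultimately show ?thesis unfolding drop_tree_def
    by (rule bsle_weaken[OF bsle_Seq]) (use assms in \<open>auto simp: clean_def fun_eq_iff\<close>)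
qed

lemma dup_tree:
  assumes "clean S" "S 1 = code a @ r"
  shows "bsle dup_tree S (30 * tsize a + 10) (S(1 := code a @ code a @ r))"
proof -
  have 1: "bsle (move_tree 2) S (9 * tsize a + 4) (S(1 := r, 2 := rev (code a)))"
    using move_tree[of S a r 2] assms by (simp add: clean_def)
  have 2: "bsle (move_both 2 1 3) (S(1 := r, 2 := rev (code a))) (9 * tsize a + 1)
      (S(1 := code a @ r, 3 := code a))"
    by (rule bsle_weaken[OF move_both[of "rev (code a)"]])
      (use set_code[of a] assms in \<open>auto simp: clean_def fun_eq_iff\<close>)
  have 3: "bsle (move_all 3 2) (S(1 := code a @ r, 3 := code a)) (6 * tsize a + 1)
      (S(1 := code a @ r, 2 := rev (code a)))"
    by (rule bsle_weaken[OF move_all[of "code a"]])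
      (use set_code[of a] assms in \<open>auto simp: clean_def fun_eq_iff\<close>)
  have 4: "bsle (move_all 2 1) (S(1 := code a @ r, 2 := rev (code a))) (6 * tsize a + 1)
      (S(1 := code a @ code a @ r))"
    by (rule bsle_weaken[OF move_all[of "rev (code a)"]])
      (use set_code[of a] assms in \<open>auto simp: clean_def fun_eq_iff\<close>)
  show ?thesis unfolding dup_tree_def
    by (rule bsle_weaken[OF bsle_Seq[OF 1 bsle_Seq[OF 2 bsle_Seq[OF 3 4]]]]) auto
qed

lemma swap_trees:
  assumes "clean S" "S 1 = code a @ code b @ r"
  shows "bsle swap_trees S (15 * tsize a + 15 * tsize b + 13) (S(1 := code b @ code a @ r))"
proof -
  have 1: "bsle (move_tree 2) S (9 * tsize a + 4) (S(1 := code b @ r, 2 := rev (code a)))"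
    using move_tree[of S a "code b @ r" 2] assms by (simp add: clean_def)
  have 2: "bsle (move_tree 3) (S(1 := code b @ r, 2 := rev (code a))) (9 * tsize b + 4)
      (S(1 := r, 2 := rev (code a), 3 := rev (code b)))"
    by (rule bsle_weaken[OF move_tree[of _ b r]])
      (use assms in \<open>auto simp: clean_def fun_eq_iff\<close>)
  have 3: "bsle (move_all 2 1) (S(1 := r, 2 := rev (code a), 3 := rev (code b))) (6 * tsize a + 1)
      (S(1 := code a @ r, 3 := rev (code b)))"
    by (rule bsle_weaken[OF move_all[of "rev (code a)"]])
      (use set_code[of a] assms in \<open>auto simp: clean_def fun_eq_iff\<close>)
  have 4: "bsle (move_all 3 1) (S(1 := code a @ r, 3 := rev (code b))) (6 * tsize b + 1)
      (S(1 := code b @ code a @ r))"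
    by (rule bsle_weaken[OF move_all[of "rev (code b)"]])
      (use set_code[of b] assms in \<open>auto simp: clean_def fun_eq_iff\<close>)
  show ?thesis unfolding swap_trees_def
    by (rule bsle_weaken[OF bsle_Seq[OF 1 bsle_Seq[OF 2 bsle_Seq[OF 3 4]]]]) auto
qed

text \<open>On a mismatch, stack 2 is emptied, which ends the loop, and a flag \<open>3\<close> is
  put on stack 4. Stack 3 may keep a remainder then, and also when its contents are merely longer.
  Equality thus amounts to no remainder and no flag.\<close>

definition compare_loop :: com where
  "compare_loop = Loop 2 {1, 2} (Cond 2 {1}
     (Cond 3 {1} (Seq (Pop 2) (Pop 3)) (Seq (clear 2) (Push 4 3)))
     (Cond 3 {2} (Seq (Pop 2) (Pop 3)) (Seq (clear 2) (Push 4 3))))"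

lemma compare_loop:
  assumes "set xs \<subseteq> {1, 2}" "set ys \<subseteq> {1, 2}" "S 2 = xs" "S 3 = ys" "S 4 = []"
  shows "\<exists>zs fl. set zs \<subseteq> {1, 2} \<and> length zs \<le> length ys \<and> (fl = [] \<or> fl = [3]) \<and>
    (xs = ys \<longleftrightarrow> zs = [] \<and> fl = []) \<and>
    bsle compare_loop S (8 * length xs + 9) (S(2 := [], 3 := zs, 4 := fl))"
  using assms
proof (induction xs arbitrary: S ys)
  case Nil
  then have "S(2 := [], 3 := ys, 4 := []) = S" by (auto simp: fun_eq_iff)
  moreover have "bsle compare_loop S 1 S"
    unfolding compare_loop_def using Nil by (intro bsle_LoopF) auto
  ultimately have "bsle compare_loop S (8 * length [] + 9) (S(2 := [], 3 := ys, 4 := []))"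
    by - (rule bsle_weaken, assumption, auto)
  then show ?case using Nil by - (rule exI[of _ ys], rule exI[of _ "[]"], auto simp: fun_upd_def)
next
  case (Cons v xs)
  let ?body = "Cond 2 {1}
     (Cond 3 {1} (Seq (Pop 2) (Pop 3)) (Seq (clear 2) (Push 4 3)))
     (Cond 3 {2} (Seq (Pop 2) (Pop 3)) (Seq (clear 2) (Push 4 3)))"
  have v: "v = 1 \<or> v = 2" using Cons.prems by auto
  have top2: "top_sym (S 2) = v" using Cons.prems by simp
  have c: "bsle ?body S (Suc (Suc t)) S'"
    if "bsle (if top_sym (S 3) = v then Seq (Pop 2) (Pop 3) else Seq (clear 2) (Push 4 3)) S t S'" for t S'
  proof (rule bsle_Cond, cases "v = 1")
    case True
    then show "bsle (if top_sym (S 2) \<in> {1} then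
        Cond 3 {1} (Seq (Pop 2) (Pop 3)) (Seq (clear 2) (Push 4 3)) else
        Cond 3 {2} (Seq (Pop 2) (Pop 3)) (Seq (clear 2) (Push 4 3))) S (Suc t) S'"
      using that top2 bsle_Cond[of S 3 "{1}"] by auto
  next
    case False
    then show "bsle (if top_sym (S 2) \<in> {1} then
        Cond 3 {1} (Seq (Pop 2) (Pop 3)) (Seq (clear 2) (Push 4 3)) else
        Cond 3 {2} (Seq (Pop 2) (Pop 3)) (Seq (clear 2) (Push 4 3))) S (Suc t) S'"
      using that top2 v bsle_Cond[of S 3 "{2}"] by auto
  qed
  show ?case
  proof (cases "top_sym ys = v")
    case True
    then obtain ys' where ys: "ys = v # ys'" using v by (cases ys) auto
    define S1 where "S1 = S(2 := xs, 3 := ys')"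
    have b: "bsle ?body S 5 S1"
      by (rule bsle_weaken, rule c, simp add: Cons.prems(4) True, (rule bsle_Seq bsle_Pop)+)
        (use Cons.prems ys in \<open>auto simp: fun_eq_iff S1_def\<close>)
    have pre: "set xs \<subseteq> {1, 2}" "set ys' \<subseteq> {1, 2}" "S1 2 = xs" "S1 3 = ys'" "S1 4 = []"
      using Cons.prems ys by (auto simp: S1_def)
    obtain zs fl where z: "set zs \<subseteq> {1, 2}" "length zs \<le> length ys'" "fl = [] \<or> fl = [3]"
        "xs = ys' \<longleftrightarrow> zs = [] \<and> fl = []"
        "bsle compare_loop S1 (8 * length xs + 9) (S1(2 := [], 3 := zs, 4 := fl))"
      using Cons.IH[OF pre] unfolding fun_upd_def by blast
    have "bsle compare_loop S (Suc (5 + (8 * length xs + 9))) (S1(2 := [], 3 := zs, 4 := fl))"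
      using b z(5) unfolding compare_loop_def by (rule bsle_LoopT) (use Cons.prems in auto)
    then have "bsle compare_loop S (8 * length (v # xs) + 9) (S(2 := [], 3 := zs, 4 := fl))"
      by (rule bsle_weaken) (auto simp: S1_def fun_eq_iff)
    then show ?thesis using z ys by - (rule exI[of _ zs], rule exI[of _ fl], auto simp: fun_upd_def)
  next
    case False
    have cl: "bsle (clear 2) S (2 * length (v # xs) + 1) (S(2 := []))"
      using Cons.prems by (intro clear) auto
    have "bsle ?body S (2 * length (v # xs) + 6) (S(2 := [], 4 := [3]))"
      by (rule bsle_weaken, rule c, simp add: Cons.prems(4) False,
          rule bsle_Seq[OF cl], rule bsle_Push)
        (use Cons.prems in \<open>auto simp: fun_eq_iff\<close>)
    moreover have "bsle compare_loop (S(2 := [], 4 := [3])) 1 (S(2 := [], 4 := [3]))"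
      unfolding compare_loop_def by (rule bsle_LoopF) auto
    ultimately have "bsle compare_loop S (Suc (2 * length (v # xs) + 6 + 1)) (S(2 := [], 4 := [3]))"
      unfolding compare_loop_def by (rule bsle_LoopT) (use Cons.prems in auto)
    then have "bsle compare_loop S (8 * length (v # xs) + 9) (S(2 := [], 3 := ys, 4 := [3]))"
      by (rule bsle_weaken) (use Cons.prems in \<open>auto simp: fun_eq_iff\<close>)
    then show ?thesis using False Cons.prems
      by - (rule exI[of _ ys], rule exI[of _ "[3]"], cases ys; auto simp: fun_upd_def)
  qed
qed

text \<open>A non-empty stack 3 means inequality whether or not the flag is set: popping an empty
  stack 4 is harmless. The last branch pushes \<open>2, 2, 1\<close>, which reads from the top as
  the code of \<open>Node Leaf Leaf\<close>, that is, of \<open>True\<close>.\<close>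

definition equal_trees :: com where
  "equal_trees = Seq (move_tree 2) (Seq (move_tree 3) (Seq compare_loop
     (Cond 3 {1, 2} (Seq (clear 3) (Seq (Pop 4) (Push 1 2)))
       (Cond 4 {3} (Seq (Pop 4) (Push 1 2)) (Seq (Push 1 2) (Seq (Push 1 2) (Push 1 1)))))))"

definition btree :: "bool \<Rightarrow> tree" where
  "btree b = (if b then Node Leaf Leaf else Leaf)"

lemma equal_trees:
  assumes "clean S" "S 1 = code a @ code b @ r"
  shows "bsle equal_trees S (17 * tsize a + 11 * tsize b + 34) (S(1 := code (btree (a = b)) @ r))"
proof -
  have 1: "bsle (move_tree 2) S (9 * tsize a + 4) (S(1 := code b @ r, 2 := rev (code a)))"
    using move_tree[of S a "code b @ r" 2] assms by (simp add: clean_def)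
  define S2 where "S2 = S(1 := r, 2 := rev (code a), 3 := rev (code b))"
  have 2: "bsle (move_tree 3) (S(1 := code b @ r, 2 := rev (code a))) (9 * tsize b + 4) S2"
    unfolding S2_def by (rule bsle_weaken[OF move_tree[of _ b r]])
      (use assms in \<open>auto simp: clean_def fun_eq_iff\<close>)
  obtain zs fl where z: "set zs \<subseteq> {1, 2}" "length zs \<le> length (rev (code b))" "fl = [] \<or> fl = [3]"
      "rev (code a) = rev (code b) \<longleftrightarrow> zs = [] \<and> fl = []"
      "bsle compare_loop S2 (8 * length (rev (code a)) + 9) (S2(2 := [], 3 := zs, 4 := fl))"
    using compare_loop[of "rev (code a)" "rev (code b)" S2] set_code[of a] set_code[of b] assms
    by (auto simp: S2_def clean_def)
  let ?S3 = "S2(2 := [], 3 := zs, 4 := fl)"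
  let ?fin = "Cond 3 {1, 2} (Seq (clear 3) (Seq (Pop 4) (Push 1 2)))
       (Cond 4 {3} (Seq (Pop 4) (Push 1 2)) (Seq (Push 1 2) (Seq (Push 1 2) (Push 1 1))))"
  have 3: "bsle ?fin ?S3 (2 * length zs + 12) (S(1 := code (btree (a = b)) @ r))"
  proof (cases zs)
    case Nil
    show ?thesis
    proof (cases "fl = []")
      case True
      then have "a = b" using z(4) Nil code_inj by auto
      show ?thesis
        by (rule bsle_weaken, rule bsle_CondF, rule bsle_CondF, (rule bsle_Seq bsle_Push bsle_Pop)+)
          (use Nil True \<open>a = b\<close> assms in \<open>auto simp: fun_eq_iff S2_def btree_def clean_def\<close>)
    next
      case False
      then have "a \<noteq> b" "fl = [3]" using z(3,4) by auto
      then show ?thesis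
        by - (rule bsle_weaken, rule bsle_CondF, rule bsle_CondT,
            rule bsle_Seq, rule bsle_Pop, rule bsle_Push,
            use Nil assms in \<open>auto simp: fun_eq_iff S2_def btree_def clean_def\<close>)
    qed
  next
    case (Cons v vs)
    then have "a \<noteq> b" using z(4) by auto
    have cl: "bsle (clear 3) ?S3 (2 * length zs + 1) (?S3(3 := []))"
      using z(1) by (intro clear) auto
    show ?thesis
      by (rule bsle_weaken, rule bsle_CondT, rule bsle_Seq[OF cl], (rule bsle_Seq bsle_Push bsle_Pop)+)
        (use Cons z(1,3) \<open>a \<noteq> b\<close> assms in \<open>auto simp: fun_eq_iff S2_def btree_def clean_def\<close>)
  qed
  show ?thesis unfolding equal_trees_def
    by (rule bsle_weaken[OF bsle_Seq[OF 1 bsle_Seq[OF 2 bsle_Seq[OF z(5) 3]]]]) (use z(2) in auto)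
qed

lemma wf_macros [simp]:
  "wf_com drop_tree" "wf_com dup_tree" "wf_com swap_trees" "wf_com equal_trees"
  by (auto simp: drop_tree_def dup_tree_def swap_trees_def equal_trees_def compare_loop_def
      move_tree_def move_loop_def move_all_def move_both_def clear_def)

lemma wf_clear [simp]: "x < 5 \<Longrightarrow> wf_com (clear x)"
  and wf_move_tree [simp]: "x \<in> {2, 3} \<Longrightarrow> wf_com (move_tree x)"
  and wf_move_all [simp]: "x < 5 \<Longrightarrow> 1 \<le> y \<Longrightarrow> y < 5 \<Longrightarrow> wf_com (move_all x y)"
  by (auto simp: clear_def move_tree_def move_loop_def move_all_def)

subsection \<open>Encodable types and polynomial-time functions between them\<close>

text \<open>All values are handled as trees, so programs know no types. Injectivity allows equality
  of values to be tested by comparing codes.\<close>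

class encodable =
  fixes tr :: "'a \<Rightarrow> tree"
  assumes tr_inj: "tr x = tr y \<Longrightarrow> x = y"

lemma tr_eq_iff: "tr x = tr y \<longleftrightarrow> x = y"
  using tr_inj by auto

instantiation bool :: encodable
begin
definition "tr_bool = btree"
instance by standard (auto simp: tr_bool_def btree_def split: if_splits)
end

text \<open>Numbers are coded in unary, so polynomial means polynomial in the value. This suffices
  because the numbers that vary with the input are lengths, levels and positions, all bounded by
  polynomials in the input length.\<close>

instantiation nat :: encodable
begin
primrec tr_nat :: "nat \<Rightarrow> tree" where
  "tr_nat 0 = Leaf"
| "tr_nat (Suc n) = Node Leaf (tr_nat n)"
instance
proof
  fix x y :: nat
  show "tr x = tr y \<Longrightarrow> x = y"
    by (induction x arbitrary: y; case_tac y) auto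
qed
end

instantiation prod :: (encodable, encodable) encodable
begin
definition "tr_prod p = Node (tr (fst p)) (tr (snd p))"
instance by standard (auto simp: tr_prod_def tr_eq_iff)
end

instantiation list :: (encodable) encodable
begin
primrec tr_list :: "'a list \<Rightarrow> tree" where
  "tr_list [] = Leaf"
| "tr_list (x # xs) = Node (tr x) (tr_list xs)"
instance
proof
  fix x y :: "'a list"
  show "tr x = tr y \<Longrightarrow> x = y"
    by (induction x arbitrary: y; case_tac y) (auto simp: tr_eq_iff)
qed
end

instantiation counter_symbol :: encodable
begin
definition "tr_counter_symbol s = btree (s = sym_I)"
instance
proof
  fix x y :: counter_symbol
  show "tr x = tr y \<Longrightarrow> x = y"
    by (cases x; cases y) (auto simp: tr_counter_symbol_def btree_def)
qed
end

lemma tr_Pair [simp]: "tr (a, b) = Node (tr a) (tr b)"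
  by (simp add: tr_prod_def)

lemma tr_bool_simps [simp]: "tr True = Node Leaf Leaf" "tr False = Leaf"
  by (auto simp: tr_bool_def btree_def)

abbreviation sz :: "'a::encodable \<Rightarrow> nat" where
  "sz x \<equiv> tsize (tr x)"

text \<open>The rest \<open>r\<close> of stack 1 is arbitrary and preserved, so that intermediate
  results can wait below while another program runs.\<close>

definition PT :: "('a::encodable \<Rightarrow> 'b::encodable) \<Rightarrow> bool" where
  "PT f \<longleftrightarrow> (\<exists>c k. wf_com c \<and> (\<forall>x r S. clean S \<longrightarrow> S 1 = code (tr x) @ r \<longrightarrow>
     bsle c S ((sz x + 2) ^ k) (S(1 := code (tr (f x)) @ r))))"

lemma PTI:
  assumes "wf_com c" "polyb b"
    "\<And>x r S. clean S \<Longrightarrow> S 1 = code (tr x) @ r \<Longrightarrow> bsle c S (b (sz x)) (S(1 := code (tr (f x)) @ r))"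
  shows "PT f"
proof -
  obtain k where "\<And>n. b n \<le> (n + 2) ^ k" using assms(2) unfolding polyb_def by blast
  then show ?thesis unfolding PT_def using assms(1,3) bsle_weaken by meson
qed

lemma PTE:
  assumes "PT f"
  obtains c k where "wf_com c"
    "\<And>x r S. clean S \<Longrightarrow> S 1 = code (tr x) @ r \<Longrightarrow>
      bsle c S ((sz x + 2) ^ k) (S(1 := code (tr (f x)) @ r))"
    "\<And>x. sz (f x) \<le> sz x + (sz x + 2) ^ k"
proof -
  obtain c k where ck: "wf_com c" "\<And>x r S. clean S \<Longrightarrow> S 1 = code (tr x) @ r \<Longrightarrow>
      bsle c S ((sz x + 2) ^ k) (S(1 := code (tr (f x)) @ r))"
    using assms unfolding PT_def by blast
  have "sz (f x) \<le> sz x + (sz x + 2) ^ k" for x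
    using bsle_length[OF ck(2)[of "(\<lambda>_. [])(1 := code (tr x))" x "[]"], of 1]
    by (simp add: clean_def)
  then show thesis using that ck by blast
qed

lemma PT_size: "PT f \<Longrightarrow> \<exists>b. polyb b \<and> mono b \<and> (\<forall>x. sz (f x) \<le> b (sz x))"
proof (erule PTE)
  fix c k assume "\<And>x. sz (f x) \<le> sz x + (sz x + 2) ^ k"
  then show ?thesis
    by (intro exI[of _ "\<lambda>n. n + (n + 2) ^ k"] conjI polyb_intros)
      (auto simp: mono_def intro!: add_mono power_mono)
qed

text \<open>Nothing has to be done; popping the empty scratch stack 2 serves as the idle
  command.\<close>

lemma PT_retag:
  fixes f :: "'a::encodable \<Rightarrow> 'b::encodable"
  assumes "\<And>x. tr (f x) = tr x"
  shows "PT f"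
proof (rule PTI[of "Pop 2" "\<lambda>_. 1"])
  fix x :: 'a and r and S :: store
  assume "clean S" "S 1 = code (tr x) @ r"
  then show "bsle (Pop 2) S 1 (S(1 := code (tr (f x)) @ r))"
    by (intro bsle_weaken[OF bsle_Pop]) (auto simp: fun_eq_iff clean_def assms)
qed (auto intro: polyb_intros)

lemma PT_id: "PT (\<lambda>x. x)"
  by (rule PT_retag) simp

lemma PT_comp:
  fixes g :: "'a::encodable \<Rightarrow> 'b::encodable"
  assumes "PT f" "PT g"
  shows "PT (\<lambda>x. f (g x))"
proof -
  obtain c k where c: "wf_com c" "\<And>x r S. clean S \<Longrightarrow> S 1 = code (tr x) @ r \<Longrightarrow>
      bsle c S ((sz x + 2) ^ k) (S(1 := code (tr (f x)) @ r))"
    using assms(1) by (rule PTE) blast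
  obtain d m where d: "wf_com d" "\<And>x r S. clean S \<Longrightarrow> S 1 = code (tr x) @ r \<Longrightarrow>
      bsle d S ((sz x + 2) ^ m) (S(1 := code (tr (g x)) @ r))"
    "\<And>x. sz (g x) \<le> sz x + (sz x + 2) ^ m"
    using assms(2) by (rule PTE) blast
  show ?thesis
  proof (rule PTI)
    show "wf_com (Seq d c)" using c d by simp
    show "polyb (\<lambda>n. Suc ((n + 2) ^ m + (n + (n + 2) ^ m + 2) ^ k))" by (intro polyb_intros)
    fix x :: 'a and r and S :: store
    assume S: "clean S" "S 1 = code (tr x) @ r"
    have 2: "bsle c (S(1 := code (tr (g x)) @ r)) ((sz (g x) + 2) ^ k)
        (S(1 := code (tr (f (g x))) @ r))"
      using c(2)[of "S(1 := code (tr (g x)) @ r)" "g x" r] S by simp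
    show "bsle (Seq d c) S (Suc ((sz x + 2) ^ m + (sz x + (sz x + 2) ^ m + 2) ^ k))
        (S(1 := code (tr (f (g x))) @ r))"
      by (rule bsle_weaken[OF bsle_Seq[OF d(2)[OF S] 2]]) (use d(3)[of x] in \<open>auto intro: power_mono\<close>)
  qed
qed

text \<open>The argument is duplicated, \<open>g\<close> is applied to the upper copy, the two top
  trees are swapped, and \<open>f\<close> is applied to the other copy. This leaves
  \<open>f x\<close> above \<open>g x\<close> for the operation. Monotonicity of \<open>b\<close>
  replaces the sizes of these results by their bounds.\<close>

lemma PT_binary:
  fixes f :: "'a::encodable \<Rightarrow> 'b::encodable" and g :: "'a \<Rightarrow> 'c::encodable"
    and h :: "'b \<Rightarrow> 'c \<Rightarrow> 'd::encodable"
  assumes f: "PT f" and g: "PT g" and "wf_com op" "polyb b" "mono b"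
    and op: "\<And>a b' r S. clean S \<Longrightarrow> S 1 = code (tr a) @ code (tr b') @ r \<Longrightarrow>
      bsle op S (b (sz a + sz b')) (S(1 := code (tr (h a b')) @ r))"
  shows "PT (\<lambda>x. h (f x) (g x))"
proof -
  obtain c k where c: "wf_com c" "\<And>x r S. clean S \<Longrightarrow> S 1 = code (tr x) @ r \<Longrightarrow>
      bsle c S ((sz x + 2) ^ k) (S(1 := code (tr (f x)) @ r))"
    "\<And>x. sz (f x) \<le> sz x + (sz x + 2) ^ k"
    using f by (rule PTE) blast
  obtain d m where d: "wf_com d" "\<And>x r S. clean S \<Longrightarrow> S 1 = code (tr x) @ r \<Longrightarrow>
      bsle d S ((sz x + 2) ^ m) (S(1 := code (tr (g x)) @ r))"
    "\<And>x. sz (g x) \<le> sz x + (sz x + 2) ^ m"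
    using g by (rule PTE) blast
  define B where "B = (\<lambda>n. (30 * n + 10) + ((n + 2) ^ m + (15 * (n + (n + 2) ^ m) + 15 * n + 13 +
      ((n + 2) ^ k + b ((n + (n + 2) ^ k) + (n + (n + 2) ^ m))))) + 4)"
  show ?thesis
  proof (rule PTI)
    show "wf_com (Seq dup_tree (Seq d (Seq swap_trees (Seq c op))))" using c d assms(3) by simp
    show "polyb B" unfolding B_def
      by (intro polyb_intros polyb_comp[OF \<open>polyb b\<close>])
    fix x :: 'a and r and S :: store
    assume S: "clean S" "S 1 = code (tr x) @ r"
    let ?X = "code (tr x)" and ?F = "code (tr (f x))" and ?G = "code (tr (g x))"
    note 1 = dup_tree[OF S]
    have 2: "bsle d (S(1 := ?X @ ?X @ r)) ((sz x + 2) ^ m) (S(1 := ?G @ ?X @ r))"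
      using d(2)[of "S(1 := ?X @ ?X @ r)" x "?X @ r"] S by simp
    have 3: "bsle swap_trees (S(1 := ?G @ ?X @ r)) (15 * sz (g x) + 15 * sz x + 13)
        (S(1 := ?X @ ?G @ r))"
      using swap_trees[of "S(1 := ?G @ ?X @ r)"] S by simp
    have 4: "bsle c (S(1 := ?X @ ?G @ r)) ((sz x + 2) ^ k) (S(1 := ?F @ ?G @ r))"
      using c(2)[of "S(1 := ?X @ ?G @ r)" x "?G @ r"] S by simp
    have 5: "bsle op (S(1 := ?F @ ?G @ r)) (b (sz (f x) + sz (g x)))
        (S(1 := code (tr (h (f x) (g x))) @ r))"
      using op[of "S(1 := ?F @ ?G @ r)" "f x" "g x" r] S by simp
    have "b (sz (f x) + sz (g x)) \<le> b ((sz x + (sz x + 2) ^ k) + (sz x + (sz x + 2) ^ m))"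
      using c(3)[of x] d(3)[of x] by (intro monoD[OF \<open>mono b\<close>] add_mono)
    then show "bsle (Seq dup_tree (Seq d (Seq swap_trees (Seq c op)))) S (B (sz x))
        (S(1 := code (tr (h (f x) (g x))) @ r))"
      by (intro bsle_weaken[OF bsle_Seq[OF 1 bsle_Seq[OF 2 bsle_Seq[OF 3 bsle_Seq[OF 4 5]]]]])
        (use d(3)[of x] in \<open>auto simp: B_def\<close>)
  qed
qed

lemma PT_join:
  fixes f :: "'a::encodable \<Rightarrow> 'b::encodable" and g :: "'a \<Rightarrow> 'c::encodable"
    and h :: "'b \<Rightarrow> 'c \<Rightarrow> 'd::encodable"
  assumes "PT f" "PT g" "\<And>a b. tr (h a b) = Node (tr a) (tr b)"
  shows "PT (\<lambda>x. h (f x) (g x))"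
proof (rule PT_binary[OF assms(1,2), of "Push 1 1" "\<lambda>_. 2"])
  fix a :: 'b and b :: 'c and r and S :: store
  assume "clean S" "S 1 = code (tr a) @ code (tr b) @ r"
  then show "bsle (Push 1 1) S 2 (S(1 := code (tr (h a b)) @ r))"
    using bsle_Push[of 1 1 S] by (simp add: assms(3))
qed (auto intro!: polyb_intros simp: mono_def)

lemma PT_Pair: "PT f \<Longrightarrow> PT g \<Longrightarrow> PT (\<lambda>x. (f x, g x))"
  by (rule PT_join[where h = Pair]) simp_all

lemma PT_Cons: "PT f \<Longrightarrow> PT g \<Longrightarrow> PT (\<lambda>x. f x # g x)"
  by (rule PT_join[where h = Cons]) simp_all

lemma PT_eq:
  fixes f :: "'a::encodable \<Rightarrow> 'b::encodable"
  assumes "PT f" "PT g"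
  shows "PT (\<lambda>x. f x = g x)"
proof (rule PT_binary[OF assms wf_macros(4), of "\<lambda>n. 17 * n + 34"])
  fix a b :: 'b and r and S :: store
  assume "clean S" "S 1 = code (tr a) @ code (tr b) @ r"
  from equal_trees[OF this] show "bsle equal_trees S (17 * (sz a + sz b) + 34) (S(1 := code (tr (a = b)) @ r))"
    by (rule bsle_weaken) (auto simp: tr_bool_def tr_eq_iff)
qed (auto intro!: polyb_intros simp: mono_def)

lemma PT_leaf:
  fixes f :: "'a::encodable \<Rightarrow> 'b::encodable"
  assumes "\<And>x. tr (f x) = Leaf"
  shows "PT f"
proof (rule PTI)
  show "wf_com (Seq drop_tree (Push 1 2))" by simp
  show "polyb (\<lambda>n. 11 * n + 6 + 3)" by (intro polyb_intros)
  fix x :: 'a and r and S :: store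
  assume S: "clean S" "S 1 = code (tr x) @ r"
  show "bsle (Seq drop_tree (Push 1 2)) S (11 * sz x + 6 + 3) (S(1 := code (tr (f x)) @ r))"
    by (rule bsle_weaken[OF bsle_Seq[OF drop_tree[OF S] bsle_Push]]) (auto simp: assms)
qed

text \<open>Trees are their own codes, so that statements about tree transformations, such as an
  induction over a constant tree, can be made in terms of \<open>PT\<close> and then transferred to
  other types.\<close>

instantiation tree :: encodable
begin
definition "tr_tree (t :: tree) = t"
instance by standard (auto simp: tr_tree_def)
end

lemma PT_const: "PT (\<lambda>x. c)"
proof -
  have "PT (\<lambda>x::'a. t)" for t :: tree
  proof (induction t)
    case Leaf
    show ?case by (rule PT_leaf) (simp add: tr_tree_def)
  next
    case (Node a b)
    then show ?case by (rule PT_join[where h = Node]) (simp add: tr_tree_def)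
  qed
  from this[of "tr c"] show ?thesis unfolding PT_def by (simp add: tr_tree_def)
qed

lemma PT_left:
  fixes f :: "'a::encodable \<Rightarrow> 'b::encodable"
  assumes "\<And>x. tr (f x) = left (tr x)"
  shows "PT f"
proof (rule PTI)
  let ?c = "Cond 1 {1} (Seq (Pop 1) (Seq (move_tree 2) (Seq (move_tree 3) (Seq (clear 3)
      (move_all 2 1))))) (Pop 2)"
  show "wf_com ?c" by simp
  show "polyb (\<lambda>n. 30 * n + 20)" by (intro polyb_intros)
  fix x :: 'a and r and S :: store
  assume S: "clean S" "S 1 = code (tr x) @ r"
  show "bsle ?c S (30 * sz x + 20) (S(1 := code (tr (f x)) @ r))"
  proof (cases "tr x")
    case Leaf
    show ?thesis
      by (rule bsle_weaken, rule bsle_CondF, rule bsle_Pop)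
        (use S Leaf assms in \<open>auto simp: fun_eq_iff clean_def\<close>)
  next
    case (Node a b)
    have 1: "bsle (Pop 1) S 1 (S(1 := code a @ code b @ r))"
      using bsle_Pop[of 1 S] S Node by simp
    have 2: "bsle (move_tree 2) (S(1 := code a @ code b @ r)) (9 * tsize a + 4)
        (S(1 := code b @ r, 2 := rev (code a)))"
      by (rule bsle_weaken[OF move_tree[of _ a "code b @ r"]])
        (use S in \<open>auto simp: clean_def fun_eq_iff\<close>)
    have 3: "bsle (move_tree 3) (S(1 := code b @ r, 2 := rev (code a))) (9 * tsize b + 4)
        (S(1 := r, 2 := rev (code a), 3 := rev (code b)))"
      by (rule bsle_weaken[OF move_tree[of _ b r]])
        (use S in \<open>auto simp: clean_def fun_eq_iff\<close>)
    have 4: "bsle (clear 3) (S(1 := r, 2 := rev (code a), 3 := rev (code b))) (2 * tsize b + 1)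
        (S(1 := r, 2 := rev (code a)))"
      by (rule bsle_weaken[OF clear[of "rev (code b)"]])
        (use S set_code[of b] in \<open>auto simp: clean_def fun_eq_iff\<close>)
    have 5: "bsle (move_all 2 1) (S(1 := r, 2 := rev (code a))) (6 * tsize a + 1) (S(1 := code a @ r))"
      by (rule bsle_weaken[OF move_all[of "rev (code a)"]])
        (use S set_code[of a] in \<open>auto simp: clean_def fun_eq_iff\<close>)
    show ?thesis
      by (rule bsle_weaken[OF bsle_CondT[OF bsle_Seq[OF 1 bsle_Seq[OF 2 bsle_Seq[OF 3
              bsle_Seq[OF 4 5]]]]]])
        (use S Node assms[of x] in auto)
  qed
qed

lemma PT_right:
  fixes f :: "'a::encodable \<Rightarrow> 'b::encodable"
  assumes "\<And>x. tr (f x) = right (tr x)"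
  shows "PT f"
proof (rule PTI)
  let ?c = "Cond 1 {1} (Seq (Pop 1) drop_tree) (Pop 2)"
  show "wf_com ?c" by simp
  show "polyb (\<lambda>n. 11 * n + 20)" by (intro polyb_intros)
  fix x :: 'a and r and S :: store
  assume S: "clean S" "S 1 = code (tr x) @ r"
  show "bsle ?c S (11 * sz x + 20) (S(1 := code (tr (f x)) @ r))"
  proof (cases "tr x")
    case Leaf
    show ?thesis
      by (rule bsle_weaken, rule bsle_CondF, rule bsle_Pop)
        (use S Leaf assms in \<open>auto simp: fun_eq_iff clean_def\<close>)
  next
    case (Node a b)
    have 1: "bsle (Pop 1) S 1 (S(1 := code a @ code b @ r))"
      using bsle_Pop[of 1 S] S Node by simp
    have 2: "bsle drop_tree (S(1 := code a @ code b @ r)) (11 * tsize a + 6) (S(1 := code b @ r))"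
      by (rule bsle_weaken[OF drop_tree[of _ a "code b @ r"]]) (use S in auto)
    show ?thesis
      by (rule bsle_weaken[OF bsle_CondT[OF bsle_Seq[OF 1 2]]]) (use S Node assms[of x] in auto)
  qed
qed

lemma PT_fst: "PT f \<Longrightarrow> PT (\<lambda>x. fst (f x))"
  by (rule PT_comp[OF PT_left]) (simp_all add: tr_prod_def)

lemma PT_snd: "PT f \<Longrightarrow> PT (\<lambda>x. snd (f x))"
  by (rule PT_comp[OF PT_right]) (simp_all add: tr_prod_def)

lemma PT_If:
  fixes f :: "'a::encodable \<Rightarrow> 'b::encodable"
  assumes "PT p" "PT f" "PT g"
  shows "PT (\<lambda>x. if p x then f x else g x)"
proof -
  obtain c k where c: "wf_com c" "\<And>x r S. clean S \<Longrightarrow> S 1 = code (tr x) @ r \<Longrightarrow>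
      bsle c S ((sz x + 2) ^ k) (S(1 := code (tr (p x)) @ r))"
    using assms(1) by (rule PTE) blast
  obtain d m where d: "wf_com d" "\<And>x r S. clean S \<Longrightarrow> S 1 = code (tr x) @ r \<Longrightarrow>
      bsle d S ((sz x + 2) ^ m) (S(1 := code (tr (f x)) @ r))"
    using assms(2) by (rule PTE) blast
  obtain e l where e: "wf_com e" "\<And>x r S. clean S \<Longrightarrow> S 1 = code (tr x) @ r \<Longrightarrow>
      bsle e S ((sz x + 2) ^ l) (S(1 := code (tr (g x)) @ r))"
    using assms(3) by (rule PTE) blast
  let ?h = "\<lambda>x. if p x then f x else g x"
  let ?br = "Cond 1 {1} (Seq drop_tree d) (Seq drop_tree e)"
  show ?thesis
  proof (rule PTI)
    show "wf_com (Seq dup_tree (Seq c ?br))" using c d e by simp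
    show "polyb (\<lambda>n. 30 * n + (n + 2) ^ k + (n + 2) ^ m + (n + 2) ^ l + 60)" by (intro polyb_intros)
    fix x :: 'a and r and S :: store
    assume S: "clean S" "S 1 = code (tr x) @ r"
    let ?X = "code (tr x)"
    have 2: "bsle c (S(1 := ?X @ ?X @ r)) ((sz x + 2) ^ k) (S(1 := code (tr (p x)) @ ?X @ r))"
      using c(2)[of "S(1 := ?X @ ?X @ r)" x "?X @ r"] S by simp
    have dr: "bsle drop_tree (S(1 := code (tr (p x)) @ ?X @ r)) 40 (S(1 := ?X @ r))"
      by (rule bsle_weaken[OF drop_tree[of _ "tr (p x)" "?X @ r"]]) (use S in \<open>cases "p x"; auto\<close>)+
    have 3: "bsle ?br (S(1 := code (tr (p x)) @ ?X @ r))
        (Suc (Suc (40 + ((sz x + 2) ^ m + (sz x + 2) ^ l)))) (S(1 := code (tr (?h x)) @ r))"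
    proof (cases "p x")
      case True
      have "bsle d (S(1 := ?X @ r)) ((sz x + 2) ^ m) (S(1 := code (tr (f x)) @ r))"
        using d(2)[of "S(1 := ?X @ r)" x r] S by simp
      from bsle_CondT[OF bsle_Seq[OF dr this], of 1 "{1}"] show ?thesis
        by (rule bsle_weaken) (use True in auto)
    next
      case False
      have "bsle e (S(1 := ?X @ r)) ((sz x + 2) ^ l) (S(1 := code (tr (g x)) @ r))"
        using e(2)[of "S(1 := ?X @ r)" x r] S by simp
      from bsle_CondF[OF bsle_Seq[OF dr this], of 1 "{1}"] show ?thesis
        by (rule bsle_weaken) (use False in auto)
    qed
    show "bsle (Seq dup_tree (Seq c ?br)) S
       (30 * sz x + (sz x + 2) ^ k + (sz x + 2) ^ m + (sz x + 2) ^ l + 60) (S(1 := code (tr (?h x)) @ r))"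
      by (rule bsle_weaken[OF bsle_Seq[OF dup_tree[OF S] bsle_Seq[OF 2 3]]]) auto
  qed
qed

text \<open>The number \<open>n x\<close> of iterations is known to the proof, not to the program,
  which only tests \<open>p\<close>. The uniform size bound on all intermediate states is essential:
  polynomial growth in each round may compound to exponential growth. Between rounds, the stack
  holds the result of the test above the state.\<close>

lemma PT_while:
  fixes init :: "'a::encodable \<Rightarrow> 'b::encodable" and p :: "'b \<Rightarrow> bool" and f :: "'b \<Rightarrow> 'b"
  assumes init: "PT init" and p: "PT p" and f: "PT f" and "polyb b1" "polyb b2"
    and n: "\<And>x. n x \<le> b1 (sz x)"
    and size: "\<And>x i. i \<le> n x \<Longrightarrow> sz ((f ^^ i) (init x)) \<le> b2 (sz x)"
    and run: "\<And>x i. i < n x \<Longrightarrow> p ((f ^^ i) (init x))"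
    and stop: "\<And>x. \<not> p ((f ^^ n x) (init x))"
  shows "PT (\<lambda>x. (f ^^ n x) (init x))"
proof -
  obtain c k where c: "wf_com c" "\<And>x r S. clean S \<Longrightarrow> S 1 = code (tr x) @ r \<Longrightarrow>
      bsle c S ((sz x + 2) ^ k) (S(1 := code (tr (p x)) @ r))"
    using p by (rule PTE) blast
  obtain d m where d: "wf_com d" "\<And>x r S. clean S \<Longrightarrow> S 1 = code (tr x) @ r \<Longrightarrow>
      bsle d S ((sz x + 2) ^ m) (S(1 := code (tr (f x)) @ r))"
    using f by (rule PTE) blast
  obtain e l where e: "wf_com e" "\<And>x r S. clean S \<Longrightarrow> S 1 = code (tr x) @ r \<Longrightarrow>
      bsle e S ((sz x + 2) ^ l) (S(1 := code (tr (init x)) @ r))"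
    using init by (rule PTE) blast
  let ?test = "Seq dup_tree c"
  let ?body = "Seq drop_tree (Seq d ?test)"
  let ?st = "\<lambda>S r (x :: 'b). S(1 := code (tr (p x)) @ code (tr x) @ r) :: store"
  define T where "T N = Suc (30 * N + 10 + (N + 2) ^ k)" for N
  have test: "bsle ?test S (T N) (?st S r x)"
    if "clean S" "S 1 = code (tr x) @ r" "sz x \<le> N" for S r x N
  proof -
    let ?X = "code (tr x)"
    have 2: "bsle c (S(1 := ?X @ ?X @ r)) ((sz x + 2) ^ k) (?st S r x)"
      using c(2)[of "S(1 := ?X @ ?X @ r)" x "?X @ r"] that by simp
    have "(sz x + 2) ^ k \<le> (N + 2) ^ k" using that(3) by (intro power_mono) auto
    then show ?thesis
      by (intro bsle_weaken[OF bsle_Seq[OF dup_tree[OF that(1,2)] 2]]) (use that in \<open>auto simp: T_def\<close>)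
  qed
  have drop: "bsle drop_tree (?st S r x) 40 (S(1 := code (tr x) @ r))" if "clean S" for S r x
    by (rule bsle_weaken[OF drop_tree[of _ "tr (p x)" "code (tr x) @ r"]])
      (use that in \<open>cases "p x"; auto\<close>)+
  define Q where "Q N = Suc (40 + Suc ((N + 2) ^ m + T N))" for N
  have body: "bsle ?body (?st S r x) (Q N) (?st S r (f x))"
    if S: "clean S" and N: "sz x \<le> N" "sz (f x) \<le> N" for S r x N
  proof -
    have 2: "bsle d (S(1 := code (tr x) @ r)) ((sz x + 2) ^ m) (S(1 := code (tr (f x)) @ r))"
      using d(2)[of "S(1 := code (tr x) @ r)" x r] S by simp
    have 3: "bsle ?test (S(1 := code (tr (f x)) @ r)) (T N) (?st S r (f x))"
      using test[of "S(1 := code (tr (f x)) @ r)" "f x" r N] S N by simp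
    have "(sz x + 2) ^ m \<le> (N + 2) ^ m" using N by (intro power_mono) auto
    then show ?thesis
      by (intro bsle_weaken[OF bsle_Seq[OF drop[OF S] bsle_Seq[OF 2 3]]]) (auto simp: Q_def)
  qed
  have loop: "bsle (Loop 1 {1} ?body) (?st S r x) (j * Suc (Q N) + 1) (?st S r ((f ^^ j) x))"
    if "clean S" "\<And>i. i \<le> j \<Longrightarrow> sz ((f ^^ i) x) \<le> N" "\<And>i. i < j \<Longrightarrow> p ((f ^^ i) x)"
      "\<not> p ((f ^^ j) x)" for S r x j N
    using that(2-)
  proof (induction j arbitrary: x)
    case 0
    then have "bsle (Loop 1 {1} ?body) (?st S r x) 1 (?st S r x)" by (intro bsle_LoopF) auto
    then show ?case by (simp add: fun_upd_def)
  next
    case (Suc j)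
    have "sz ((f ^^ i) (f x)) \<le> N" if "i \<le> j" for i
      using Suc.prems(1)[of "Suc i"] that by (simp add: funpow_swap1)
    moreover have "p ((f ^^ i) (f x))" if "i < j" for i
      using Suc.prems(2)[of "Suc i"] that by (simp add: funpow_swap1)
    moreover have "\<not> p ((f ^^ j) (f x))" using Suc.prems(3) by (simp add: funpow_swap1)
    ultimately have "bsle (Loop 1 {1} ?body) (?st S r (f x)) (j * Suc (Q N) + 1)
        (?st S r ((f ^^ j) (f x)))"
      using Suc.IH[of "f x"] by (simp add: fun_upd_def)
    moreover have "bsle ?body (?st S r x) (Q N) (?st S r (f x))"
      using that(1) Suc.prems(1)[of 0] Suc.prems(1)[of 1] by (intro body) auto
    ultimately have "bsle (Loop 1 {1} ?body) (?st S r x) (Suc (Q N + (j * Suc (Q N) + 1)))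
        (?st S r ((f ^^ j) (f x)))"
      using Suc.prems(2)[of 0] by (intro bsle_LoopT) auto
    then show ?case by (rule bsle_weaken) (auto simp: funpow_swap1 fun_upd_def)
  qed
  define B where "B N = (N + 2) ^ l + T (b2 N) + b1 N * Suc (Q (b2 N)) + 50" for N
  show ?thesis
  proof (rule PTI)
    let ?prog = "Seq e (Seq ?test (Seq (Loop 1 {1} ?body) drop_tree))"
    show "wf_com ?prog" using c d e by simp
    show "polyb B" unfolding B_def Q_def T_def
      by (intro polyb_intros assms(4,5) polyb_comp[of "\<lambda>n. n", OF polyb_id])
    fix x :: 'a and r and S :: store
    assume S: "clean S" "S 1 = code (tr x) @ r"
    let ?z = "(f ^^ n x) (init x)"
    have 2: "bsle ?test (S(1 := code (tr (init x)) @ r)) (T (b2 (sz x))) (?st S r (init x))"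
      using test[of "S(1 := code (tr (init x)) @ r)" "init x" r "b2 (sz x)"] S size[of 0 x] by simp
    have 3: "bsle (Loop 1 {1} ?body) (?st S r (init x)) (n x * Suc (Q (b2 (sz x))) + 1) (?st S r ?z)"
      using size[of _ x] run[of _ x] stop[of x] by (intro loop S(1)) auto
    have "n x * Suc (Q (b2 (sz x))) \<le> b1 (sz x) * Suc (Q (b2 (sz x)))"
      using n[of x] by (rule mult_le_mono1)
    then show "bsle ?prog S (B (sz x)) (S(1 := code (tr ?z) @ r))"
      by (intro bsle_weaken[OF bsle_Seq[OF e(2)[OF S] bsle_Seq[OF 2 bsle_Seq[OF 3 drop[OF S(1)]]]]])
        (auto simp: B_def)
  qed
qed

subsection \<open>List functions\<close>

lemma PT_tree:
  fixes f :: "'a::encodable \<Rightarrow> 'b::encodable" and H :: "tree \<Rightarrow> tree"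
  assumes "PT H" "\<And>x. tr (f x) = H (tr x)"
  shows "PT f"
  using assms unfolding PT_def tr_tree_def by (metis (no_types, lifting))

lemma PT_comp2:
  "PT (\<lambda>z. F (fst z) (snd z)) \<Longrightarrow> PT a \<Longrightarrow> PT b \<Longrightarrow> PT (\<lambda>x. F (a x) (b x))"
  using PT_comp[of "\<lambda>z. F (fst z) (snd z)" "\<lambda>x. (a x, b x)"] by (simp add: PT_Pair)

lemma PT_not: "PT p \<Longrightarrow> PT (\<lambda>x. \<not> p x)"
  by (drule PT_eq[OF _ PT_const[of False]]) simp

lemma PT_conj:
  assumes "PT p" "PT q"
  shows "PT (\<lambda>x. p x \<and> q x)"
  using PT_If[OF assms PT_const[of False]] by (rule back_subst[of PT]) auto

lemma PT_disj:
  assumes "PT p" "PT q"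
  shows "PT (\<lambda>x. p x \<or> q x)"
  using PT_If[OF assms(1) PT_const[of True] assms(2)] by (rule back_subst[of PT]) auto

lemma PT_imp:
  assumes "PT p" "PT q"
  shows "PT (\<lambda>x. p x \<longrightarrow> q x)"
  using PT_If[OF assms PT_const[of True]] by (rule back_subst[of PT]) auto

lemma tr_tl: "tr (tl xs) = right (tr xs)"
  by (cases xs) auto

lemma PT_tl: "PT f \<Longrightarrow> PT (\<lambda>x. tl (f x))"
  by (rule PT_comp[of tl, OF PT_right[OF tr_tl]])

lemma PT_hd:
  assumes "PT f"
  shows "PT (\<lambda>x. hd (f x :: 'b::encodable list))"
proof (rule PT_comp[of hd, OF _ assms])
  \<comment> \<open>The value of \<open>hd []\<close> is unspecified but fixed, so its code is a
    constant.\<close>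
  have "PT (\<lambda>t. if t = Leaf then tr (hd [] :: 'b) else left t)"
    by (intro PT_If PT_eq PT_id PT_const PT_left) (simp add: tr_tree_def)
  then show "PT (hd :: 'b list \<Rightarrow> 'b)"
  proof (rule PT_tree)
    fix x :: "'b list"
    show "tr (hd x) = (if tr x = Leaf then tr (hd [] :: 'b) else left (tr x))" by (cases x) auto
  qed
qed

lemma PT_case_list:
  assumes "PT xs" "PT f" "PT (\<lambda>z. g (fst z) (fst (snd z)) (snd (snd z)))"
  shows "PT (\<lambda>e. case xs e of [] \<Rightarrow> f e | y # ys \<Rightarrow> g e y ys)"
proof -
  have "PT (\<lambda>e. if xs e = [] then f e else
      (\<lambda>z. g (fst z) (fst (snd z)) (snd (snd z))) (e, hd (xs e), tl (xs e)))"
    by (rule PT_If[OF PT_eq[OF assms(1) PT_const] assms(2)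
          PT_comp[OF assms(3) PT_Pair[OF PT_id PT_Pair[OF PT_hd[OF assms(1)] PT_tl[OF assms(1)]]]]])
  then show ?thesis by (rule back_subst[of PT]) (auto simp: fun_eq_iff split: list.split)
qed

lemma PT_Suc:
  assumes "PT f"
  shows "PT (\<lambda>x. Suc (f x))"
\<comment> \<open>The first argument is a dummy that is dropped again; the symbols
  \<open>1, 2\<close> in front of a code add a node whose left subtree is a leaf.\<close>
proof (rule PT_binary[OF PT_const[of False] assms, of "Seq drop_tree (Seq (Push 1 2) (Push 1 1))" "\<lambda>n. 11 * n + 20" "\<lambda>_ n. Suc n"])
  fix a :: bool and n :: nat and r and S :: store
  assume S: "clean S" "S 1 = code (tr a) @ code (tr n) @ r"
  show "bsle (Seq drop_tree (Seq (Push 1 2) (Push 1 1))) S (11 * (sz a + sz n) + 20)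
      (S(1 := code (tr (Suc n)) @ r))"
    by (rule bsle_weaken[OF bsle_Seq[OF drop_tree[OF S] bsle_Seq[OF bsle_Push bsle_Push]]])
      (auto simp: fun_eq_iff)
qed (auto intro!: polyb_intros simp: mono_def)

lemma tr_pred: "tr (n - Suc 0) = right (tr n)"
  by (cases n) auto

lemma PT_pred: "PT f \<Longrightarrow> PT (\<lambda>x. f x - Suc 0)"
  by (rule PT_comp[of "\<lambda>n. n - Suc 0", OF PT_right[OF tr_pred]])

lemma tr_replicate_False: "tr (replicate n False) = tr n"
  by (induction n) auto

lemma PT_replicate_False: "PT f \<Longrightarrow> PT (\<lambda>x. replicate (f x) False)"
  by (rule PT_comp[of "\<lambda>n. replicate n False", OF PT_retag[OF tr_replicate_False]])

lemma sz_elem: "x \<in> set xs \<Longrightarrow> sz x \<le> sz xs"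
  by (induction xs) auto

lemma length_le_sz: "length xs \<le> sz xs"
  by (induction xs) auto

lemma sz_drop: "sz (drop i xs) \<le> sz xs"
  by (induction xs arbitrary: i) (auto simp: drop_Cons' le_SucI trans_le_add2)

lemma sz_take: "sz (take i xs) \<le> sz xs"
  by (induction xs arbitrary: i) (auto simp: take_Cons' tsize_pos)

lemma sz_append: "sz (xs @ ys) \<le> sz xs + sz ys"
  by (induction xs) auto

lemma sz_rev: "sz (rev xs) = sz xs"
proof -
  have "sz (xs @ ys) + 1 = sz xs + sz ys" for xs ys :: "'a list" by (induction xs) auto
  from this[of "rev _" "[_]"] show ?thesis
    by (induction xs) (auto simp: add.commute)
qed

lemma sz_list_bound: "(\<And>x. x \<in> set xs \<Longrightarrow> sz x \<le> B) \<Longrightarrow> sz xs \<le> length xs * Suc B + 1"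
proof (induction xs)
  case (Cons x xs)
  then have "sz x \<le> B" "sz xs \<le> length xs * Suc B + 1" by auto
  then show ?case by simp
qed simp

lemma sz_nat: "sz (n :: nat) = 2 * n + 1"
  by (induction n) auto

lemma sz_bool: "sz (b :: bool) \<le> 3"
  by (cases b) auto

text \<open>The fold becomes a while loop over triples of environment, accumulator and remaining
  list. As for loops in general, the sizes of all intermediate accumulators have to be bounded in
  terms of the environment.\<close>

lemma PT_foldl:
  fixes f :: "'e::encodable \<Rightarrow> 'b::encodable \<Rightarrow> 'a::encodable \<Rightarrow> 'b"
  assumes init: "PT init" and xs: "PT xs" and f: "PT (\<lambda>z. f (fst z) (fst (snd z)) (snd (snd z)))"
    and b: "polyb b"
    and bound: "\<And>e i. i \<le> length (xs e) \<Longrightarrow> sz (foldl (f e) (init e) (take i (xs e))) \<le> b (sz e)"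
  shows "PT (\<lambda>e. foldl (f e) (init e) (xs e))"
proof -
  define step where "step = (\<lambda>(e, acc, ys). case ys of [] \<Rightarrow> (e, acc, ys) | y # ys' \<Rightarrow> (e, f e acc y, ys'))"
  have "PT (\<lambda>s. case snd (snd s) of [] \<Rightarrow> s | y # ys' \<Rightarrow> (fst s, f (fst s) (fst (snd s)) y, ys'))"
    by (intro PT_case_list PT_Pair PT_fst PT_snd PT_id
        PT_comp[OF f, of "\<lambda>z. (fst (fst z), fst (snd (fst z)), fst (snd z))", simplified])
  then have step: "PT step"
    unfolding step_def by (rule back_subst[of PT]) (auto simp: fun_eq_iff split: list.split)
  obtain bx where bx: "polyb bx" "\<And>e. sz (xs e) \<le> bx (sz e)"
    using PT_size[OF xs] by blast
  have it: "(step ^^ i) (e, init e, xs e) = (e, foldl (f e) (init e) (take i (xs e)), drop i (xs e))"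
    if "i \<le> length (xs e)" for e i
    using that
  proof (induction i)
    case (Suc i)
    then have d: "drop i (xs e) = xs e ! i # drop (Suc i) (xs e)"
      by (simp add: Cons_nth_drop_Suc)
    have "(step ^^ Suc i) (e, init e, xs e) = step ((step ^^ i) (e, init e, xs e))" by simp
    also have "\<dots> = step (e, foldl (f e) (init e) (take i (xs e)), drop i (xs e))"
      using Suc by simp
    also have "\<dots> = (e, foldl (f e) (init e) (take (Suc i) (xs e)), drop (Suc i) (xs e))"
      unfolding step_def d using Suc.prems by (simp add: take_Suc_conv_app_nth)
    finally show ?case .
  qed simp
  have "PT (\<lambda>e. (step ^^ length (xs e)) (e, init e, xs e))"
  proof (rule PT_while[OF _ _ step])
    show "PT (\<lambda>e. (e, init e, xs e))" by (intro PT_Pair PT_id init xs)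
    show "PT (\<lambda>s :: 'e \<times> 'b \<times> 'a list. snd (snd s) \<noteq> [])"
      by (intro PT_not PT_eq PT_snd PT_id PT_const)
    show "polyb bx" by fact
    show "polyb (\<lambda>n. n + b n + bx n + 2)" by (intro polyb_intros b bx)
    show "length (xs e) \<le> bx (sz e)" for e using bx(2)[of e] length_le_sz[of "xs e"] by linarith
    show "sz ((step ^^ i) (e, init e, xs e)) \<le> sz e + b (sz e) + bx (sz e) + 2"
      if "i \<le> length (xs e)" for e i
      using it[OF that] bound[OF that] sz_drop[of i "xs e"] bx(2)[of e] by simp
    show "snd (snd ((step ^^ i) (e, init e, xs e))) \<noteq> []" if "i < length (xs e)" for e i
      using it[of i e] that by simp
    show "\<not> snd (snd ((step ^^ length (xs e)) (e, init e, xs e))) \<noteq> []" for e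
      using it[of "length (xs e)" e] by simp
  qed
  from PT_fst[OF PT_snd[OF this]] show ?thesis using it by simp
qed

lemma PT_rev: "PT f \<Longrightarrow> PT (\<lambda>x. rev (f x :: 'b::encodable list))"
proof (rule PT_comp[of "rev"])
  have "PT (\<lambda>xs :: 'b list. foldl (\<lambda>a y. y # a) [] xs)"
  proof (rule PT_foldl[OF PT_const PT_id _ polyb_id])
    fix xs :: "'b list" and i
    have "foldl (\<lambda>a y. y # a) zs ys = rev ys @ zs" for zs ys :: "'b list"
      by (induction ys arbitrary: zs) auto
    then show "sz (foldl (\<lambda>a y. y # a) [] (take i xs)) \<le> sz xs"
      by (simp add: sz_rev sz_take)
  qed (intro PT_Cons PT_fst PT_snd PT_id)
  moreover have "foldl (\<lambda>a y. y # a) zs ys = rev ys @ zs" for zs ys :: "'b list"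
    by (induction ys arbitrary: zs) auto
  ultimately show "PT (rev :: 'b list \<Rightarrow> 'b list)" by simp
qed

lemma PT_append:
  assumes "PT f" "PT g"
  shows "PT (\<lambda>x. f x @ (g x :: 'b::encodable list))"
proof (rule PT_comp2[OF _ assms])
  have fl: "foldl (\<lambda>a y. y # a) zs ys = rev ys @ zs" for zs ys :: "'b list"
    by (induction ys arbitrary: zs) auto
  have "PT (\<lambda>z :: 'b list \<times> 'b list. foldl (\<lambda>a y. y # a) (snd z) (rev (fst z)))"
  proof (rule PT_foldl[OF _ _ _ polyb_id])
    fix z :: "'b list \<times> 'b list" and i
    show "sz (foldl (\<lambda>a y. y # a) (snd z) (take i (rev (fst z)))) \<le> sz z"
      using sz_append[of "rev (take i (rev (fst z)))" "snd z"] sz_take[of i "rev (fst z)"]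
      by (simp add: fl sz_rev tr_prod_def)
  qed (intro PT_Cons PT_fst PT_snd PT_id PT_rev)+
  then show "PT (\<lambda>z :: 'b list \<times> 'b list. fst z @ snd z)" by (simp add: fl)
qed

lemma PT_map:
  fixes f :: "'e::encodable \<Rightarrow> 'a::encodable \<Rightarrow> 'b::encodable"
  assumes f: "PT (\<lambda>z. f (fst z) (snd z))" and xs: "PT xs"
  shows "PT (\<lambda>e. map (f e) (xs e))"
proof -
  have fl: "foldl (\<lambda>a y. f e y # a) zs ys = rev (map (f e) ys) @ zs" for zs ys e
    by (induction ys arbitrary: zs) auto
  obtain bx where bx: "polyb bx" "\<And>e. sz (xs e) \<le> bx (sz e)"
    using PT_size[OF xs] by blast
  obtain bf where bf: "polyb bf" "mono bf" "\<And>z. sz (f (fst z) (snd z)) \<le> bf (sz z)"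
    using PT_size[OF f] by blast
  have "PT (\<lambda>e. foldl (\<lambda>a y. f e y # a) [] (xs e))"
  proof (rule PT_foldl[OF PT_const xs])
    show "PT (\<lambda>z. f (fst z) (snd (snd z)) # fst (snd z))"
      by (intro PT_Cons PT_fst PT_snd PT_id PT_comp[OF f, of "\<lambda>z. (fst z, snd (snd z))", simplified]
          PT_Pair)
    show "polyb (\<lambda>n. bx n * Suc (bf (n + bx n + 1)) + 1)"
      by (intro polyb_intros polyb_comp[OF bf(1)] bx)
    fix e i assume i: "i \<le> length (xs e)"
    let ?B = "bf (sz e + bx (sz e) + 1)"
    have "sz (map (f e) (take i (xs e))) \<le> length (map (f e) (take i (xs e))) * Suc ?B + 1"
    proof (rule sz_list_bound)
      fix y assume "y \<in> set (map (f e) (take i (xs e)))"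
      then obtain x where x: "x \<in> set (xs e)" "y = f e x" by (auto dest: in_set_takeD)
      have "sz (e, x) \<le> sz e + bx (sz e) + 1" using sz_elem[OF x(1)] bx(2)[of e] by simp
      then have "bf (sz (e, x)) \<le> ?B" by (rule monoD[OF bf(2)])
      then show "sz y \<le> ?B" using bf(3)[of "(e, x)"] x(2) by simp
    qed
    also have "\<dots> \<le> bx (sz e) * Suc ?B + 1"
      using bx(2)[of e] length_le_sz[of "xs e"] i by (intro add_mono mult_le_mono1) auto
    finally show "sz (foldl (\<lambda>a y. f e y # a) [] (take i (xs e))) \<le> bx (sz e) * Suc ?B + 1"
      by (simp add: fl sz_rev)
  qed
  from PT_rev[OF this] show ?thesis by (simp add: fl)
qed

lemma PT_concat: "PT f \<Longrightarrow> PT (\<lambda>x. concat (f x :: 'b::encodable list list))"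
proof (rule PT_comp[of "concat"])
  have fl: "foldl (\<lambda>a y. a @ y) zs ys = zs @ concat ys" for zs :: "'b list" and ys
    by (induction ys arbitrary: zs) auto
  have "PT (\<lambda>x :: 'b list list. foldl (\<lambda>a y. a @ y) [] x)"
  proof (rule PT_foldl[OF PT_const PT_id _ polyb_id])
    fix x :: "'b list list" and i
    have "sz (concat ys) \<le> sz ys" for ys :: "'b list list"
    proof (induction ys)
      case (Cons y ys)
      then show ?case using sz_append[of y "concat ys"] by simp
    qed simp
    then show "sz (foldl (\<lambda>a y. a @ y) [] (take i x)) \<le> sz x"
      using sz_take[of i x] by (simp add: fl) (meson le_trans)
  qed (intro PT_append PT_fst PT_snd PT_id)
  then show "PT (concat :: 'b list list \<Rightarrow> 'b list)" by (simp add: fl)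
qed

lemma PT_filter:
  fixes xs :: "'e::encodable \<Rightarrow> 'a::encodable list"
  assumes "PT (\<lambda>z. p (fst z) (snd z))" "PT xs"
  shows "PT (\<lambda>e. filter (p e) (xs e))"
proof -
  have "PT (\<lambda>e. concat (map (\<lambda>x. if p e x then [x] else []) (xs e)))"
    by (intro PT_concat PT_map PT_If assms PT_Cons PT_snd PT_id PT_const)
  moreover have "concat (map (\<lambda>x. if q x then [x] else []) ys) = filter q ys" for q and ys :: "'a list"
    by (induction ys) auto
  ultimately show ?thesis by simp
qed

lemma PT_Ball:
  fixes xs :: "'e::encodable \<Rightarrow> 'a::encodable list"
  assumes p: "PT (\<lambda>z. p (fst z) (snd z))" and xs: "PT xs"
  shows "PT (\<lambda>e. \<forall>x\<in>set (xs e). p e x)"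
proof -
  have "PT (\<lambda>e. foldl (\<lambda>b x. b \<and> p e x) True (xs e))"
    by (rule PT_foldl[OF PT_const xs _ polyb_const sz_bool])
      (intro PT_conj PT_fst PT_snd PT_id PT_comp[OF p, of "\<lambda>z. (fst z, snd (snd z))", simplified]
        PT_Pair)
  moreover have "foldl (\<lambda>b x. b \<and> q x) b ys \<longleftrightarrow> b \<and> (\<forall>x\<in>set ys. q x)" for q b and ys :: "'a list"
    by (induction ys arbitrary: b) auto
  ultimately show ?thesis by simp
qed

lemma PT_Bex:
  assumes p: "PT (\<lambda>z. p (fst z) (snd z))" and xs: "PT xs"
  shows "PT (\<lambda>e. \<exists>x\<in>set (xs e). p e x)"
  using PT_not[OF PT_Ball[OF PT_not[OF p] xs]] by simp

lemma PT_member: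
  assumes "PT f" "PT xs"
  shows "PT (\<lambda>e. f e \<in> set (xs e))"
proof -
  have "PT (\<lambda>e. \<exists>x\<in>set (xs e). x = f e)"
    by (intro PT_Bex PT_eq PT_snd PT_id PT_comp[OF assms(1)] PT_fst assms(2))
  then show ?thesis by simp
qed

lemma PT_length: "PT f \<Longrightarrow> PT (\<lambda>x. length (f x :: 'b::encodable list))"
proof (rule PT_comp[of "length"])
  have fl: "foldl (\<lambda>a y. Suc a) n ys = n + length ys" for n and ys :: "'b list"
    by (induction ys arbitrary: n) auto
  have "PT (\<lambda>x :: 'b list. foldl (\<lambda>a y. Suc a) 0 x)"
  proof (rule PT_foldl[OF PT_const PT_id])
    show "polyb (\<lambda>n. 2 * n + 1)" by (intro polyb_intros)
    show "sz (foldl (\<lambda>a y. Suc a) 0 (take i x)) \<le> 2 * sz x + 1" for x :: "'b list" and i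
      using length_le_sz[of x] by (simp add: fl sz_nat)
  qed (intro PT_Suc PT_fst PT_snd PT_id)
  then show "PT (length :: 'b list \<Rightarrow> nat)" by (simp add: fl)
qed

text \<open>The accumulator of the fold is the reversed initial segment, so its length is the next
  number to be added.\<close>

lemma PT_upt: "PT f \<Longrightarrow> PT (\<lambda>x. [0..<f x])"
proof (rule PT_comp[of "\<lambda>n. [0..<n]"])
  have fl: "foldl (\<lambda>a y. length a # a) (rev [0..<m]) (ys :: bool list) = rev [0..<m + length ys]" for m ys
  proof (induction ys arbitrary: m)
    case (Cons y ys)
    from Cons[of "Suc m"] show ?case by simp
  qed simp
  have "PT (\<lambda>n. foldl (\<lambda>a y. length a # a) [] (replicate n False))"
  proof (rule PT_foldl[OF PT_const])
    show "polyb (\<lambda>n. n * Suc (2 * n + 1) + 1)" by (intro polyb_intros)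
    fix n i :: nat assume i: "i \<le> length (replicate n False)"
    have "sz [0..<i] \<le> length [0..<i] * Suc (2 * n + 1) + 1"
      using i by (intro sz_list_bound) (auto simp: sz_nat)
    also have "\<dots> \<le> sz n * Suc (2 * sz n + 1) + 1"
      using i by (intro add_mono mult_mono) (auto simp: sz_nat)
    finally show "sz (foldl (\<lambda>a y. length a # a) [] (take i (replicate n False)))
        \<le> sz n * Suc (2 * sz n + 1) + 1"
      using fl[of 0 "replicate i False"] i by (simp add: sz_rev min_absorb1)
  qed (intro PT_Cons PT_length PT_fst PT_snd PT_id PT_replicate_False)+
  from PT_rev[OF this] show "PT (\<lambda>n. [0..<n])" using fl[of 0] by simp
qed

lemma PT_add:
  assumes "PT f" "PT g"
  shows "PT (\<lambda>x. f x + (g x :: nat))"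
proof (rule PT_comp2[OF _ assms])
  have fl: "foldl (\<lambda>a y. Suc a) n ys = n + length ys" for n and ys :: "bool list"
    by (induction ys arbitrary: n) auto
  have "PT (\<lambda>z. foldl (\<lambda>a y. Suc a) (fst z) (replicate (snd z) False))"
  proof (rule PT_foldl[OF _ _ _ polyb_id])
    show "sz (foldl (\<lambda>a y. Suc a) (fst z) (take i (replicate (snd z) False))) \<le> sz z"
      if "i \<le> length (replicate (snd z) False)" for z :: "nat \<times> nat" and i
      using that by (simp add: fl sz_nat tr_prod_def)
  qed (intro PT_Suc PT_fst PT_snd PT_id PT_replicate_False)+
  then show "PT (\<lambda>z :: nat \<times> nat. fst z + snd z)" by (simp add: fl)
qed

lemma PT_mult:
  assumes "PT f" "PT g"
  shows "PT (\<lambda>x. f x * (g x :: nat))"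
proof (rule PT_comp2[OF _ assms])
  have fl: "foldl (\<lambda>a y. m + a) n ys = n + m * length ys" for m n :: nat and ys :: "bool list"
    by (induction ys arbitrary: n) auto
  have "PT (\<lambda>z :: nat \<times> nat. foldl (\<lambda>a y. fst z + a) 0 (replicate (snd z) False))"
  proof (rule PT_foldl[OF PT_const])
    show "polyb (\<lambda>n. 2 * (n * n) + 1)" by (intro polyb_intros)
    fix z :: "nat \<times> nat" and i assume i: "i \<le> length (replicate (snd z) False)"
    have "fst z * min i (snd z) \<le> sz z * sz z"
      by (intro mult_mono) (auto simp: tr_prod_def sz_nat)
    then show "sz (foldl (\<lambda>a y. fst z + a) 0 (take i (replicate (snd z) False))) \<le> 2 * (sz z * sz z) + 1"
      by (simp add: fl sz_nat)
  qed (intro PT_add PT_fst PT_snd PT_id PT_replicate_False)+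
  then show "PT (\<lambda>z :: nat \<times> nat. fst z * snd z)" by (simp add: fl)
qed

lemma PT_power: "PT f \<Longrightarrow> PT (\<lambda>x. (f x :: nat) ^ k)"
  by (induction k) (auto intro: PT_const PT_mult)

text \<open>Since \<open>cs\<close> does not depend on the input, each \<open>f c\<close> may have a
  program of its own. This is how arbitrary functions on finite sets, such as a transition function,
  are tabulated.\<close>

lemma PT_map_consts: "(\<And>c. c \<in> set cs \<Longrightarrow> PT (f c)) \<Longrightarrow> PT (\<lambda>e. map (\<lambda>c. f c e) cs)"
  by (induction cs) (auto intro: PT_const PT_Cons)

lemmas PT_intros =
  PT_id PT_const PT_Pair PT_fst PT_snd PT_If PT_eq PT_not PT_conj PT_disj PT_imp PT_Cons PT_hd PT_tl
  PT_case_list PT_Suc PT_pred PT_rev PT_append PT_map PT_concat PT_filter PT_Ball PT_Bex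
  PT_member PT_length PT_upt PT_add PT_mult PT_power

section \<open>From polynomial-time functions to Turing machines\<close>

lemma sz_bools: "sz (w :: bool list) \<le> 4 * length w + 1"
proof -
  have "sz w \<le> length w * Suc 3 + 1" by (rule sz_list_bound) (rule sz_bool)
  then show ?thesis by simp
qed

text \<open>Moving the input to stack 2 reverses it, so the list is built from its last bit. A cons
  cell is \<open>1\<close> followed by the code of the bit, which is \<open>[2]\<close> for
  \<open>False\<close> and \<open>[1, 2, 2]\<close> for \<open>True\<close>.\<close>

definition read_input :: com where
  "read_input = Seq (move_all 0 2) (Seq (Push 1 2)
     (Loop 2 {1, 2} (Cond 2 {1} (Seq (Pop 2) (Seq (Push 1 2) (Push 1 1)))
        (Seq (Pop 2) (Seq (Push 1 2) (Seq (Push 1 2) (Seq (Push 1 1) (Push 1 1))))))))"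

lemma read_loop:
  fixes u v :: "bool list"
  assumes "S 2 = map bit_symbol v" "S 1 = code (tr u)"
  shows "bsle (Loop 2 {1, 2} (Cond 2 {1} (Seq (Pop 2) (Seq (Push 1 2) (Push 1 1)))
        (Seq (Pop 2) (Seq (Push 1 2) (Seq (Push 1 2) (Seq (Push 1 1) (Push 1 1)))))))
     S (20 * length v + 1) (S(1 := code (tr (rev v @ u)), 2 := []))"
    (is "bsle (Loop 2 {1, 2} ?body) _ _ _")
  using assms
proof (induction v arbitrary: u S)
  case Nil
  then have "bsle (Loop 2 {1, 2} ?body) S 1 S" by (intro bsle_LoopF) auto
  then show ?case by (rule bsle_weaken) (use Nil in \<open>auto simp: fun_eq_iff\<close>)
next
  case (Cons b v)
  define S1 where "S1 = S(1 := code (tr (b # u)), 2 := map bit_symbol v)"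
  have 1: "bsle ?body S 19 S1"
  proof (cases b)
    case False
    show ?thesis
      by (rule bsle_weaken, rule bsle_CondT, (rule bsle_Seq bsle_Push bsle_Pop)+)
        (use Cons.prems False in \<open>auto simp: fun_eq_iff S1_def bit_symbol_def\<close>)
  next
    case True
    show ?thesis
      by (rule bsle_weaken, rule bsle_CondF, (rule bsle_Seq bsle_Push bsle_Pop)+)
        (use Cons.prems True in \<open>auto simp: fun_eq_iff S1_def bit_symbol_def\<close>)
  qed
  have 2: "bsle (Loop 2 {1, 2} ?body) S1 (20 * length v + 1)
      (S1(1 := code (tr (rev v @ b # u)), 2 := []))"
    by (rule bsle_weaken[OF Cons.IH[of S1 "b # u"]]) (auto simp: S1_def fun_upd_def)
  show ?case
    by (rule bsle_weaken[OF bsle_LoopT[OF 1 2]])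
      (use Cons.prems in \<open>auto simp: S1_def bit_symbol_def fun_eq_iff\<close>)
qed

lemma read_input:
  "bsle read_input (initial_store w) (26 * length w + 6) ((\<lambda>_. [])(1 := code (tr w)))"
proof -
  define S1 :: store where "S1 = (\<lambda>_. [])(2 := rev (map bit_symbol w))"
  have 1: "bsle (move_all 0 2) (initial_store w) (6 * length w + 1) S1"
    by (rule bsle_weaken[OF move_all[of "map bit_symbol w"]])
      (auto simp: initial_store_def S1_def bit_symbol_def fun_eq_iff)
  have 2: "bsle (Push 1 2) S1 2 (S1(1 := [2]))" using bsle_Push[of 1 2 S1] by (simp add: S1_def)
  have 3: "bsle (Loop 2 {1, 2} (Cond 2 {1} (Seq (Pop 2) (Seq (Push 1 2) (Push 1 1)))
        (Seq (Pop 2) (Seq (Push 1 2) (Seq (Push 1 2) (Seq (Push 1 1) (Push 1 1)))))))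
      (S1(1 := [2])) (20 * length w + 1) ((\<lambda>_. [])(1 := code (tr w)))"
    by (rule bsle_weaken[OF read_loop[of _ "rev w" "[]"]])
      (auto simp: S1_def rev_map fun_eq_iff)
  show ?thesis unfolding read_input_def
    by (rule bsle_weaken[OF bsle_Seq[OF 1 bsle_Seq[OF 2 3]]]) auto
qed

definition write_output :: com where
  "write_output = Loop 1 {1} (Seq (Pop 1) (Cond 1 {1}
     (Seq (Pop 1) (Seq (Pop 1) (Seq (Pop 1) (Push 5 2)))) (Seq (Pop 1) (Push 5 1))))"

lemma write_output:
  fixes v :: "bool list"
  assumes "S 1 = code (tr v)"
  shows "bsle write_output S (14 * length v + 1) (S(1 := [2], 5 := rev (map bit_symbol v) @ S 5))"
  using assms
proof (induction v arbitrary: S)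
  case Nil
  have "bsle write_output S 1 S" unfolding write_output_def using Nil by (intro bsle_LoopF) auto
  then show ?case by (rule bsle_weaken) (use Nil in \<open>auto simp: fun_eq_iff\<close>)
next
  case (Cons b v)
  let ?br = "Cond 1 {1} (Seq (Pop 1) (Seq (Pop 1) (Seq (Pop 1) (Push 5 2)))) (Seq (Pop 1) (Push 5 1))"
  define S1 where "S1 = S(1 := code (tr v), 5 := bit_symbol b # S 5)"
  have p: "bsle (Pop 1) S 1 (S(1 := code (tr b) @ code (tr v)))"
    using bsle_Pop[of 1 S] Cons.prems by simp
  have br: "bsle ?br (S(1 := code (tr b) @ code (tr v))) 11 S1"
  proof (cases b)
    case True
    show ?thesis
      by (rule bsle_weaken, rule bsle_CondT, (rule bsle_Seq bsle_Push bsle_Pop)+)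
        (use True in \<open>auto simp: fun_eq_iff S1_def bit_symbol_def\<close>)
  next
    case False
    show ?thesis
      by (rule bsle_weaken, rule bsle_CondF, (rule bsle_Seq bsle_Push bsle_Pop)+)
        (use False in \<open>auto simp: fun_eq_iff S1_def bit_symbol_def\<close>)
  qed
  have 2: "bsle write_output S1 (14 * length v + 1) (S1(1 := [2], 5 := rev (map bit_symbol v) @ S1 5))"
    by (rule bsle_weaken[OF Cons.IH[of S1]]) (auto simp: S1_def fun_upd_def)
  show ?case unfolding write_output_def
    by (rule bsle_weaken[OF bsle_LoopT[OF bsle_Seq[OF p br] 2[unfolded write_output_def]]])
      (use Cons.prems in \<open>auto simp: S1_def fun_eq_iff\<close>)
qed

lemma wf_io [simp]: "wf_com read_input" "wf_com write_output"
  by (auto simp: read_input_def write_output_def)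

lemma polyb_poly: "polyb b \<Longrightarrow> \<exists>p :: nat poly. \<forall>n. b n \<le> poly p n"
  unfolding polyb_def
  by (metis poly_power poly_pCons poly_0 mult_zero_right add_0_right mult.right_neutral add.commute
      mult_1_right mult_1)

lemma bsle_compile:
  assumes "bsle c S t S'" "wf_com c0" "wf_com c" "conts c \<kappa> \<subseteq> cstates c0" "rep n S T"
  shows "\<exists>t' T'. t' \<le> t \<and> (tm_step (compile c0) ^^ t') (cnum c0 (c # \<kappa>), T) = (cnum c0 \<kappa>, T') \<and>
    rep n S' T'"
  using assms bs_compile unfolding bsle_def by (meson le_trans)

theorem polytime_computable_PT:
  assumes "PT g"
  shows "polytime_computable g"
proof -
  obtain c k where c: "wf_com c" "\<And>x r S. clean S \<Longrightarrow> S 1 = code (tr x) @ r \<Longrightarrow>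
      bsle c S ((sz x + 2) ^ k) (S(1 := code (tr (g x)) @ r))"
    "\<And>x. sz (g x) \<le> sz x + (sz x + 2) ^ k"
    using assms by (rule PTE) blast
  define m where "m = Seq read_input (Seq c write_output)"
  define c0 where "c0 = Seq m Accept"
  let ?M = "compile c0"
  define N where "N n = 4 * n + 1" for n :: nat
  define b where "b n = 26 * n + ((N n + 2) ^ k + 14 * (N n + (N n + 2) ^ k)) + 20" for n
  have "polyb b" unfolding b_def N_def by (intro polyb_intros)
  then obtain p :: "nat poly" where p: "\<And>n. b n \<le> poly p n" using polyb_poly by blast
  have wf: "wf_com c0" using c(1) by (simp add: c0_def m_def)
  have "\<exists>t \<le> poly p (length w). halted ?M (tm_run ?M w t) \<and> output_is (tm_run ?M w t) (g w)" for w
  proof -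
    let ?S1 = "(\<lambda>_. [])(1 := code (tr w)) :: store" and ?S2 = "(\<lambda>_. [])(1 := code (tr (g w))) :: store"
    let ?S3 = "?S2(1 := [2], 5 := rev (map bit_symbol (g w)))"
    have 2: "bsle c ?S1 ((sz w + 2) ^ k) ?S2"
      using c(2)[of ?S1 w "[]"] by (simp add: clean_def)
    have 3: "bsle write_output ?S2 (14 * length (g w) + 1) ?S3"
      using write_output[of ?S2 "g w"] by simp
    have szw: "sz w \<le> N (length w)" using sz_bools[of w] by (simp add: N_def)
    then have pw: "(sz w + 2) ^ k \<le> (N (length w) + 2) ^ k" by (intro power_mono) auto
    have "length (g w) \<le> N (length w) + (N (length w) + 2) ^ k"
      using length_le_sz[of "g w"] c(3)[of w] szw pw by linarith
    then have m: "bsle m (initial_store w) (b (length w) - 1) ?S3"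
      unfolding m_def by (intro bsle_weaken[OF bsle_Seq[OF read_input bsle_Seq[OF 2 3]]])
        (use pw in \<open>auto simp: b_def\<close>)
    let ?T0 = "snd (initial_config ?M w)"
    have sub: "conts m [Accept] \<subseteq> cstates c0" by (auto simp: cstates_def c0_def)
    obtain t T where t: "t \<le> b (length w) - 1"
        "(tm_step ?M ^^ t) (cnum c0 [m, Accept], ?T0) = (cnum c0 [Accept], T)" "rep (length w) ?S3 T"
      using bsle_compile[OF m wf _ sub rep_initial[of w c0]] wf unfolding c0_def by force
    have "tm_step ?M (cnum c0 [c0], ?T0) = (cnum c0 [m, Accept], ?T0)"
      using rep_initial[of w c0] by (subst step_compile[OF wf]) (auto simp: rep_def c0_def)
    moreover have "initial_config ?M w = (cnum c0 [c0], ?T0)"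
      by (simp add: initial_config_def compile_def)
    ultimately have run: "tm_run ?M w (t + 1) = (cnum c0 [Accept], T)"
      unfolding tm_run_def funpow_add using t(2) by simp
    have "output_is (tm_run ?M w (t + 1)) (g w)"
    proof -
      have T: "length T = 6" "out_rep (rev (map bit_symbol (g w))) (T ! 5)"
        using t(3) by (auto simp: rep_def)
      then have "T \<noteq> []" by auto
      then have "last T = T ! 5" using T(1) by (simp add: last_conv_nth)
      then show ?thesis using T(2) unfolding run output_is_def
        by (cases "T ! 5") auto
    qed
    moreover have "halted ?M (tm_run ?M w (t + 1))" unfolding run by (simp add: halted_compile)
    moreover have "t + 1 \<le> poly p (length w)"
      using t(1) p[of "length w"] by (simp add: b_def)
    ultimately show ?thesis by blast
  qed
  then show ?thesis unfolding polytime_computable_def using turing_machine_compile[OF wf] by blast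
qed

text \<open>Head bound and verdict in a form that propagates backwards along a run. No time bound
  occurs, so the run may be exponentially long.\<close>

definition settles :: "tm \<Rightarrow> nat \<Rightarrow> bool \<Rightarrow> tm_config \<Rightarrow> bool" where
  "settles M B a c \<longleftrightarrow> (\<forall>t. heads_le B (snd ((tm_step M ^^ t) c))) \<and>
     (\<exists>t. halted M ((tm_step M ^^ t) c) \<and> (fst ((tm_step M ^^ t) c) = accept_state M \<longleftrightarrow> a))"

lemma settles_back:
  assumes "settles M B a c'" "(tm_step M ^^ n) c = c'" "heads_le H (snd c)" "H + n \<le> B"
  shows "settles M B a c"
proof -
  have "heads_le B (snd ((tm_step M ^^ t) c))" for t
  proof (cases "t < n")
    case True
    then show ?thesis using heads_le_steps[OF assms(3), of t M] assms(4) heads_le_mono by fastforce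
  next
    case False
    then have "(tm_step M ^^ t) c = (tm_step M ^^ (t - n)) c'"
      using assms(2) funpow_add[of "t - n" n "tm_step M"] by simp
    then show ?thesis using assms(1) by (simp add: settles_def)
  qed
  moreover obtain t where "halted M ((tm_step M ^^ t) c')"
      "fst ((tm_step M ^^ t) c') = accept_state M \<longleftrightarrow> a"
    using assms(1) by (auto simp: settles_def)
  then have "halted M ((tm_step M ^^ (t + n)) c) \<and>
      (fst ((tm_step M ^^ (t + n)) c) = accept_state M \<longleftrightarrow> a)"
    using assms(2) by (simp add: funpow_add)
  ultimately show ?thesis unfolding settles_def by blast
qed

lemma settles_halted:
  assumes "halted M c" "fst c = accept_state M \<longleftrightarrow> a" "heads_le B (snd c)"
  shows "settles M B a c"
proof -
  have "(tm_step M ^^ t) c = c" for t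
    by (induction t) (use assms(1) in \<open>auto simp: tm_step_def\<close>)
  then show ?thesis unfolding settles_def using assms by simp
qed

text \<open>Nothing bounds the number of rounds: the \<open>n\<close> in the last assumption may be
  exponential. Each round starts from a store of polynomial size and takes polynomially many steps,
  and heads move by at most one cell per step, so the space remains polynomial.\<close>

theorem PSPACE_iterate:
  fixes init :: "bool list \<Rightarrow> 's::encodable" and step :: "'s \<Rightarrow> 's" and run acc :: "'s \<Rightarrow> bool"
  assumes init: "PT init" and step: "PT step" and run: "PT run" and acc: "PT acc"
    and b: "polyb b" and size: "\<And>w i. sz ((step ^^ i) (init w)) \<le> b (length w)"
    and stop: "\<And>w. \<exists>n. (\<forall>i<n. run ((step ^^ i) (init w))) \<and> \<not> run ((step ^^ n) (init w)) \<and>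
      (acc ((step ^^ n) (init w)) \<longleftrightarrow> w \<in> L)"
  shows "L \<in> PSPACE"
proof -
  obtain ci ki where ci: "wf_com ci" "\<And>x r S. clean S \<Longrightarrow> S 1 = code (tr x) @ r \<Longrightarrow>
      bsle ci S ((sz x + 2) ^ ki) (S(1 := code (tr (init x)) @ r))"
    using init by (rule PTE) blast
  obtain cs ks where cs: "wf_com cs" "\<And>x r S. clean S \<Longrightarrow> S 1 = code (tr x) @ r \<Longrightarrow>
      bsle cs S ((sz x + 2) ^ ks) (S(1 := code (tr (step x)) @ r))"
    using step by (rule PTE) blast
  obtain cr kr where cr: "wf_com cr" "\<And>x r S. clean S \<Longrightarrow> S 1 = code (tr x) @ r \<Longrightarrow>
      bsle cr S ((sz x + 2) ^ kr) (S(1 := code (tr (run x)) @ r))"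
    using run by (rule PTE) blast
  obtain ca ka where ca: "wf_com ca" "\<And>x r S. clean S \<Longrightarrow> S 1 = code (tr x) @ r \<Longrightarrow>
      bsle ca S ((sz x + 2) ^ ka) (S(1 := code (tr (acc x)) @ r))"
    using acc by (rule PTE) blast
  define test where "test = Seq dup_tree cr"
  define pre where "pre = Seq read_input (Seq ci test)"
  define body where "body = Seq drop_tree (Seq cs test)"
  define lp where "lp = Loop 1 {1} body"
  define fin where "fin = Seq drop_tree ca"
  define cd where "cd = Cond 1 {1} Accept Reject"
  define r2 where "r2 = Seq fin cd"
  define r1 where "r1 = Seq lp r2"
  define c0 where "c0 = Seq pre r1"
  let ?M = "compile c0"
  have wf: "wf_com c0" "wf_com pre" "wf_com body" "wf_com fin"
    using ci cs cr ca
    by (auto simp: c0_def pre_def r1_def r2_def cd_def fin_def lp_def body_def test_def)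
  have sub: "conts c0 [] \<subseteq> cstates c0" "conts pre [r1] \<subseteq> cstates c0" "conts r1 [] \<subseteq> cstates c0"
    "conts lp [r2] \<subseteq> cstates c0" "conts body [lp, r2] \<subseteq> cstates c0" "conts r2 [] \<subseteq> cstates c0"
    "conts fin [cd] \<subseteq> cstates c0" "conts cd [] \<subseteq> cstates c0"
    unfolding cstates_def c0_def r1_def r2_def lp_def by auto
  have mem: "[c0] \<in> cstates c0" "[pre, r1] \<in> cstates c0" "[r1] \<in> cstates c0" "[lp, r2] \<in> cstates c0"
    "[body, lp, r2] \<in> cstates c0" "[r2] \<in> cstates c0" "[fin, cd] \<in> cstates c0" "[cd] \<in> cstates c0"
    using sub conts_self[of c0 "[]"] conts_self[of pre "[r1]"] conts_self[of r1 "[]"]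
      conts_self[of lp "[r2]"] conts_self[of body "[lp, r2]"] conts_self[of r2 "[]"]
      conts_self[of fin "[cd]"] conts_self[of cd "[]"] by auto
  define st :: "'s \<Rightarrow> store" where "st x = (\<lambda>_. [])(1 := code (tr (run x)) @ code (tr x))" for x
  define N where "N n = b n + 4 * n + 1" for n
  define T where "T n = Suc (30 * N n + 10 + (N n + 2) ^ kr)" for n
  define Q where "Q n = 26 * n + (N n + 2) ^ ki + (N n + 2) ^ ks + (N n + 2) ^ ka + T n + 100" for n
  \<comment> \<open>At the beginning of a round the heads are at most at position
    \<open>3 + N n + n\<close>, accounting for the test result, the state and the input. Until the
    next such moment at most \<open>Q n\<close> steps are taken.\<close>
  define B where "B n = 3 + N n + n + Q n" for n
  have "polyb B" unfolding B_def Q_def T_def N_def by (intro polyb_intros b)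
  then have "polyb (\<lambda>n. B n + 1)" by (intro polyb_intros)
  then obtain p :: "nat poly" where p: "\<And>n. B n + 1 \<le> poly p n" using polyb_poly by blast
  have set: "settles ?M (B (length w)) (w \<in> L) (initial_config ?M w)" for w
  proof -
    let ?n = "length w" and ?x = "\<lambda>i. (step ^^ i) (init w)"
    have szx: "sz (?x i) \<le> N ?n" for i using size[of i w] by (simp add: N_def)
    have pwx: "(sz (?x i) + 2) ^ k \<le> (N ?n + 2) ^ k" for i k
      by (intro power_mono add_mono szx) auto
    have szw: "sz w \<le> N ?n" using sz_bools[of w] by (simp add: N_def)
    then have pww: "(sz w + 2) ^ k \<le> (N ?n + 2) ^ k" for k by (intro power_mono) auto
    have test: "bsle test ((\<lambda>_. [])(1 := code (tr (?x i)))) (T ?n) (st (?x i))" for i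
    proof -
      let ?X = "code (tr (?x i))" and ?S = "(\<lambda>_. [])(1 := code (tr (?x i))) :: store"
      have 1: "bsle dup_tree ?S (30 * sz (?x i) + 10) (?S(1 := ?X @ ?X))"
        using dup_tree[of ?S "tr (?x i)" "[]"] by (simp add: clean_def)
      have 2: "bsle cr (?S(1 := ?X @ ?X)) ((sz (?x i) + 2) ^ kr) (st (?x i))"
        using cr(2)[of "?S(1 := ?X @ ?X)" "?x i" ?X] by (simp add: clean_def st_def)
      show ?thesis unfolding test_def
        by (rule bsle_weaken[OF bsle_Seq[OF 1 2]]) (use szx[of i] pwx[of i kr] in \<open>auto simp: T_def\<close>)
    qed
    have drop: "bsle drop_tree (st (?x i)) 40 ((\<lambda>_. [])(1 := code (tr (?x i))))" for i
      by (rule bsle_weaken[OF drop_tree[of _ "tr (run (?x i))" "code (tr (?x i))"]])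
        (cases "run (?x i)"; auto simp: clean_def st_def)+
    have body: "bsle body (st (?x i)) (Q ?n - 1) (st (?x (Suc i)))" for i
    proof -
      have 2: "bsle cs ((\<lambda>_. [])(1 := code (tr (?x i)))) ((sz (?x i) + 2) ^ ks)
          ((\<lambda>_. [])(1 := code (tr (?x (Suc i)))))"
        using cs(2)[of "(\<lambda>_. [])(1 := code (tr (?x i)))" "?x i" "[]"] by (simp add: clean_def)
      show ?thesis unfolding body_def
        by (rule bsle_weaken[OF bsle_Seq[OF drop bsle_Seq[OF 2 test]]])
          (use pwx[of i ks] in \<open>auto simp: Q_def\<close>)
    qed
    have pre: "bsle pre (initial_store w) (Q ?n - 2) (st (?x 0))"
    proof -
      have 2: "bsle ci ((\<lambda>_. [])(1 := code (tr w))) ((sz w + 2) ^ ki)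
          ((\<lambda>_. [])(1 := code (tr (?x 0))))"
        using ci(2)[of "(\<lambda>_. [])(1 := code (tr w))" w "[]"] by (simp add: clean_def)
      show ?thesis unfolding pre_def
        by (rule bsle_weaken[OF bsle_Seq[OF read_input bsle_Seq[OF 2 test]]])
          (use pww[of ki] in \<open>auto simp: Q_def\<close>)
    qed
    have fin: "bsle fin (st (?x i)) (Q ?n - 3) ((\<lambda>_. [])(1 := code (tr (acc (?x i)))))" for i
    proof -
      have 2: "bsle ca ((\<lambda>_. [])(1 := code (tr (?x i)))) ((sz (?x i) + 2) ^ ka)
          ((\<lambda>_. [])(1 := code (tr (acc (?x i)))))"
        using ca(2)[of "(\<lambda>_. [])(1 := code (tr (?x i)))" "?x i" "[]"] by (simp add: clean_def)
      show ?thesis unfolding fin_def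
        by (rule bsle_weaken[OF bsle_Seq[OF drop 2]]) (use pwx[of i ka] in \<open>auto simp: Q_def\<close>)
    qed
    have hd: "heads_le (3 + N ?n + ?n) Tp" if "rep ?n (st (?x i)) Tp" for i Tp
      using that szx[of i] sz_bool[of "run (?x i)"] by (intro rep_heads) (auto simp: st_def)
    obtain m where m: "\<And>i. i < m \<Longrightarrow> run (?x i)" "\<not> run (?x m)" "acc (?x m) \<longleftrightarrow> w \<in> L"
      using stop[of w] by blast
    have last: "settles ?M (B ?n) (w \<in> L) (cnum c0 [lp, r2], Tp)" if rp: "rep ?n (st (?x m)) Tp" for Tp
    proof -
      have len: "length Tp = 6" using rp by (simp add: rep_def)
      have 1: "tm_step ?M (cnum c0 [lp, r2], Tp) = (cnum c0 [r2], Tp)"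
        using mem m(2) rep_top[OF rp, of 1] len
        by (subst step_compile[OF wf(1)]) (auto simp: lp_def st_def)
      have 2: "tm_step ?M (cnum c0 [r2], Tp) = (cnum c0 [fin, cd], Tp)"
        using mem len by (subst step_compile[OF wf(1)]) (auto simp: r2_def)
      obtain t' T' where 3: "t' \<le> Q ?n - 3" "(tm_step ?M ^^ t') (cnum c0 [fin, cd], Tp) = (cnum c0 [cd], T')"
          "rep ?n ((\<lambda>_. [])(1 := code (tr (acc (?x m))))) T'"
        using bsle_compile[OF fin wf(1,4) sub(7) rp] by blast
      let ?e = "if acc (?x m) then [Accept] else [Reject]"
      have 4: "tm_step ?M (cnum c0 [cd], T') = (cnum c0 ?e, T')"
        using mem rep_top[OF 3(3), of 1] 3(3)
        by (subst step_compile[OF wf(1)]) (auto simp: cd_def rep_def)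
      have steps: "(tm_step ?M ^^ (1 + t' + 2)) (cnum c0 [lp, r2], Tp) = (cnum c0 ?e, T')"
        unfolding funpow_add using 1 2 3(2) 4 by (simp add: numeral_2_eq_2)
      have "settles ?M (B ?n) (w \<in> L) (cnum c0 ?e, T')"
      proof (rule settles_halted)
        show "halted ?M (cnum c0 ?e, T')" by (simp add: halted_compile)
        have "accept_state ?M = cnum c0 [Accept]" by (simp add: compile_def)
        then show "fst (cnum c0 ?e, T') = accept_state ?M \<longleftrightarrow> w \<in> L"
          using m(3) by (auto simp: cnum_inj)
        have "heads_le (3 + ?n) T'"
          using 3(3) sz_bool[of "acc (?x m)"] by (intro rep_heads[OF 3(3)]) auto
        then show "heads_le (B ?n) (snd (cnum c0 ?e, T'))"
          by (auto simp: B_def elim: heads_le_mono)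
      qed
      from settles_back[OF this steps] show ?thesis
        using hd[OF rp] 3(1) by (simp add: B_def Q_def)
    qed
    \<comment> \<open>Induction on the number \<open>j\<close> of rounds still to come, as
      \<open>settles\<close> is inherited from later to earlier configurations.\<close>
    have loop: "settles ?M (B ?n) (w \<in> L) (cnum c0 [lp, r2], Tp)"
      if "rep ?n (st (?x (m - j))) Tp" "j \<le> m" for j Tp
      using that
    proof (induction j arbitrary: Tp)
      case 0
      then show ?case using last by simp
    next
      case (Suc j)
      let ?i = "m - Suc j"
      have i: "?i < m" "Suc ?i = m - j" using Suc.prems by auto
      have 1: "tm_step ?M (cnum c0 [lp, r2], Tp) = (cnum c0 [body, lp, r2], Tp)"
        using mem m(1)[OF i(1)] rep_top[OF Suc.prems(1), of 1] Suc.prems(1)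
        by (subst step_compile[OF wf(1)]) (auto simp: lp_def st_def rep_def)
      obtain t' T' where 2: "t' \<le> Q ?n - 1"
          "(tm_step ?M ^^ t') (cnum c0 [body, lp, r2], Tp) = (cnum c0 [lp, r2], T')"
          "rep ?n (st (?x (m - j))) T'"
        using bsle_compile[OF body wf(1,3) sub(5) Suc.prems(1)] unfolding i(2) by blast
      have steps: "(tm_step ?M ^^ (t' + 1)) (cnum c0 [lp, r2], Tp) = (cnum c0 [lp, r2], T')"
        unfolding funpow_add using 1 2(2) by simp
      have "settles ?M (B ?n) (w \<in> L) (cnum c0 [lp, r2], T')"
        using Suc.IH[OF 2(3)] Suc.prems(2) by simp
      from settles_back[OF this steps] show ?case
        using hd[OF Suc.prems(1)] 2(1) by (simp add: B_def Q_def)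
    qed
    let ?T0 = "snd (initial_config ?M w)"
    have rp: "rep ?n (initial_store w) ?T0" by (rule rep_initial)
    have ic: "initial_config ?M w = (cnum c0 [c0], ?T0)"
      by (simp add: initial_config_def compile_def)
    have 1: "tm_step ?M (cnum c0 [c0], ?T0) = (cnum c0 [pre, r1], ?T0)"
      using mem rp by (subst step_compile[OF wf(1)]) (auto simp: c0_def rep_def)
    obtain t' T' where 2: "t' \<le> Q ?n - 2"
        "(tm_step ?M ^^ t') (cnum c0 [pre, r1], ?T0) = (cnum c0 [r1], T')" "rep ?n (st (?x 0)) T'"
      using bsle_compile[OF pre wf(1,2) sub(2) rp] by blast
    have 3: "tm_step ?M (cnum c0 [r1], T') = (cnum c0 [lp, r2], T')"
      using mem 2(3) by (subst step_compile[OF wf(1)]) (auto simp: r1_def rep_def)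
    have "(tm_step ?M ^^ (1 + t' + 1)) (initial_config ?M w) = (cnum c0 [lp, r2], T')"
      unfolding funpow_add using 1 2(2) 3 ic by simp
    moreover have "settles ?M (B ?n) (w \<in> L) (cnum c0 [lp, r2], T')"
      using loop[of m T'] 2(3) by simp
    moreover have "0 + (1 + t' + 1) \<le> B ?n" using 2(1) by (simp add: B_def Q_def)
    ultimately show ?thesis using settles_back heads_initial by blast
  qed
  have "decides ?M L" unfolding decides_def tm_run_def using set unfolding settles_def by blast
  moreover have "runs_in_space ?M (poly p)"
    unfolding runs_in_space_def tm_run_def
  proof (intro allI ballI)
    fix w t x
    assume "x \<in> set (snd ((tm_step ?M ^^ t) (initial_config ?M w)))"
    moreover have "heads_le (B (length w)) (snd ((tm_step ?M ^^ t) (initial_config ?M w)))"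
      using set[of w] by (simp add: settles_def)
    ultimately have "snd x \<le> B (length w)" by (cases x) (auto simp: heads_le_def)
    then show "case x of (f, i) \<Rightarrow> i < poly p (length w)" using p[of "length w"] by (cases x) auto
  qed
  ultimately show ?thesis unfolding PSPACE_def using turing_machine_compile[OF wf(1)] by blast
qed

section \<open>Infinite paths in graphs on subsets\<close>

text \<open>Savitch's algorithm: \<open>reach N E k u v\<close> says that \<open>v\<close> is reached from \<open>u\<close> in exactly
  \<open>2 ^ k\<close> steps.\<close>

fun reach :: "'n set \<Rightarrow> ('n \<Rightarrow> 'n \<Rightarrow> bool) \<Rightarrow> nat \<Rightarrow> 'n \<Rightarrow> 'n \<Rightarrow> bool" where
  "reach N E 0 u v \<longleftrightarrow> E u v"
| "reach N E (Suc k) u v \<longleftrightarrow> (\<exists>m\<in>N. reach N E k u m \<and> reach N E k m v)"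

text \<open>Only the inner points of the walk must lie in \<open>N\<close>. The end points are free,
  which later lets the empty node, although not counted among the nodes, be both source and
  sink.\<close>

lemma reach_walk:
  "reach N E k u v \<longleftrightarrow> (\<exists>\<sigma>. \<sigma> 0 = u \<and> \<sigma> (2 ^ k) = v \<and> (\<forall>i<2 ^ k. E (\<sigma> i) (\<sigma> (Suc i))) \<and>
     (\<forall>i. 0 < i \<and> i < 2 ^ k \<longrightarrow> \<sigma> i \<in> N))"
proof (induction k arbitrary: u v)
  case 0
  show ?case
  proof
    assume "reach N E 0 u v"
    then show "\<exists>\<sigma>. \<sigma> 0 = u \<and> \<sigma> (2 ^ 0) = v \<and> (\<forall>i<2 ^ 0. E (\<sigma> i) (\<sigma> (Suc i))) \<and>
        (\<forall>i. 0 < i \<and> i < 2 ^ 0 \<longrightarrow> \<sigma> i \<in> N)"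
      by (intro exI[of _ "\<lambda>i. if i = 0 then u else v"]) auto
  qed auto
next
  case (Suc k)
  show ?case
  proof
    assume "reach N E (Suc k) u v"
    then obtain m where m: "m \<in> N" "reach N E k u m" "reach N E k m v" by auto
    obtain \<sigma> where s: "\<sigma> 0 = u" "\<sigma> (2 ^ k) = m" "\<forall>i<2 ^ k. E (\<sigma> i) (\<sigma> (Suc i))"
        "\<forall>i. 0 < i \<and> i < 2 ^ k \<longrightarrow> \<sigma> i \<in> N"
      using m(2) Suc.IH by blast
    obtain \<tau> where t: "\<tau> 0 = m" "\<tau> (2 ^ k) = v" "\<forall>i<2 ^ k. E (\<tau> i) (\<tau> (Suc i))"
        "\<forall>i. 0 < i \<and> i < 2 ^ k \<longrightarrow> \<tau> i \<in> N"
      using m(3) Suc.IH by blast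
    define \<rho> where "\<rho> i = (if i \<le> 2 ^ k then \<sigma> i else \<tau> (i - 2 ^ k))" for i
    have "E (\<rho> i) (\<rho> (Suc i))" if "i < 2 ^ Suc k" for i
    proof -
      consider "i < 2 ^ k" | "i = 2 ^ k" | "i > 2 ^ k" by linarith
      then show ?thesis
      proof cases
        case 2
        then show ?thesis using s(2) t(1) t(3)[rule_format, of 0] by (simp add: \<rho>_def)
      next
        case 3
        then show ?thesis using t(3)[rule_format, of "i - 2 ^ k"] that by (simp add: \<rho>_def Suc_diff_le)
      qed (use s in \<open>auto simp: \<rho>_def\<close>)
    qed
    moreover have "\<rho> i \<in> N" if "0 < i" "i < 2 ^ Suc k" for i
    proof -
      consider "i < 2 ^ k" | "i = 2 ^ k" | "i > 2 ^ k" by linarith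
      then show ?thesis
        using s(2,4) t(4)[rule_format, of "i - 2 ^ k"] m(1) that by cases (auto simp: \<rho>_def)
    qed
    moreover have "\<rho> 0 = u" "\<rho> (2 ^ Suc k) = v" using s t by (auto simp: \<rho>_def)
    ultimately show "\<exists>\<sigma>. \<sigma> 0 = u \<and> \<sigma> (2 ^ Suc k) = v \<and> (\<forall>i<2 ^ Suc k. E (\<sigma> i) (\<sigma> (Suc i))) \<and>
        (\<forall>i. 0 < i \<and> i < 2 ^ Suc k \<longrightarrow> \<sigma> i \<in> N)" by blast
  next
    assume "\<exists>\<sigma>. \<sigma> 0 = u \<and> \<sigma> (2 ^ Suc k) = v \<and> (\<forall>i<2 ^ Suc k. E (\<sigma> i) (\<sigma> (Suc i))) \<and>
        (\<forall>i. 0 < i \<and> i < 2 ^ Suc k \<longrightarrow> \<sigma> i \<in> N)"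
    then obtain \<sigma> where s: "\<sigma> 0 = u" "\<sigma> (2 ^ Suc k) = v" "\<And>i. i < 2 ^ Suc k \<Longrightarrow> E (\<sigma> i) (\<sigma> (Suc i))"
        "\<And>i. 0 < i \<Longrightarrow> i < 2 ^ Suc k \<Longrightarrow> \<sigma> i \<in> N" by blast
    have "reach N E k u (\<sigma> (2 ^ k))"
      unfolding Suc.IH using s by (intro exI[of _ \<sigma>]) auto
    moreover have "reach N E k (\<sigma> (2 ^ k)) v"
      unfolding Suc.IH using s by (intro exI[of _ "\<lambda>i. \<sigma> (i + 2 ^ k)"]) (auto simp: mult_2)
    moreover have "\<sigma> (2 ^ k) \<in> N" by (rule s(4)) auto
    ultimately show "reach N E (Suc k) u v" by auto
  qed
qed

text \<open>A subset of \<open>us\<close> is given by attaching a bit to each entry; the bit vectors are enumerated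
  as binary numbers with the least significant bit first.\<close>

fun bval :: "(bool \<times> 'u) list \<Rightarrow> nat" where
  "bval [] = 0"
| "bval (x # m) = (if fst x then 1 else 0) + 2 * bval m"

fun inc :: "(bool \<times> 'u) list \<Rightarrow> (bool \<times> 'u) list" where
  "inc [] = []"
| "inc (x # m) = (if fst x then (False, snd x) # inc m else (True, snd x) # m)"

lemma map_snd_inc [simp]: "map snd (inc m) = map snd m"
  by (induction m) auto

lemma bval_inc: "\<exists>x\<in>set m. \<not> fst x \<Longrightarrow> bval (inc m) = Suc (bval m)"
  by (induction m) auto

lemma bval_less: "bval m < 2 ^ length m"
  by (induction m) auto

lemma bval_all: "\<forall>x\<in>set m. fst x \<Longrightarrow> Suc (bval m) = 2 ^ length m"
  by (induction m) auto

lemma bval_inj: "map snd m = map snd m' \<Longrightarrow> bval m = bval m' \<Longrightarrow> m = m'"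
proof (induction m arbitrary: m')
  case (Cons x m)
  then obtain y n where y: "m' = y # n" by (cases m') auto
  have "fst x = fst y"
  proof (rule ccontr)
    assume "fst x \<noteq> fst y"
    then show False using Cons.prems(2) y by (auto split: if_splits) presburger+
  qed
  then show ?case using Cons y by (auto simp: prod_eq_iff split: if_splits)
qed simp

lemma bval_zero: "bval (map (Pair False) us) = 0"
  by (induction us) auto

definition picked :: "(bool \<times> 'u) list \<Rightarrow> 'u list" where
  "picked m = map snd (filter fst m)"

text \<open>Binary increment as a fold: the first component is the carry, the second the reversed
  list of digits already treated.\<close>

definition inc_fold :: "bool \<times> (bool \<times> 'u) list \<Rightarrow> bool \<times> 'u \<Rightarrow> bool \<times> (bool \<times> 'u) list" where
  "inc_fold a x = (fst a \<and> fst x, (fst a \<noteq> fst x, snd x) # snd a)"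

lemma inc_fold: "snd (foldl inc_fold a m) = rev (if fst a then inc m else m) @ snd a"
  by (induction m arbitrary: a) (auto simp: inc_fold_def prod_eq_iff)

lemma sz_pair_bound: "sz (x :: bool \<times> 'u::encodable) \<le> 4 + sz (snd x)"
  using sz_bool[of "fst x"] by (simp add: tr_prod_def)

lemma sz_node:
  assumes "\<And>x. x \<in> snd ` set m \<Longrightarrow> sz x \<le> B"
  shows "sz (m :: (bool \<times> 'u::encodable) list) \<le> length m * (5 + B) + 1"
proof -
  have "sz x \<le> 4 + B" if "x \<in> set m" for x
    using sz_pair_bound[of x] assms[of "snd x"] that by (meson add_left_mono imageI le_trans)
  from sz_list_bound[of m, OF this] show ?thesis by simp
qed

lemma PT_inc: "PT f \<Longrightarrow> PT (\<lambda>x. inc (f x :: (bool \<times> 'u::encodable) list))"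
proof (rule PT_comp[of inc])
  have "PT (\<lambda>m :: (bool \<times> 'u) list. foldl inc_fold (True, []) m)"
  proof (rule PT_foldl[OF PT_const PT_id])
    show "PT (\<lambda>z :: (bool \<times> 'u) list \<times> (bool \<times> (bool \<times> 'u) list) \<times> bool \<times> 'u.
        inc_fold (fst (snd z)) (snd (snd z)))"
      unfolding inc_fold_def by (intro PT_intros)
    show "polyb (\<lambda>n. 4 + (n * (5 + n) + 1))" by (intro polyb_intros)
    fix m :: "(bool \<times> 'u) list" and i
    let ?r = "foldl inc_fold (True, []) (take i m)"
    have r: "snd ?r = rev (inc (take i m))" by (simp add: inc_fold)
    have "snd ` set (inc n) = set (map snd n)" for n :: "(bool \<times> 'u) list"
      by (metis list.set_map map_snd_inc)
    then have "sz (snd ?r) \<le> length (snd ?r) * (5 + sz m) + 1"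
    proof (intro sz_node)
      fix x assume "x \<in> snd ` set (snd ?r)"
      then obtain y where y: "y \<in> set m" "x = snd y"
        using r \<open>\<And>n. snd ` set (inc n) = set (map snd n)\<close> by (auto dest: in_set_takeD)
      have "sz x \<le> sz y" by (simp add: y(2) tr_prod_def)
      then show "sz x \<le> sz m" using sz_elem[OF y(1)] by linarith
    qed
    also have "length (inc n) = length n" for n :: "(bool \<times> 'u) list"
      by (metis length_map map_snd_inc)
    then have "length (snd ?r) \<le> sz m" using length_le_sz[of m] by (simp add: r)
    then have "length (snd ?r) * (5 + sz m) + 1 \<le> sz m * (5 + sz m) + 1" by simp
    finally show "sz ?r \<le> 4 + (sz m * (5 + sz m) + 1)"
      using sz_bool[of "fst ?r"] by (simp add: tr_prod_def[of ?r])
  qed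
  from PT_rev[OF PT_snd[OF this]] show "PT (inc :: (bool \<times> 'u) list \<Rightarrow> _)" by (simp add: inc_fold)
qed

lemma PT_picked: "PT f \<Longrightarrow> PT (\<lambda>x. picked (f x :: (bool \<times> 'u::encodable) list))"
  unfolding picked_def by (intro PT_intros)

text \<open>The recursion of \<open>reach\<close> is evaluated with an explicit stack. A state consists of the
  environment, the current level, a flag that distinguishes returns from calls, the returned
  value, the end points of a call, and frames \<open>(u, v, m, second)\<close>. The empty node stands for a
  source above all start nodes and for a sink below all nodes.\<close>

type_synonym 'u node = "(bool \<times> 'u) list"

type_synonym ('e, 'u) search =
  "'e \<times> nat \<times> bool \<times> bool \<times> 'u node \<times> 'u node \<times> ('u node \<times> 'u node \<times> 'u node \<times> bool) list"

locale subset_graph =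
  fixes Us :: "'e::encodable \<Rightarrow> 'u::encodable list"
    and start :: "'e \<Rightarrow> 'u list \<Rightarrow> bool"
    and edge :: "'e \<Rightarrow> 'u list \<Rightarrow> 'u list \<Rightarrow> bool"
begin

definition E :: "'e \<Rightarrow> 'u node \<Rightarrow> 'u node \<Rightarrow> bool" where
  "E e u v = (if u = [] then v \<noteq> [] \<and> start e (picked v)
     else if v = [] then True else edge e (picked u) (picked v))"

definition N :: "'e \<Rightarrow> 'u node set" where
  "N e = {m. map snd m = Us e}"

text \<open>A frame records whether the second half of the path is under examination. A negative
  answer for either half proceeds to the next midpoint, and the midpoint with all bits set is the
  last. Having returned with no frames left, the search stays put, so surplus steps are
  harmless.\<close>

definition step :: "('e, 'u) search \<Rightarrow> ('e, 'u) search" where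
  "step = (\<lambda>(e, k, ret, b, u, v, fr).
     if \<not> ret then
       (if k = 0 then (e, k, True, E e u v, u, v, fr)
        else (e, k - Suc 0, False, b, u, map (Pair False) (Us e), (u, v, map (Pair False) (Us e), False) # fr))
     else (case fr of [] \<Rightarrow> (e, k, ret, b, u, v, fr)
       | f # fr' \<Rightarrow>
         if b then
           (if snd (snd (snd f)) then (e, Suc k, True, True, u, v, fr')
            else (e, k, False, b, fst (snd (snd f)), fst (snd f), (fst f, fst (snd f), fst (snd (snd f)), True) # fr'))
         else if \<forall>x\<in>set (fst (snd (snd f))). fst x then (e, Suc k, True, False, u, v, fr')
         else (e, k, False, b, fst f, inc (fst (snd (snd f))),
           (fst f, fst (snd f), inc (fst (snd (snd f))), False) # fr')))"

text \<open>Induction on the number of midpoints from \<open>m\<close> upwards; the value returned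
  is the existence of a suitable midpoint among these. \<open>cont\<close> treats the failure of
  either half uniformly, because both continue in the same way.\<close>

lemma step_search:
  assumes IH: "\<And>b u v fr. \<exists>n u' v'. (step ^^ n) (e, k, False, b, u, v, fr) =
      (e, k, True, reach (N e) (E e) k u v, u', v', fr)"
    and "m \<in> N e"
  shows "\<exists>n u' v'. (step ^^ n) (e, k, False, b, u, m, (u, v, m, False) # fr) =
    (e, Suc k, True, \<exists>m'\<in>N e. bval m \<le> bval m' \<and> reach (N e) (E e) k u m' \<and> reach (N e) (E e) k m' v,
      u', v', fr)"
  using assms(2)
proof (induction "2 ^ length (Us e) - bval m" arbitrary: m b rule: less_induct)
  case less
  let ?R = "reach (N e) (E e) k"
  let ?c = "\<lambda>b m. (e, k, False, b, u, m, (u, v, m, False) # fr)"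
  let ?all = "\<forall>x\<in>set m. fst x"
  have len: "length m = length (Us e)" using less.prems by (metis (mono_tags) N_def length_map mem_Collect_eq)
  obtain n u1 v1 where 1: "(step ^^ n) (?c b m) = (e, k, True, ?R u m, u1, v1, (u, v, m, False) # fr)"
    using IH by blast
  have cont: "\<exists>n u' v'. (step ^^ n) (e, k, True, False, u2, v2, (u, v, m, ph) # fr) =
      (e, Suc k, True, \<exists>m'\<in>N e. bval m \<le> bval m' \<and> ?R u m' \<and> ?R m' v, u', v', fr)"
    if no: "\<not> (?R u m \<and> ?R m v)" for u2 v2 ph
  proof (cases ?all)
    case True
    have "m' = m" if "m' \<in> N e" "bval m \<le> bval m'" for m'
    proof (rule bval_inj)
      have "length m' = length (Us e)" using that by (metis (mono_tags) N_def length_map mem_Collect_eq)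
      then show "bval m' = bval m" using bval_all[OF True] bval_less[of m'] that(2) len by simp
    qed (use that(1) less.prems in \<open>simp add: N_def\<close>)
    then have "\<not> (\<exists>m'\<in>N e. bval m \<le> bval m' \<and> ?R u m' \<and> ?R m' v)" using no by blast
    moreover have "step (e, k, True, False, u2, v2, (u, v, m, ph) # fr) = (e, Suc k, True, False, u2, v2, fr)"
      using True by (simp add: step_def)
    ultimately show ?thesis by (intro exI[of _ 1] exI[of _ u2] exI[of _ v2]) auto
  next
    case False
    have st: "step (e, k, True, False, u2, v2, (u, v, m, ph) # fr) = ?c False (inc m)"
      using False by (auto simp: step_def)
    have bi: "bval (inc m) = Suc (bval m)" using False by (intro bval_inc) blast
    have im: "inc m \<in> N e" using less.prems by (simp add: N_def)
    have "2 ^ length (Us e) - bval (inc m) < 2 ^ length (Us e) - bval m"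
      using bi bval_less[of m] len by simp
    from less.hyps[OF this im, of False] obtain n u' v' where
      n: "(step ^^ n) (?c False (inc m)) = (e, Suc k, True,
        \<exists>m'\<in>N e. bval (inc m) \<le> bval m' \<and> ?R u m' \<and> ?R m' v, u', v', fr)" by blast
    have "m' = m \<or> Suc (bval m) \<le> bval m'" if "m' \<in> N e" "bval m \<le> bval m'" for m'
      using bval_inj[of m' m] that less.prems by (auto simp: N_def)
    then have "(\<exists>m'\<in>N e. bval m \<le> bval m' \<and> ?R u m' \<and> ?R m' v) \<longleftrightarrow>
        (\<exists>m'\<in>N e. bval (inc m) \<le> bval m' \<and> ?R u m' \<and> ?R m' v)"
      using no unfolding bi by (metis Suc_leD)
    then have "(step ^^ Suc n) (e, k, True, False, u2, v2, (u, v, m, ph) # fr) =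
        (e, Suc k, True, \<exists>m'\<in>N e. bval m \<le> bval m' \<and> ?R u m' \<and> ?R m' v, u', v', fr)"
      unfolding funpow_Suc_right comp_def st using n by simp
    then show ?thesis by blast
  qed
  show ?case
  proof (cases "?R u m")
    case False
    obtain n' u' v' where 2: "(step ^^ n') (e, k, True, False, u1, v1, (u, v, m, False) # fr) =
        (e, Suc k, True, \<exists>m'\<in>N e. bval m \<le> bval m' \<and> ?R u m' \<and> ?R m' v, u', v', fr)"
      using cont[of u1 v1 False] False by blast
    have "(step ^^ (n' + n)) (?c b m) =
        (e, Suc k, True, \<exists>m'\<in>N e. bval m \<le> bval m' \<and> ?R u m' \<and> ?R m' v, u', v', fr)"
      unfolding funpow_add using 1 2 False by simp
    then show ?thesis by blast
  next
    case True
    let ?d = "(e, k, False, True, m, v, (u, v, m, True) # fr)"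
    have st: "step (e, k, True, True, u1, v1, (u, v, m, False) # fr) = ?d" by (simp add: step_def)
    obtain n2 u2 v2 where 2: "(step ^^ n2) ?d = (e, k, True, ?R m v, u2, v2, (u, v, m, True) # fr)"
      using IH by blast
    have 3: "(step ^^ (n2 + (1 + n))) (?c b m) = (e, k, True, ?R m v, u2, v2, (u, v, m, True) # fr)"
      unfolding funpow_add using 1 2 True st by simp
    show ?thesis
    proof (cases "?R m v")
      case True
      have "step (e, k, True, True, u2, v2, (u, v, m, True) # fr) = (e, Suc k, True, True, u2, v2, fr)"
        by (simp add: step_def)
      then have "(step ^^ Suc (n2 + (1 + n))) (?c b m) = (e, Suc k, True, True, u2, v2, fr)"
        using 3 True by simp
      moreover have "(\<exists>m'\<in>N e. bval m \<le> bval m' \<and> ?R u m' \<and> ?R m' v) = True"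
        using True \<open>?R u m\<close> less.prems by blast
      ultimately show ?thesis by (simp only:) blast
    next
      case False
      obtain n' u' v' where 4: "(step ^^ n') (e, k, True, False, u2, v2, (u, v, m, True) # fr) =
          (e, Suc k, True, \<exists>m'\<in>N e. bval m \<le> bval m' \<and> ?R u m' \<and> ?R m' v, u', v', fr)"
        using cont[of u2 v2 True] False by blast
      have "(step ^^ (n' + (n2 + (1 + n)))) (?c b m) =
          (e, Suc k, True, \<exists>m'\<in>N e. bval m \<le> bval m' \<and> ?R u m' \<and> ?R m' v, u', v', fr)"
        unfolding funpow_add[of n'] using 3 4 False by simp
      then show ?thesis by blast
    qed
  qed
qed

lemma step_reach:
  "\<exists>n u' v'. (step ^^ n) (e, k, False, b, u, v, fr) =
    (e, k, True, reach (N e) (E e) k u v, u', v', fr)"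
proof (induction k arbitrary: b u v fr)
  case 0
  have "step (e, 0, False, b, u, v, fr) = (e, 0, True, E e u v, u, v, fr)" by (simp add: step_def)
  then show ?case by (intro exI[of _ 1] exI[of _ u] exI[of _ v]) simp
next
  case (Suc k)
  let ?m = "map (Pair False) (Us e)"
  have m: "?m \<in> N e" by (simp add: N_def comp_def)
  have st: "step (e, Suc k, False, b, u, v, fr) = (e, k, False, b, u, ?m, (u, v, ?m, False) # fr)"
    by (simp add: step_def)
  obtain n u' v' where "(step ^^ n) (e, k, False, b, u, ?m, (u, v, ?m, False) # fr) =
      (e, Suc k, True, \<exists>m'\<in>N e. bval ?m \<le> bval m' \<and> reach (N e) (E e) k u m' \<and>
        reach (N e) (E e) k m' v, u', v', fr)"
    using step_search[OF Suc.IH m] by blast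
  then have "(step ^^ Suc n) (e, Suc k, False, b, u, v, fr) =
      (e, Suc k, True, reach (N e) (E e) (Suc k) u v, u', v', fr)"
    unfolding funpow_Suc_right comp_def st by (simp add: bval_zero)
  then show ?case by blast
qed

definition node_ok :: "'e \<Rightarrow> 'u node \<Rightarrow> bool" where
  "node_ok e m \<longleftrightarrow> m = [] \<or> map snd m = Us e"

text \<open>Level plus stack height is constant: every call descends one level and leaves a frame.
  Together with the size of nodes, this keeps the state polynomial even though the search takes
  exponential time.\<close>

definition search_inv :: "'e \<Rightarrow> nat \<Rightarrow> ('e, 'u) search \<Rightarrow> bool" where
  "search_inv e0 K = (\<lambda>(e, k, ret, b, u, v, fr). e = e0 \<and> k + length fr = K \<and> node_ok e u \<and> node_ok e v \<and>
     (\<forall>(u, v, m, ph)\<in>set fr. node_ok e u \<and> node_ok e v \<and> node_ok e m))"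

lemma node_ok_simps [simp]:
  "node_ok e []" "node_ok e (map (Pair False) (Us e))" "node_ok e m \<Longrightarrow> node_ok e (inc m)"
  by (auto simp: node_ok_def comp_def)

lemma search_inv_step:
  assumes "search_inv e0 K s"
  shows "search_inv e0 K (step s)"
proof -
  obtain k ret b u v fr where s: "s = (e0, k, ret, b, u, v, fr)"
    using assms by (cases s) (auto simp: search_inv_def)
  show ?thesis
  proof (cases ret)
    case False
    then show ?thesis using assms by (cases k) (simp_all add: s search_inv_def step_def)
  next
    case True
    show ?thesis
    proof (cases fr)
      case Nil
      then show ?thesis using assms True by (simp add: s search_inv_def step_def)
    next
      case (Cons f fr')
      obtain u' v' m ph where f: "f = (u', v', m, ph)" by (cases f)
      show ?thesis using assms True unfolding s Cons f
        by (cases b; cases ph; cases "\<forall>x\<in>set m. fst x") (simp_all add: search_inv_def step_def)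
    qed
  qed
qed

lemma search_inv_steps: "search_inv e K s \<Longrightarrow> search_inv e K ((step ^^ i) s)"
  by (induction i) (auto intro: search_inv_step)

definition node_bound :: "nat \<Rightarrow> nat" where
  "node_bound n = n * (5 + n) + 1"

lemma sz_node_ok: "node_ok e m \<Longrightarrow> sz m \<le> node_bound (sz (Us e))"
proof (cases "m = []")
  case False
  assume "node_ok e m"
  then have m: "map snd m = Us e" using False by (simp add: node_ok_def)
  then have len: "length m \<le> sz (Us e)" by (metis length_le_sz length_map)
  have "sz x \<le> sz (Us e)" if "x \<in> snd ` set m" for x
    using that m sz_elem by (metis list.set_map)
  from sz_node[OF this] have "sz m \<le> length m * (5 + sz (Us e)) + 1" by simp
  also have "\<dots> \<le> node_bound (sz (Us e))" unfolding node_bound_def using len by simp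
  finally show ?thesis .
qed (simp add: node_bound_def)

lemma sz_search:
  assumes "search_inv e K s"
  shows "sz s \<le> sz e + 2 * K + 2 * node_bound (sz (Us e)) + K * (3 * node_bound (sz (Us e)) + 7) + 20"
proof -
  obtain k ret b u v fr where s: "s = (e, k, ret, b, u, v, fr)"
    using assms by (cases s) (auto simp: search_inv_def)
  let ?B = "node_bound (sz (Us e))"
  have "sz fr \<le> length fr * Suc (3 * ?B + 6) + 1"
  proof (rule sz_list_bound)
    fix f assume f: "f \<in> set fr"
    obtain u v m ph where "f = (u, v, m, ph)" by (cases f)
    then show "sz f \<le> 3 * ?B + 6"
      using f assms s sz_node_ok[of e u] sz_node_ok[of e v] sz_node_ok[of e m] sz_bool[of ph]
      by (auto simp: search_inv_def)
  qed
  also have "\<dots> \<le> K * (3 * ?B + 7) + 1"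
    using assms s by (intro add_mono mult_le_mono) (auto simp: search_inv_def)
  finally show ?thesis
    using assms s sz_node_ok[of e u] sz_node_ok[of e v] sz_bool[of ret] sz_bool[of b]
    by (auto simp: search_inv_def sz_nat)
qed

text \<open>With \<open>n = length (Us e)\<close>, the walk has \<open>2 ^ (n + 1) - 1\<close> inner
  points, more than the at most \<open>2 ^ n\<close> nodes, so one node recurs and the part between
  two occurrences can be repeated forever. Conversely, an infinite path is cut off and led into the
  sink, which every node may enter.\<close>

lemma infinite_path:
  assumes "Us e \<noteq> []"
  shows "reach (N e) (E e) (Suc (length (Us e))) [] [] \<longleftrightarrow>
    (\<exists>\<sigma>. (\<forall>i. \<sigma> i \<in> N e) \<and> start e (picked (\<sigma> 0)) \<and> (\<forall>i. edge e (picked (\<sigma> i)) (picked (\<sigma> (Suc i)))))"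
    (is "?l \<longleftrightarrow> ?r")
proof
  let ?n = "length (Us e)" and ?K = "Suc (length (Us e))"
  have ne: "m \<noteq> []" if "m \<in> N e" for m using that assms by (auto simp: N_def)
  {
    assume ?l
    then obtain \<sigma> where s: "\<sigma> 0 = []" "\<sigma> (2 ^ ?K) = []" "\<And>i. i < 2 ^ ?K \<Longrightarrow> E e (\<sigma> i) (\<sigma> (Suc i))"
        "\<And>i. 0 < i \<Longrightarrow> i < 2 ^ ?K \<Longrightarrow> \<sigma> i \<in> N e"
      unfolding reach_walk by blast
    \<comment> \<open>The inequality \<open>2 ^ n < 2 ^ (n + 1) - 1\<close>, which forces a
      repetition, fails at \<open>n = 0\<close>.\<close>
    have "?n \<ge> 1" using assms by (cases "Us e") auto
    then have "(2::nat) ^ ?n \<ge> 2 ^ 1" by (intro power_increasing) auto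
    then have card: "2 ^ ?n < card {1..<2 ^ ?K :: nat}" by simp
    have "inj_on bval (N e)" by (rule inj_onI) (auto simp: N_def intro: bval_inj)
    moreover have "bval ` N e \<subseteq> {..<2 ^ ?n}"
    proof
      fix x assume "x \<in> bval ` N e"
      then obtain m where m: "x = bval m" "map snd m = Us e" by (auto simp: N_def)
      from m(2) have "length m = ?n" by (metis length_map)
      then show "x \<in> {..<2 ^ ?n}" using m(1) bval_less[of m] by simp
    qed
    ultimately have fin: "finite (N e)" "card (N e) \<le> 2 ^ ?n"
      using card_inj_on_le[of bval "N e" "{..<2 ^ ?n}"] inj_on_finite[of bval "N e"] by auto
    have "\<sigma> ` {1..<2 ^ ?K} \<subseteq> N e" using s(4) by auto
    then have "card (\<sigma> ` {1..<2 ^ ?K}) < card {1..<2 ^ ?K :: nat}"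
      using card_mono[OF fin(1)] fin(2) card by (meson le_less_trans le_trans)
    then have "\<not> inj_on \<sigma> {1..<2 ^ ?K}" by (rule pigeonhole)
    then obtain a b where ab: "1 \<le> a" "a < b" "b < 2 ^ ?K" "\<sigma> a = \<sigma> b"
      unfolding inj_on_def by (metis atLeastLessThan_iff nat_neq_iff)
    define p where "p = b - a"
    \<comment> \<open>Up to \<open>a\<close> the walk is followed, afterwards its cycle of length
      \<open>p\<close> between \<open>a\<close> and \<open>b\<close>.\<close>
    define \<rho> where "\<rho> i = (if i < a then \<sigma> i else \<sigma> (a + (i - a) mod p))" for i
    have p: "p > 0" "a + p = b" using ab by (auto simp: p_def)
    have rng: "\<exists>j. 1 \<le> j \<and> j < b \<and> \<rho> i = \<sigma> j \<and> \<rho> (Suc i) = \<sigma> (Suc j)" if "1 \<le> i" for i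
    proof -
      consider "Suc i < a" | "Suc i = a" | "a \<le> i" by linarith
      then show ?thesis
      proof cases
        case 3
        let ?j = "a + (i - a) mod p"
        have j: "?j < b" using p mod_less_divisor[of p "i - a"] by linarith
        have "\<rho> (Suc i) = \<sigma> (Suc ?j)"
        proof (cases "Suc ((i - a) mod p) = p")
          case True
          then have "(Suc (i - a)) mod p = 0" by (simp add: mod_Suc)
          moreover have "Suc (a + (i - a) mod p) = b" using True p(2) by linarith
          ultimately show ?thesis using 3 ab(4) by (simp add: \<rho>_def Suc_diff_le)
        next
          case False
          then show ?thesis using 3 by (simp add: \<rho>_def Suc_diff_le mod_Suc)
        qed
        then show ?thesis using 3 j ab(1) by (intro exI[of _ ?j]) (simp add: \<rho>_def)
      qed (use that ab in \<open>auto simp: \<rho>_def intro!: exI[of _ i]\<close>)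
    qed
    have "\<rho> (Suc i) \<in> N e \<and> edge e (picked (\<rho> (Suc i))) (picked (\<rho> (Suc (Suc i))))" for i
    proof -
      obtain j where j: "1 \<le> j" "j < b" "\<rho> (Suc i) = \<sigma> j" "\<rho> (Suc (Suc i)) = \<sigma> (Suc j)"
        using rng[of "Suc i"] by auto
      have "\<sigma> j \<in> N e" "\<sigma> (Suc j) \<in> N e" using s(4) j(1,2) ab(3) by auto
      moreover have "E e (\<sigma> j) (\<sigma> (Suc j))" using s(3)[of j] j(2) ab(3) by simp
      ultimately show ?thesis using ne[of "\<sigma> j"] ne[of "\<sigma> (Suc j)"] j(3,4) by (auto simp: E_def)
    qed
    moreover have "\<rho> 1 = \<sigma> 1" using ab by (auto simp: \<rho>_def)
    then have "start e (picked (\<rho> (Suc 0)))" using s(1) s(3)[of 0] by (simp add: E_def)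
    \<comment> \<open>Position 0 of the walk is the source, so the path starts at position
      1.\<close>
    ultimately show ?r by (intro exI[of _ "\<lambda>i. \<rho> (Suc i)"]) blast
  }
  {
    assume ?r
    then obtain \<sigma> where s: "\<And>i. \<sigma> i \<in> N e" "start e (picked (\<sigma> 0))"
        "\<And>i. edge e (picked (\<sigma> i)) (picked (\<sigma> (Suc i)))" by blast
    define \<rho> where "\<rho> i = (if i = 0 \<or> i = 2 ^ ?K then [] else \<sigma> (i - 1))" for i
    have "E e (\<rho> i) (\<rho> (Suc i))" if i: "i < 2 ^ ?K" for i
    proof (cases i)
      case 0
      have "Suc 0 \<noteq> 2 ^ ?K" using one_less_power[of "2::nat" ?K] by (simp del: power_Suc)
      then show ?thesis using 0 s(2) ne[OF s(1)[of 0]] by (simp add: \<rho>_def E_def del: power_Suc)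
    next
      case (Suc j)
      then show ?thesis using i s(3)[of j] ne[OF s(1)[of j]] by (simp add: \<rho>_def E_def del: power_Suc)
    qed
    then show ?l unfolding reach_walk using s(1)
      by (intro exI[of _ \<rho>]) (auto simp: \<rho>_def simp del: power_Suc)
  }
qed

end

text \<open>The search works on lists, while the application speaks of sets. The primed predicates
  connect the two: \<open>start\<close> and \<open>edge\<close> may depend on the set of picked
  entries only, not on their order.\<close>

theorem PSPACE_subset_paths:
  fixes env :: "bool list \<Rightarrow> 'e::encodable" and Us :: "'e \<Rightarrow> 'u::encodable list"
  assumes env: "PT env" and valid: "PT valid" and Us: "PT Us"
    and start: "PT (\<lambda>z. start (fst z) (snd z))"
    and edge: "PT (\<lambda>z. edge (fst z) (fst (snd z)) (snd (snd z)))"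
    and ne: "\<And>e. Us e \<noteq> []"
    and start': "\<And>e xs. start e xs \<longleftrightarrow> start' e (set xs)"
    and edge': "\<And>e xs ys. edge e xs ys \<longleftrightarrow> edge' e (set xs) (set ys)"
  shows "{w. valid (env w) \<and> (\<exists>\<sigma>. (\<forall>i. \<sigma> i \<subseteq> set (Us (env w))) \<and> start' (env w) (\<sigma> 0) \<and>
    (\<forall>i. edge' (env w) (\<sigma> i) (\<sigma> (Suc i))))} \<in> PSPACE" (is "?L \<in> PSPACE")
proof -
  interpret subset_graph Us start edge .
  define K where "K e = Suc (length (Us e))" for e
  \<comment> \<open>An invalid input starts in a state that has already returned
    \<open>False\<close>, so that the loop stops at once and rejects.\<close>
  define init where "init w = (let e = env w in (e, K e, \<not> valid e, False, [], [], []) :: ('e, 'u) search)" for w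
  define run where "run s \<longleftrightarrow> \<not> (fst (snd (snd s)) \<and> snd (snd (snd (snd (snd (snd s))))) = [])"
    for s :: "('e, 'u) search"
  define acc where "acc s \<longleftrightarrow> fst (snd (snd (snd s)))" for s :: "('e, 'u) search"
  obtain be where be: "polyb be" "mono be" "\<And>w. sz (env w) \<le> be (sz w)"
    using PT_size[OF env] by blast
  obtain bu where bu: "polyb bu" "mono bu" "\<And>e. sz (Us e) \<le> bu (sz e)"
    using PT_size[OF Us] by blast
  define n1 where "n1 n = be (4 * n + 1)" for n
  define n2 where "n2 n = bu (n1 n)" for n
  define B where "B n = n1 n + 2 * Suc (n2 n) + 2 * node_bound (n2 n) +
    Suc (n2 n) * (3 * node_bound (n2 n) + 7) + 20" for n
  have Epicked: "PT (\<lambda>z. E (fst z) (fst (snd z)) (snd (snd z)))"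
    unfolding E_def
    by (intro PT_intros PT_comp[OF start, of "\<lambda>z. (fst z, picked (snd (snd z)))", simplified]
        PT_comp[OF edge, of "\<lambda>z. (fst z, picked (fst (snd z)), picked (snd (snd z)))", simplified] PT_picked)
  have "PT init" unfolding init_def Let_def K_def
    by (intro PT_intros env PT_comp[OF valid] PT_comp[OF Us])
  moreover have "PT step"
    unfolding step_def case_prod_beta'
    by (intro PT_intros PT_inc PT_comp[OF Us]
      PT_comp[OF Epicked, of "\<lambda>z. (fst z, fst (snd (snd (snd (snd z)))), fst (snd (snd (snd (snd (snd z))))))", simplified])
  moreover have "PT run" unfolding run_def by (intro PT_intros)
  moreover have "PT acc" unfolding acc_def by (intro PT_intros)
  moreover have "polyb n1" unfolding n1_def by (intro polyb_comp[OF be(1)] polyb_intros)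
  then have "polyb n2" unfolding n2_def by (intro polyb_comp[OF bu(1)])
  then have "polyb B" unfolding B_def node_bound_def using \<open>polyb n1\<close> by (intro polyb_intros)
  moreover have "sz ((step ^^ i) (init w)) \<le> B (length w)" for w i
  proof -
    let ?e = "env w"
    have "search_inv ?e (K ?e) (init w)" by (simp add: search_inv_def init_def Let_def node_ok_def)
    from sz_search[OF search_inv_steps[OF this]]
    have 1: "sz ((step ^^ i) (init w)) \<le> sz ?e + 2 * K ?e + 2 * node_bound (sz (Us ?e)) +
        K ?e * (3 * node_bound (sz (Us ?e)) + 7) + 20" .
    have e: "sz ?e \<le> n1 (length w)"
      using be(3)[of w] monoD[OF be(2) sz_bools[of w]] by (simp add: n1_def)
    have u: "sz (Us ?e) \<le> n2 (length w)"
      using bu(3)[of ?e] monoD[OF bu(2) e] by (simp add: n2_def)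
    then have k: "K ?e \<le> Suc (n2 (length w))"
      using length_le_sz[of "Us ?e"] by (simp add: K_def)
    have nb: "node_bound (sz (Us ?e)) \<le> node_bound (n2 (length w))"
      unfolding node_bound_def using u by (intro add_mono mult_mono) auto
    show ?thesis unfolding B_def
      by (rule order_trans[OF 1]) (intro add_mono mult_mono e k nb order_refl; simp)
  qed
  moreover have "\<exists>n. (\<forall>i<n. run ((step ^^ i) (init w))) \<and> \<not> run ((step ^^ n) (init w)) \<and>
      (acc ((step ^^ n) (init w)) \<longleftrightarrow> w \<in> ?L)" for w
  proof -
    let ?e = "env w"
    let ?path = "\<exists>\<sigma>. (\<forall>i. \<sigma> i \<subseteq> set (Us ?e)) \<and> start' ?e (\<sigma> 0) \<and> (\<forall>i. edge' ?e (\<sigma> i) (\<sigma> (Suc i)))"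
    have fixed: "step s = s" if "\<not> run s" for s
      using that by (cases s) (auto simp: step_def run_def split: list.splits)
    have ex: "\<exists>n. \<not> run ((step ^^ n) (init w)) \<and> (acc ((step ^^ n) (init w)) \<longleftrightarrow> w \<in> ?L)"
    proof (cases "valid ?e")
      case False
      then show ?thesis by (intro exI[of _ 0]) (auto simp: init_def run_def acc_def Let_def)
    next
      case True
      obtain n u' v' where n: "(step ^^ n) (init w) =
          (?e, K ?e, True, reach (N ?e) (E ?e) (K ?e) [] [], u', v', [])"
        using step_reach[of ?e "K ?e" False "[]" "[]" "[]"] True by (auto simp: init_def Let_def)
      have "reach (N ?e) (E ?e) (K ?e) [] [] \<longleftrightarrow> ?path"
        unfolding K_def infinite_path[OF ne] start' edge'
      proof
        assume "\<exists>\<sigma>. (\<forall>i. \<sigma> i \<in> N ?e) \<and> start' ?e (set (picked (\<sigma> 0))) \<and>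
          (\<forall>i. edge' ?e (set (picked (\<sigma> i))) (set (picked (\<sigma> (Suc i)))))"
        then obtain \<sigma> where s: "\<forall>i. \<sigma> i \<in> N ?e" "start' ?e (set (picked (\<sigma> 0)))"
          "\<forall>i. edge' ?e (set (picked (\<sigma> i))) (set (picked (\<sigma> (Suc i))))" by blast
        have "set (picked m) \<subseteq> set (Us ?e)" if "m \<in> N ?e" for m
          using that by (auto simp: N_def picked_def) (metis image_eqI list.set_map snd_conv)
        then show ?path using s by (intro exI[of _ "\<lambda>i. set (picked (\<sigma> i))"]) auto
      next
        assume ?path
        then obtain \<sigma> where s: "\<forall>i. \<sigma> i \<subseteq> set (Us ?e)" "start' ?e (\<sigma> 0)"
          "\<forall>i. edge' ?e (\<sigma> i) (\<sigma> (Suc i))" by blast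
        define \<tau> where "\<tau> i = map (\<lambda>u. (u \<in> \<sigma> i, u)) (Us ?e)" for i
        have "set (picked (\<tau> i)) = \<sigma> i" for i
          using s(1)[rule_format, of i] by (auto simp: \<tau>_def picked_def image_iff)
        moreover have "\<tau> i \<in> N ?e" for i by (simp add: N_def \<tau>_def comp_def)
        ultimately show "\<exists>\<sigma>. (\<forall>i. \<sigma> i \<in> N ?e) \<and> start' ?e (set (picked (\<sigma> 0))) \<and>
            (\<forall>i. edge' ?e (set (picked (\<sigma> i))) (set (picked (\<sigma> (Suc i)))))"
          using s by (intro exI[of _ \<tau>]) simp
      qed
      then show ?thesis using n True by (intro exI[of _ n]) (simp add: run_def acc_def)
    qed
    then obtain n where n: "\<not> run ((step ^^ n) (init w))" "acc ((step ^^ n) (init w)) \<longleftrightarrow> w \<in> ?L" by blast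
    \<comment> \<open>\<open>PSPACE_iterate\<close> asks for the first moment at which the search
      stops; as the state does not change afterwards, the verdict there agrees with the one after
      \<open>n\<close> steps.\<close>
    define l where "l = (LEAST n. \<not> run ((step ^^ n) (init w)))"
    have l: "\<not> run ((step ^^ l) (init w))" unfolding l_def using n(1) by (rule LeastI)
    have "l \<le> n" unfolding l_def using n(1) by (rule Least_le)
    have "(step ^^ (j + l)) (init w) = (step ^^ l) (init w)" for j
      by (induction j) (use fixed[OF l] in auto)
    from this[of "n - l"] have "(step ^^ n) (init w) = (step ^^ l) (init w)" using \<open>l \<le> n\<close> by simp
    moreover have "run ((step ^^ i) (init w))" if "i < l" for i
      using not_less_Least[of i "\<lambda>n. \<not> run ((step ^^ n) (init w))"] that unfolding l_def by blast
    ultimately show ?thesis using l n(2) by (intro exI[of _ l]) auto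
  qed
  ultimately show ?thesis by (intro PSPACE_iterate[of init step run acc B])
qed

section \<open>Encoding and parsing instances\<close>

definition eseq :: "('a \<Rightarrow> bool list) \<Rightarrow> ('b \<Rightarrow> bool list) \<Rightarrow> 'a \<times> 'b \<Rightarrow> bool list" where
  "eseq e1 e2 z = e1 (fst z) @ e2 (snd z)"

lemma PT_eseq:
  assumes "PT e1" "PT e2"
  shows "PT (eseq e1 e2)"
  unfolding eseq_def by (intro PT_intros PT_comp[OF assms(1)] PT_comp[OF assms(2)])

lemma enc_list_concat: "enc_list e xs = concat (map (\<lambda>x. True # e x) xs) @ [False]"
  by (induction xs) auto

lemma PT_enc_list:
  assumes "PT e"
  shows "PT (enc_list e)"
  unfolding enc_list_concat by (intro PT_intros PT_comp[OF assms])

lemma PT_enc_name: "PT enc_name"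
  unfolding enc_name_def by (intro PT_enc_list PT_intros)

lemma enc_symbol_if: "enc_symbol = (\<lambda>s. if s = sym_I then [True] else [False])"
  by (rule ext) (case_tac s; simp)

lemma PT_enc_symbol: "PT enc_symbol"
  unfolding enc_symbol_if by (intro PT_intros)

lemma enc_rule_eseq: "enc_rule = eseq enc_name (eseq enc_symbol (eseq enc_name
    (eseq enc_name (enc_list enc_symbol))))"
  by (rule ext) (auto simp: eseq_def)

lemma enc_config_eseq: "enc_config = eseq enc_name (enc_list enc_symbol)"
  by (rule ext) (auto simp: eseq_def)

type_synonym rule_data = "name \<times> counter_symbol \<times> name \<times> name \<times> counter_symbol list"

type_synonym cfg_data = "name \<times> counter_symbol list"

type_synonym instance_data =
  "name list \<times> name list \<times> name list \<times> name list \<times> rule_data list \<times> cfg_data \<times> cfg_data"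

definition enc_data :: "instance_data \<Rightarrow> bool list" where
  "enc_data = eseq (enc_list enc_name) (eseq (enc_list enc_name) (eseq (enc_list enc_name)
     (eseq (enc_list enc_name) (eseq (enc_list enc_rule) (eseq enc_config enc_config)))))"

definition data_presentation :: "instance_data \<Rightarrow> v1ca_presentation" where
  "data_presentation = (\<lambda>(ctl, ca, re, it, ru, c, d).
     \<lparr>control_list = ctl, call_list = ca, return_list = re, internal_list = it, rule_list = ru\<rparr>)"

lemma enc_data_eq:
  "enc_data (ctl, ca, re, it, ru, c, d) =
    enc_instance (data_presentation (ctl, ca, re, it, ru, c, d)) c d"
  by (simp add: enc_data_def eseq_def enc_instance_def enc_presentation_def data_presentation_def)

lemma PT_enc_data: "PT enc_data"
  unfolding enc_data_def enc_rule_eseq enc_config_eseq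
  by (intro PT_eseq PT_enc_list PT_enc_name PT_enc_symbol)

text \<open>Parsers return junk on malformed input; the result is checked by encoding it again.\<close>

definition parser :: "('a::encodable \<Rightarrow> bool list) \<Rightarrow> (bool list \<Rightarrow> 'a \<times> bool list) \<Rightarrow> bool" where
  "parser e p \<longleftrightarrow> PT p \<and> (\<forall>x v. p (e x @ v) = (x, v)) \<and> (\<forall>w. length (snd (p w)) \<le> length w)"

definition pbit :: "bool list \<Rightarrow> bool \<times> bool list" where
  "pbit w = (hd w, tl w)"

definition psym :: "bool list \<Rightarrow> counter_symbol \<times> bool list" where
  "psym w = (if hd w then sym_I else sym_Z, tl w)"

lemma parser_pbit: "parser (\<lambda>b. [b]) pbit"
  unfolding parser_def pbit_def by (auto intro!: PT_intros)

lemma parser_psym: "parser enc_symbol psym"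
proof -
  have "psym (enc_symbol x @ v) = (x, v)" for x v by (cases x) (auto simp: psym_def)
  then show ?thesis unfolding parser_def psym_def by (auto intro!: PT_intros)
qed

definition pseq :: "(bool list \<Rightarrow> 'a \<times> bool list) \<Rightarrow> (bool list \<Rightarrow> 'b \<times> bool list) \<Rightarrow>
    bool list \<Rightarrow> ('a \<times> 'b) \<times> bool list" where
  "pseq p1 p2 w = ((fst (p1 w), fst (p2 (snd (p1 w)))), snd (p2 (snd (p1 w))))"

lemma parser_pseq:
  assumes "parser e1 p1" "parser e2 p2"
  shows "parser (eseq e1 e2) (pseq p1 p2)"
proof -
  have p: "PT p1" "PT p2" using assms by (auto simp: parser_def)
  have "PT (pseq p1 p2)"
    unfolding pseq_def by (intro PT_intros PT_comp[OF p(1)] PT_comp[OF p(2)])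
  moreover have "length (snd (pseq p1 p2 w)) \<le> length w" for w
    using assms unfolding parser_def pseq_def by (metis le_trans snd_conv)
  ultimately show ?thesis using assms by (simp add: parser_def pseq_def eseq_def)
qed

text \<open>The state consists of a flag for the closing bit, the reversed entries and the remaining
  input. The fold in \<open>plist\<close> runs over the input itself merely to have enough rounds:
  every entry costs at least its leading \<open>True\<close>, so the input is longer than the parsed
  list.\<close>

definition pstep :: "(bool list \<Rightarrow> 'a \<times> bool list) \<Rightarrow> bool \<times> 'a list \<times> bool list \<Rightarrow> bool \<Rightarrow>
    bool \<times> 'a list \<times> bool list" where
  "pstep p s _ = (if fst s \<or> snd (snd s) = [] then s
     else if hd (snd (snd s)) then
       (False, fst (p (tl (snd (snd s)))) # fst (snd s), snd (p (tl (snd (snd s)))))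
     else (True, fst (snd s), tl (snd (snd s))))"

definition plist :: "(bool list \<Rightarrow> 'a \<times> bool list) \<Rightarrow> bool list \<Rightarrow> 'a list \<times> bool list" where
  "plist p w = (rev (fst (snd (foldl (pstep p) (False, [], w) w))),
     snd (snd (foldl (pstep p) (False, [], w) w)))"

lemma pstep_simps:
  "pstep p (True, acc, v) y = (True, acc, v)"
  "pstep p (False, acc, False # v) y = (True, acc, v)"
  "pstep p (False, acc, True # v) y = (False, fst (p v) # acc, snd (p v))"
  by (auto simp: pstep_def)

lemma foldl_pstep_done: "foldl (pstep p) (True, acc, v) ys = (True, acc, v)"
  by (induction ys) (auto simp: pstep_simps)

lemma foldl_pstep_enc:
  assumes "\<And>x v. p (e x @ v) = (x, v)" "length xs < length ys"
  shows "foldl (pstep p) (False, acc, enc_list e xs @ v) ys = (True, rev xs @ acc, v)"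
  using assms(2)
proof (induction xs arbitrary: ys acc)
  case Nil
  then show ?case by (cases ys) (auto simp: pstep_simps foldl_pstep_done)
next
  case (Cons x xs)
  then obtain y ys' where "ys = y # ys'" "length xs < length ys'" by (cases ys) auto
  then show ?case using Cons.IH[of ys' "x # acc"] by (simp add: pstep_simps assms(1))
qed

lemma length_enc_list: "length xs < length (enc_list e xs @ v)"
  by (induction xs) auto

text \<open>The remainder never grows, so all entries are parsed from words of length at most
  \<open>n\<close> and share one size bound. This rules out growth from one entry to the
  next.\<close>

lemma foldl_pstep_inv:
  assumes "\<And>w. length (snd (p w)) \<le> length w" "\<And>w. length w \<le> n \<Longrightarrow> sz (fst (p w)) \<le> B"
    and "length (snd (snd s)) \<le> n" "\<forall>x\<in>set (fst (snd s)). sz x \<le> B"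
  shows "length (snd (snd (foldl (pstep p) s ys))) \<le> n \<and>
    (\<forall>x\<in>set (fst (snd (foldl (pstep p) s ys))). sz x \<le> B) \<and>
    length (fst (snd (foldl (pstep p) s ys))) \<le> length (fst (snd s)) + length ys"
  using assms(3,4)
proof (induction ys arbitrary: s)
  case (Cons y ys)
  let ?r = "snd (snd s)"
  have "length (snd (p (tl ?r))) \<le> n"
    using assms(1)[of "tl ?r"] Cons.prems(1) by (metis le_trans length_tl diff_le_self)
  moreover have "sz (fst (p (tl ?r))) \<le> B" using Cons.prems(1) by (intro assms(2)) auto
  ultimately have "length (snd (snd (pstep p s y))) \<le> n" "\<forall>x\<in>set (fst (snd (pstep p s y))). sz x \<le> B"
    "length (fst (snd (pstep p s y))) \<le> Suc (length (fst (snd s)))"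
    using Cons.prems by (auto simp: pstep_def)
  then show ?case using Cons.IH[of "pstep p s y"] by (auto intro: le_trans)
qed simp

lemma parser_plist:
  assumes "parser e p"
  shows "parser (enc_list e) (plist p)"
proof -
  have p: "PT p" "\<And>x v. p (e x @ v) = (x, v)" "\<And>w. length (snd (p w)) \<le> length w"
    using assms by (auto simp: parser_def)
  obtain b where b: "polyb b" "mono b" "\<And>w. sz (p w) \<le> b (sz w)" using PT_size[OF p(1)] by blast
  have bound: "sz (fst (p w)) \<le> b (4 * n + 1)" if "length w \<le> n" for w n
  proof -
    have "sz (fst (p w)) \<le> sz (p w)" by (simp add: tr_prod_def)
    also have "\<dots> \<le> b (sz w)" by (rule b)
    also have "\<dots> \<le> b (4 * n + 1)"
      using sz_bools[of w] that by (intro monoD[OF b(2)]) linarith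
    finally show ?thesis .
  qed
  have "PT (\<lambda>w. foldl (pstep p) (False, [], w) w)"
  proof (rule PT_foldl)
    show "PT (\<lambda>z :: bool list \<times> (bool \<times> 'a list \<times> bool list) \<times> bool.
        pstep p (fst (snd z)) (snd (snd z)))"
      unfolding pstep_def by (intro PT_intros PT_comp[OF p(1)])
    show "polyb (\<lambda>n. 5 + (n * Suc (b (4 * n + 1)) + 1) + (4 * n + 1))"
      by (intro polyb_intros polyb_comp[OF b(1)])
    fix w :: "bool list" and i
    let ?s = "foldl (pstep p) (False, [], w) (take i w)" and ?B = "b (4 * length w + 1)"
    have inv: "length (snd (snd ?s)) \<le> length w" "\<forall>x\<in>set (fst (snd ?s)). sz x \<le> ?B"
        "length (fst (snd ?s)) \<le> length w"
      using foldl_pstep_inv[where p = p and n = "length w" and B = ?B and s = "(False, [], w)" and ys = "take i w"]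
        p(3) bound[of _ "length w"] by auto
    have "sz (fst (snd ?s)) \<le> length (fst (snd ?s)) * Suc ?B + 1"
      using inv(2) by (intro sz_list_bound) auto
    also have "\<dots> \<le> length w * Suc ?B + 1" using inv(3) by (intro add_mono mult_le_mono1) auto
    also have "\<dots> \<le> sz w * Suc (b (4 * sz w + 1)) + 1"
      using length_le_sz[of w] by (intro add_mono mult_mono) (auto intro!: monoD[OF b(2)])
    finally have 1: "sz (fst (snd ?s)) \<le> sz w * Suc (b (4 * sz w + 1)) + 1" .
    have 2: "sz (snd (snd ?s)) \<le> 4 * sz w + 1"
      using sz_bools[of "snd (snd ?s)"] inv(1) length_le_sz[of w] by linarith
    have "sz ?s = Suc (sz (fst ?s) + Suc (sz (fst (snd ?s)) + sz (snd (snd ?s))))"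
      by (metis (no_types, lifting) prod.collapse tr_Pair tsize.simps(2))
    then show "sz ?s \<le> 5 + (sz w * Suc (b (4 * sz w + 1)) + 1) + (4 * sz w + 1)"
      using 1 2 sz_bool[of "fst ?s"] by linarith
  qed (intro PT_intros)+
  then have "PT (plist p)" unfolding plist_def by (intro PT_intros)
  moreover have "plist p (enc_list e xs @ v) = (xs, v)" for xs v
    using foldl_pstep_enc[of p e xs "enc_list e xs @ v" "[]" v] p(2) length_enc_list[of xs e v]
    by (simp add: plist_def)
  moreover have "length (snd (plist p w)) \<le> length w" for w
  proof -
    define B where "B = b (4 * length w + 1)"
    show ?thesis
      using foldl_pstep_inv[where p = p and n = "length w" and B = B and s = "(False, [], w)" and ys = w]
        p(3) bound[of _ "length w"] by (auto simp: plist_def B_def)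
  qed
  ultimately show ?thesis by (simp add: parser_def)
qed

definition parse_data :: "bool list \<Rightarrow> instance_data" where
  "parse_data w =
     (let pname = plist pbit; prule = pseq pname (pseq psym (pseq pname (pseq pname (plist psym))));
        pcfg = pseq pname (plist psym)
      in fst (pseq (plist pname) (pseq (plist pname) (pseq (plist pname) (pseq (plist pname)
        (pseq (plist prule) (pseq pcfg pcfg))))) w))"

lemma PT_parse_data: "PT parse_data"
  and parse_enc_data: "parse_data (enc_data x) = x"
proof -
  define pname where "pname = plist pbit"
  define prule where "prule = pseq pname (pseq psym (pseq pname (pseq pname (plist psym))))"
  define pcfg where "pcfg = pseq pname (plist psym)"
  have n: "parser enc_name pname"
    unfolding enc_name_def pname_def by (intro parser_plist parser_pbit)
  have r: "parser enc_rule prule"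
    unfolding enc_rule_eseq prule_def by (intro parser_pseq parser_plist parser_psym n)
  have c: "parser enc_config pcfg"
    unfolding enc_config_eseq pcfg_def by (intro parser_pseq parser_plist parser_psym n)
  let ?p = "pseq (plist pname) (pseq (plist pname) (pseq (plist pname) (pseq (plist pname)
        (pseq (plist prule) (pseq pcfg pcfg)))))"
  have p: "parser enc_data ?p"
    unfolding enc_data_def by (intro parser_pseq parser_plist n r c)
  have eq: "parse_data w = fst (?p w)" for w
    by (simp only: parse_data_def Let_def pname_def prule_def pcfg_def)
  have "PT ?p" using p by (simp only: parser_def)
  from PT_fst[OF this] show "PT parse_data" unfolding eq[abs_def] .
  have "?p (enc_data x @ []) = (x, [])" using p unfolding parser_def by blast
  then show "parse_data (enc_data x) = x" by (simp add: eq)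
qed

section \<open>Membership in PSPACE\<close>

abbreviation src :: "rule_data \<Rightarrow> name" where "src r \<equiv> fst r"
abbreviation ssym :: "rule_data \<Rightarrow> counter_symbol" where "ssym r \<equiv> fst (snd r)"
abbreviation act :: "rule_data \<Rightarrow> name" where "act r \<equiv> fst (snd (snd r))"
abbreviation tgt :: "rule_data \<Rightarrow> name" where "tgt r \<equiv> fst (snd (snd (snd r)))"
abbreviation psh :: "rule_data \<Rightarrow> counter_symbol list" where "psh r \<equiv> snd (snd (snd (snd r)))"

text \<open>Two related configurations push and pop in lockstep, so the stacks of the pairs reachable from
  \<open>(I\<^sup>k \<alpha>, I\<^sup>k \<beta>)\<close>, where not both of \<open>\<alpha>\<close> and \<open>\<beta>\<close> start with \<open>I\<close>, are \<open>(I\<^sup>l \<alpha>, I\<^sup>l \<beta>)\<close>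
  for some level \<open>l\<close>.\<close>

definition stk :: "nat \<Rightarrow> counter_symbol list \<Rightarrow> counter_symbol list" where
  "stk l \<delta> = replicate l sym_I @ \<delta>"

text \<open>Above level zero the top symbol is I on both sides and the base \<open>\<delta>\<close>
  is invisible; at level zero, marked by \<open>zt\<close>, the rule reads the base.\<close>

definition fires :: "bool \<Rightarrow> counter_symbol list \<Rightarrow> name \<Rightarrow> rule_data \<Rightarrow> bool" where
  "fires zt \<delta> p r \<longleftrightarrow> src r = p \<and> (if zt then \<delta> \<noteq> [] \<and> hd \<delta> = ssym r else ssym r = sym_I)"

text \<open>The predicate \<open>f\<close> receives the number of pushed symbols, since this fixes
  the level after the move; by visibility it is the same for both rules.\<close>

definition matches :: "rule_data list \<Rightarrow> bool \<Rightarrow> counter_symbol list \<Rightarrow> counter_symbol list \<Rightarrow>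
    name \<Rightarrow> name \<Rightarrow> (nat \<Rightarrow> name \<Rightarrow> name \<Rightarrow> bool) \<Rightarrow> bool" where
  "matches ru zt \<delta>1 \<delta>2 p1 p2 f \<longleftrightarrow> (\<forall>r\<in>set ru. fires zt \<delta>1 p1 r \<longrightarrow>
     (\<exists>r'\<in>set ru. fires zt \<delta>2 p2 r' \<and> act r' = act r \<and> f (length (psh r)) (tgt r) (tgt r')))"

text \<open>An atom \<open>(t, p, q)\<close> with \<open>t < 4\<close> at level \<open>l\<close> says that \<open>(p I\<^sup>l \<alpha>, q I\<^sup>l \<beta>)\<close> is in the
  \<open>t\<close>-th relation, the odd relations being converses of simulations; an atom \<open>(4 + j, [], [])\<close>
  says that the initial pair is \<open>j\<close> levels higher.\<close>

type_synonym atom = "nat \<times> name \<times> name"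

text \<open>A rule that pushes \<open>n\<close> symbols in place of the top changes the level by
  \<open>n - 1\<close>, so for \<open>n\<close> = 0, 1, 2 the successor lies one level below, on the
  same level, or one above. \<open>A\<close>, \<open>B\<close>, \<open>C\<close> are the atoms on
  these levels.\<close>

definition in_level :: "atom set \<Rightarrow> atom set \<Rightarrow> atom set \<Rightarrow> nat \<Rightarrow> atom \<Rightarrow> bool" where
  "in_level A B C n x \<longleftrightarrow> n = 0 \<and> x \<in> A \<or> n = 1 \<and> x \<in> B \<or> n \<noteq> 0 \<and> n \<noteq> 1 \<and> x \<in> C"

text \<open>The nine relations are instances of one system of four relations: \<open>\<kappa>\<close> selects the condition on
  enabled actions (1 for completed, 2 for ready simulations), \<open>incl\<close> lists the inclusions between the
  four relations, and \<open>ini\<close> lists those that contain the initial pair.\<close>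

definition local_ok :: "nat \<Rightarrow> (nat \<times> nat) list \<Rightarrow> nat list \<Rightarrow> rule_data list \<Rightarrow>
    counter_symbol list \<Rightarrow> counter_symbol list \<Rightarrow> name \<Rightarrow> name \<Rightarrow> bool \<Rightarrow>
    atom set \<Rightarrow> atom set \<Rightarrow> atom set \<Rightarrow> bool" where
  "local_ok \<kappa> incl ini ru \<alpha> \<beta> p0 q0 zt A B C \<longleftrightarrow> (\<forall>a\<in>B.
     if fst a \<in> set [0, 1, 2, 3] then
       (fst a \<in> set [0, 2] \<longrightarrow> matches ru zt \<alpha> \<beta> (fst (snd a)) (snd (snd a))
          (\<lambda>n p' q'. in_level A B C n (fst a, p', q'))) \<and>
       (fst a \<in> set [1, 3] \<longrightarrow> matches ru zt \<beta> \<alpha> (snd (snd a)) (fst (snd a))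
          (\<lambda>n q' p'. in_level A B C n (fst a, p', q'))) \<and>
       (\<kappa> = 1 \<longrightarrow> (\<exists>r\<in>set ru. fires zt \<alpha> (fst (snd a)) r) = (\<exists>r\<in>set ru. fires zt \<beta> (snd (snd a)) r)) \<and>
       (\<kappa> = 2 \<longrightarrow> matches ru zt \<alpha> \<beta> (fst (snd a)) (snd (snd a)) (\<lambda>_ _ _. True) \<and>
          matches ru zt \<beta> \<alpha> (snd (snd a)) (fst (snd a)) (\<lambda>_ _ _. True)) \<and>
       (\<forall>i\<in>set incl. fst i = fst a \<longrightarrow> (snd i, snd a) \<in> B)
     else if fst a = 4 then \<forall>t\<in>set ini. (t, p0, q0) \<in> B
     else (fst a - Suc 0, [], []) \<in> C)"

section \<open>The nine relations as solutions of one system\<close>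

definition relational_system ::
    "nat \<Rightarrow> (nat \<times> nat) list \<Rightarrow> nat list \<Rightarrow> ('s, 'a) lts \<Rightarrow> 's \<Rightarrow> 's \<Rightarrow> (nat \<Rightarrow> ('s \<times> 's) set) \<Rightarrow> bool" where
  "relational_system \<kappa> incl ini T c d R \<longleftrightarrow>
     (\<forall>t\<in>{0, 2}. simulation T (R t)) \<and> (\<forall>t\<in>{1, 3}. simulation T ((R t)\<inverse>)) \<and>
     (\<forall>t<4. \<forall>(s, s')\<in>R t. (\<kappa> = 1 \<longrightarrow> (enabled T s = {} \<longleftrightarrow> enabled T s' = {})) \<and>
        (\<kappa> = 2 \<longrightarrow> enabled T s = enabled T s')) \<and>
     (\<forall>(t, t')\<in>set incl. R t \<subseteq> R t') \<and> (\<forall>t\<in>set ini. (c, d) \<in> R t)"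

lemma relational_system_enabled:
  assumes "relational_system \<kappa> incl ini T c d R" "(s, s') \<in> R t" "t < 4"
  shows "\<kappa> = 1 \<Longrightarrow> enabled T s = {} \<longleftrightarrow> enabled T s' = {}" "\<kappa> = 2 \<Longrightarrow> enabled T s = enabled T s'"
  using assms unfolding relational_system_def by blast+

lemma simulation_empty [simp]: "simulation T {}"
  by (simp add: simulation_def)

lemma simulationD:
  "simulation T R \<Longrightarrow> (s, t) \<in> R \<Longrightarrow> (s, a, s') \<in> transitions T \<Longrightarrow>
    \<exists>t'. (t, a, t') \<in> transitions T \<and> (s', t') \<in> R"
  unfolding simulation_def by blast

lemma simulationI:
  assumes "R \<subseteq> states T \<times> states T"
    "\<And>s t a s'. (s, t) \<in> R \<Longrightarrow> (s, a, s') \<in> transitions T \<Longrightarrow>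
      \<exists>t'. (t, a, t') \<in> transitions T \<and> (s', t') \<in> R"
  shows "simulation T R"
  using assms unfolding simulation_def by fast

lemma simulation_Un:
  assumes "simulation T R" "simulation T R'"
  shows "simulation T (R \<union> R')"
proof (rule simulationI)
  show "R \<union> R' \<subseteq> states T \<times> states T" using assms by (auto simp: simulation_def)
  show "\<exists>t'. (t, a, t') \<in> transitions T \<and> (s', t') \<in> R \<union> R'"
    if "(s, t) \<in> R \<union> R'" "(s, a, s') \<in> transitions T" for s t a s'
    using that(1)
  proof
    assume "(s, t) \<in> R"
    from simulationD[OF assms(1) this that(2)] show ?thesis by blast
  next
    assume "(s, t) \<in> R'"
    from simulationD[OF assms(2) this that(2)] show ?thesis by blast
  qed
qed

lemma less_4: "t < 4 \<longleftrightarrow> t \<in> {0, 1, 2, 3 :: nat}"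
  by auto

lemma system_sim: "sim_preorder T c d \<longleftrightarrow> (\<exists>R. relational_system 0 [] [0] T c d R)"
proof
  assume "sim_preorder T c d"
  then obtain R where R: "simulation T R" "(c, d) \<in> R" by (auto simp: sim_preorder_def)
  then show "\<exists>R. relational_system 0 [] [0] T c d R"
    by (intro exI[of _ "(\<lambda>_. {})(0 := R)"]) (simp add: relational_system_def)
qed (auto simp: relational_system_def sim_preorder_def)

lemma system_sim_equiv: "sim_equiv T c d \<longleftrightarrow> (\<exists>R. relational_system 0 [] [0, 1] T c d R)"
proof
  assume "sim_equiv T c d"
  then obtain R R' where R: "simulation T R" "(c, d) \<in> R" "simulation T R'" "(d, c) \<in> R'"
    by (auto simp: sim_preorder_def sim_equiv_def)
  then show "\<exists>R. relational_system 0 [] [0, 1] T c d R"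
    by (intro exI[of _ "(\<lambda>_. {})(0 := R, 1 := R'\<inverse>)"]) (simp add: relational_system_def)
next
  assume "\<exists>R. relational_system 0 [] [0, 1] T c d R"
  then show "sim_equiv T c d"
    unfolding relational_system_def sim_preorder_def sim_equiv_def
    by (metis converse_iff insertI1 insert_iff list.set_intros)
qed

lemma system_completed: "completed_sim_preorder T c d \<longleftrightarrow> (\<exists>R. relational_system 1 [] [0] T c d R)"
proof
  assume "completed_sim_preorder T c d"
  then obtain R where R: "completed_simulation T R" "(c, d) \<in> R" by (auto simp: completed_sim_preorder_def)
  then show "\<exists>R. relational_system 1 [] [0] T c d R"
    by (intro exI[of _ "(\<lambda>_. {})(0 := R)"]) (auto simp: relational_system_def completed_simulation_def)
next
  assume "\<exists>R. relational_system 1 [] [0] T c d R"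
  then obtain R where R: "relational_system 1 [] [0] T c d R" ..
  then have "completed_simulation T (R 0)" "(c, d) \<in> R 0"
    using relational_system_enabled[OF R, of _ _ 0]
    unfolding relational_system_def completed_simulation_def by (simp_all, blast)
  then show "completed_sim_preorder T c d" by (auto simp: completed_sim_preorder_def)
qed

lemma system_completed_equiv:
  "completed_sim_equiv T c d \<longleftrightarrow> (\<exists>R. relational_system 1 [] [0, 1] T c d R)"
proof
  assume "completed_sim_equiv T c d"
  then obtain R R' where R: "completed_simulation T R" "(c, d) \<in> R" "completed_simulation T R'" "(d, c) \<in> R'"
    by (auto simp: completed_sim_preorder_def completed_sim_equiv_def)
  then show "\<exists>R. relational_system 1 [] [0, 1] T c d R"
    by (intro exI[of _ "(\<lambda>_. {})(0 := R, 1 := R'\<inverse>)"]) (auto simp: relational_system_def completed_simulation_def)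
next
  assume "\<exists>R. relational_system 1 [] [0, 1] T c d R"
  then obtain R where R: "relational_system 1 [] [0, 1] T c d R" ..
  have en: "(s, s') \<in> R 0 \<Longrightarrow> (enabled T s = {} \<longleftrightarrow> enabled T s' = {})" "(s, s') \<in> R 1 \<Longrightarrow> (enabled T s = {} \<longleftrightarrow> enabled T s' = {})" for s s'
    using relational_system_enabled[OF R] by auto
  from R have "completed_simulation T (R 0)" "(c, d) \<in> R 0" "completed_simulation T ((R 1)\<inverse>)" "(d, c) \<in> (R 1)\<inverse>"
    using en unfolding relational_system_def completed_simulation_def by (simp_all, blast+)
  then show "completed_sim_equiv T c d" unfolding completed_sim_preorder_def completed_sim_equiv_def by blast
qed

lemma system_ready: "ready_sim_preorder T c d \<longleftrightarrow> (\<exists>R. relational_system 2 [] [0] T c d R)"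
proof
  assume "ready_sim_preorder T c d"
  then obtain R where R: "ready_simulation T R" "(c, d) \<in> R" by (auto simp: ready_sim_preorder_def)
  then show "\<exists>R. relational_system 2 [] [0] T c d R"
    by (intro exI[of _ "(\<lambda>_. {})(0 := R)"]) (auto simp: relational_system_def ready_simulation_def)
next
  assume "\<exists>R. relational_system 2 [] [0] T c d R"
  then obtain R where R: "relational_system 2 [] [0] T c d R" ..
  then have "ready_simulation T (R 0)" "(c, d) \<in> R 0"
    using relational_system_enabled[OF R, of _ _ 0]
    unfolding relational_system_def ready_simulation_def by (simp_all, blast)
  then show "ready_sim_preorder T c d" by (auto simp: ready_sim_preorder_def)
qed

lemma system_ready_equiv: "ready_sim_equiv T c d \<longleftrightarrow> (\<exists>R. relational_system 2 [] [0, 1] T c d R)"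
proof
  assume "ready_sim_equiv T c d"
  then obtain R R' where R: "ready_simulation T R" "(c, d) \<in> R" "ready_simulation T R'" "(d, c) \<in> R'"
    by (auto simp: ready_sim_preorder_def ready_sim_equiv_def)
  then show "\<exists>R. relational_system 2 [] [0, 1] T c d R"
    by (intro exI[of _ "(\<lambda>_. {})(0 := R, 1 := R'\<inverse>)"]) (auto simp: relational_system_def ready_simulation_def)
next
  assume "\<exists>R. relational_system 2 [] [0, 1] T c d R"
  then obtain R where R: "relational_system 2 [] [0, 1] T c d R" ..
  have en: "(s, s') \<in> R 0 \<Longrightarrow> (enabled T s = enabled T s')" "(s, s') \<in> R 1 \<Longrightarrow> (enabled T s = enabled T s')" for s s'
    using relational_system_enabled[OF R] by auto
  from R have "ready_simulation T (R 0)" "(c, d) \<in> R 0" "ready_simulation T ((R 1)\<inverse>)" "(d, c) \<in> (R 1)\<inverse>"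
    using en unfolding relational_system_def ready_simulation_def by (simp_all, blast+)
  then show "ready_sim_equiv T c d" unfolding ready_sim_preorder_def ready_sim_equiv_def by blast
qed

lemma system_two_nested:
  "two_nested_sim_preorder T c d \<longleftrightarrow> (\<exists>R. relational_system 0 [(0, 1)] [0] T c d R)"
proof
  assume "two_nested_sim_preorder T c d"
  then obtain R R' where R: "simulation T R" "simulation T R'" "R\<inverse> \<subseteq> R'" "(c, d) \<in> R"
    by (auto simp: two_nested_sim_preorder_def two_nested_simulation_def)
  then show "\<exists>R. relational_system 0 [(0, 1)] [0] T c d R"
    by (intro exI[of _ "(\<lambda>_. {})(0 := R, 1 := R'\<inverse>)"]) (auto simp: relational_system_def)
next
  assume "\<exists>R. relational_system 0 [(0, 1)] [0] T c d R"
  then obtain R where R: "relational_system 0 [(0, 1)] [0] T c d R" ..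
  then have "simulation T (R 0)" "(c, d) \<in> R 0" "simulation T ((R 1)\<inverse>)" "(R 0)\<inverse> \<subseteq> (R 1)\<inverse>"
    unfolding relational_system_def by auto
  then show "two_nested_sim_preorder T c d"
    unfolding two_nested_sim_preorder_def two_nested_simulation_def by blast
qed

text \<open>Four relations are needed here: 0 and 3 carry a 2-nested simulation for
  \<open>(c, d)\<close> and the simulation that contains its converse, 1 and 2 the same for
  \<open>(d, c)\<close>. As the odd ones are stored as converses, both conditions of the form
  \<open>R\<inverse> \<subseteq> R'\<close> become plain inclusions.\<close>

lemma system_two_nested_equiv:
  "two_nested_sim_equiv T c d \<longleftrightarrow> (\<exists>R. relational_system 0 [(0, 3), (1, 2)] [0, 1] T c d R)"
proof
  assume "two_nested_sim_equiv T c d"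
  then obtain R R' where R: "simulation T R" "simulation T R'" "R\<inverse> \<subseteq> R'" "(c, d) \<in> R"
    unfolding two_nested_sim_equiv_def two_nested_sim_preorder_def two_nested_simulation_def by blast
  obtain Q Q' where Q: "simulation T Q" "simulation T Q'" "Q\<inverse> \<subseteq> Q'" "(d, c) \<in> Q"
    using \<open>two_nested_sim_equiv T c d\<close>
    unfolding two_nested_sim_equiv_def two_nested_sim_preorder_def two_nested_simulation_def by blast
  show "\<exists>R. relational_system 0 [(0, 3), (1, 2)] [0, 1] T c d R"
    by (intro exI[of _ "(\<lambda>_. {})(0 := R, 1 := Q\<inverse>, 2 := Q', 3 := R'\<inverse>)"])
      (use R Q in \<open>auto simp: relational_system_def\<close>)
next
  assume "\<exists>R. relational_system 0 [(0, 3), (1, 2)] [0, 1] T c d R"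
  then obtain R where R: "relational_system 0 [(0, 3), (1, 2)] [0, 1] T c d R" ..
  then have "simulation T (R 0)" "(c, d) \<in> R 0" "simulation T ((R 3)\<inverse>)" "(R 0)\<inverse> \<subseteq> (R 3)\<inverse>"
    "simulation T ((R 1)\<inverse>)" "(d, c) \<in> (R 1)\<inverse>" "simulation T (R 2)" "((R 1)\<inverse>)\<inverse> \<subseteq> R 2"
    unfolding relational_system_def by auto
  then show "two_nested_sim_equiv T c d"
    unfolding two_nested_sim_equiv_def two_nested_sim_preorder_def two_nested_simulation_def by blast
qed

text \<open>The two inclusions make relations 0 and 1 equal, hence relation 0 and its converse are
  both simulations. It need not be symmetric, so the bisimulation is its union with the
  converse.\<close>

lemma system_bisimilar: "bisimilar T c d \<longleftrightarrow> (\<exists>R. relational_system 0 [(0, 1), (1, 0)] [0] T c d R)"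
proof
  assume "bisimilar T c d"
  then obtain R where R: "simulation T R" "R\<inverse> = R" "(c, d) \<in> R"
    by (auto simp: bisimilar_def bisimulation_def)
  then show "\<exists>R. relational_system 0 [(0, 1), (1, 0)] [0] T c d R"
    by (intro exI[of _ "(\<lambda>_. {})(0 := R, 1 := R)"]) (simp add: relational_system_def)
next
  assume "\<exists>R. relational_system 0 [(0, 1), (1, 0)] [0] T c d R"
  then obtain R where R: "relational_system 0 [(0, 1), (1, 0)] [0] T c d R" ..
  then have "simulation T (R 0)" "(c, d) \<in> R 0" "simulation T ((R 0)\<inverse>)"
    unfolding relational_system_def by auto
  then have "bisimulation T (R 0 \<union> (R 0)\<inverse>)" "(c, d) \<in> R 0 \<union> (R 0)\<inverse>"
    unfolding bisimulation_def using simulation_Un by auto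
  then show "bisimilar T c d" unfolding bisimilar_def by blast
qed

section \<open>Moves of an automaton level by level\<close>

locale v1ca =
  fixes D :: v1ca_presentation
  assumes pres: "presents_v1ca D"
begin

abbreviation "T \<equiv> pda_lts (presented_pda D)"
abbreviation "ru \<equiv> rule_list D"
abbreviation "ctl \<equiv> control_list D"

lemma sym_cases: "(x :: counter_symbol) = sym_I \<or> x = sym_Z"
  by (cases x) auto

lemma all_symbols [simp]: "{sym_I, sym_Z} = UNIV"
  using sym_cases by auto

lemma rule_props:
  assumes "(p, X, a, q, \<gamma>) \<in> set ru"
  shows "p \<in> set ctl" "q \<in> set ctl"
    "a \<in> set (call_list D) \<and> length \<gamma> = 2 \<or> a \<in> set (return_list D) \<and> length \<gamma> = 0 \<or>
     a \<in> set (internal_list D) \<and> length \<gamma> = 1"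
    "\<exists>\<delta>\<in>lists {sym_I}. X = sym_I \<and> \<gamma> = \<delta> \<or> X = sym_Z \<and> \<gamma> = \<delta> @ [sym_Z]"
proof -
  let ?P = "presented_pda D"
  have r: "(p, X, a, q, \<gamma>) \<in> rules ?P" using assms by (simp add: presented_pda_def)
  have P: "pushdown_automaton ?P" "one_counter_automaton ?P"
      "visibly_pushdown (set (call_list D)) (set (return_list D)) (set (internal_list D)) ?P"
    using pres by (auto simp: presents_v1ca_def visibly_one_counter_automaton_def visibly_pushdown_def)
  show "p \<in> set ctl" "q \<in> set ctl"
    using P(1) r unfolding pushdown_automaton_def by (auto simp: presented_pda_def)
  have "a \<in> actions ?P" using P(1) r unfolding pushdown_automaton_def by auto
  then have "a \<in> set (call_list D) \<or> a \<in> set (return_list D) \<or> a \<in> set (internal_list D)"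
    by (simp add: presented_pda_def)
  then show "a \<in> set (call_list D) \<and> length \<gamma> = 2 \<or> a \<in> set (return_list D) \<and> length \<gamma> = 0 \<or>
     a \<in> set (internal_list D) \<and> length \<gamma> = 1"
    using P(3) r unfolding visibly_pushdown_def by auto
  show "\<exists>\<delta>\<in>lists {sym_I}. X = sym_I \<and> \<gamma> = \<delta> \<or> X = sym_Z \<and> \<gamma> = \<delta> @ [sym_Z]"
    using P(2) r unfolding one_counter_automaton_def by auto
qed

lemma actions_disjoint:
  "set (call_list D) \<inter> set (return_list D) = {}" "set (call_list D) \<inter> set (internal_list D) = {}"
  "set (return_list D) \<inter> set (internal_list D) = {}"
  using pres by (auto simp: presents_v1ca_def visibly_one_counter_automaton_def visibly_pushdown_def)

lemma rule_class:
  "r \<in> set ru \<Longrightarrow> act r \<in> set (call_list D) \<and> length (psh r) = 2 \<or>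
     act r \<in> set (return_list D) \<and> length (psh r) = 0 \<or>
     act r \<in> set (internal_list D) \<and> length (psh r) = 1"
  by (rule rule_props(3)[of "src r" "ssym r" "act r" "tgt r" "psh r"]) simp

lemma psh_le: "r \<in> set ru \<Longrightarrow> length (psh r) \<le> 2"
  using rule_class[of r] by auto

text \<open>This is where visibility enters: an action belongs to exactly one of three disjoint
  classes, and the class fixes how many symbols are pushed.\<close>

lemma same_length: "r \<in> set ru \<Longrightarrow> r' \<in> set ru \<Longrightarrow> act r = act r' \<Longrightarrow> length (psh r) = length (psh r')"
  using rule_class[of r] rule_class[of r'] actions_disjoint by auto

lemma lists_I: "\<delta> \<in> lists {sym_I} \<Longrightarrow> \<delta> = replicate (length \<delta>) sym_I"
  by (induction \<delta>) auto

lemma rule_shape: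
  assumes "r \<in> set ru"
  shows "ssym r = sym_I \<and> psh r = replicate (length (psh r)) sym_I \<or>
    ssym r = sym_Z \<and> length (psh r) > 0 \<and> psh r = replicate (length (psh r) - 1) sym_I @ [sym_Z]"
proof -
  obtain \<delta> where d: "\<delta> \<in> lists {sym_I}" "ssym r = sym_I \<and> psh r = \<delta> \<or> ssym r = sym_Z \<and> psh r = \<delta> @ [sym_Z]"
    using rule_props(4)[of "src r" "ssym r" "act r" "tgt r" "psh r"] assms by auto
  then show ?thesis using lists_I[OF d(1)] by auto
qed

lemma states_T: "states T = set ctl \<times> UNIV"
  by (simp add: pda_lts_def configurations_def presented_pda_def)

lemma trans_iff:
  "((p, \<delta>), a, s') \<in> transitions T \<longleftrightarrow>
    (\<exists>r\<in>set ru. src r = p \<and> act r = a \<and> \<delta> \<noteq> [] \<and> hd \<delta> = ssym r \<and> s' = (tgt r, psh r @ tl \<delta>))"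
proof
  assume "((p, \<delta>), a, s') \<in> transitions T"
  then obtain X q \<gamma> \<delta>' where "\<delta> = X # \<delta>'" "s' = (q, \<gamma> @ \<delta>')" "(p, X, a, q, \<gamma>) \<in> set ru"
    by (auto simp: pda_lts_def presented_pda_def)
  then show "\<exists>r\<in>set ru. src r = p \<and> act r = a \<and> \<delta> \<noteq> [] \<and> hd \<delta> = ssym r \<and> s' = (tgt r, psh r @ tl \<delta>)"
    by (intro bexI[of _ "(p, X, a, q, \<gamma>)"]) auto
next
  assume "\<exists>r\<in>set ru. src r = p \<and> act r = a \<and> \<delta> \<noteq> [] \<and> hd \<delta> = ssym r \<and> s' = (tgt r, psh r @ tl \<delta>)"
  then obtain r where r: "r \<in> set ru" "src r = p" "act r = a" "\<delta> \<noteq> []" "hd \<delta> = ssym r"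
    "s' = (tgt r, psh r @ tl \<delta>)" by blast
  then have "(p, hd \<delta>, a, tgt r, psh r) \<in> set ru" by (metis prod.collapse)
  then have "((p, hd \<delta> # tl \<delta>), a, (tgt r, psh r @ tl \<delta>)) \<in> transitions T"
    by (auto simp: pda_lts_def presented_pda_def)
  then show "((p, \<delta>), a, s') \<in> transitions T" using r(4,6) by simp
qed

lemma trans_stk:
  "((p, stk l \<delta>), a, s') \<in> transitions T \<longleftrightarrow>
    (\<exists>r\<in>set ru. fires (l = 0) \<delta> p r \<and> act r = a \<and> s' = (tgt r, psh r @ tl (stk l \<delta>)))"
  unfolding trans_iff by (cases l) (auto simp: fires_def stk_def)

text \<open>A rule that reads the base at level zero and pushes at least one symbol restores the
  symbol it has read as the lowest one it pushes, both for I and for Z. So the base survives unless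
  a return occurs at level zero, the case excluded by the last assumption.\<close>

lemma next_stk:
  assumes "r \<in> set ru" "fires (l = 0) \<delta> p r" "0 < l + length (psh r)"
  shows "psh r @ tl (stk l \<delta>) = stk (l + length (psh r) - 1) \<delta>"
proof (cases l)
  case 0
  then obtain \<delta>' where \<delta>: "\<delta> = ssym r # \<delta>'" using assms(2) by (cases \<delta>) (auto simp: fires_def)
  obtain n where n: "length (psh r) = Suc n" using 0 assms(3) by (cases "length (psh r)") auto
  show ?thesis using rule_shape[OF assms(1)]
  proof
    assume h: "ssym r = sym_I \<and> psh r = replicate (length (psh r)) sym_I"
    then have "psh r = replicate n sym_I @ [sym_I]" by (metis n replicate_Suc replicate_append_same)
    then show ?thesis using 0 \<delta> n h by (simp add: stk_def)
  next
    assume h: "ssym r = sym_Z \<and> length (psh r) > 0 \<and> psh r = replicate (length (psh r) - 1) sym_I @ [sym_Z]"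
    then have "psh r = replicate n sym_I @ [sym_Z]" using n by (metis diff_Suc_1)
    then show ?thesis using 0 \<delta> n h by (simp add: stk_def)
  qed
next
  case (Suc m)
  then have "ssym r = sym_I" using assms(2) by (simp add: fires_def)
  then have "psh r = replicate (length (psh r)) sym_I" using rule_shape[OF assms(1)] by auto
  then have "psh r @ replicate m sym_I = replicate (length (psh r) + m) sym_I"
    by (metis replicate_add)
  then show ?thesis using Suc by (simp add: stk_def add.commute)
qed

lemma enabled_stk: "enabled T (p, stk l \<delta>) = act ` {r \<in> set ru. fires (l = 0) \<delta> p r}"
  by (auto simp: enabled_def trans_stk image_iff)

lemma matches_enabled:
  "matches ru (l = 0) \<delta>1 \<delta>2 p1 p2 (\<lambda>_ _ _. True) \<longleftrightarrow> enabled T (p1, stk l \<delta>1) \<subseteq> enabled T (p2, stk l \<delta>2)"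
  unfolding matches_def enabled_stk image_subset_iff by (simp add: image_iff Ball_def Bex_def) metis

lemma simulation_levels:
  assumes sub: "\<And>l. W l \<subseteq> set ctl \<times> set ctl"
    and m: "\<And>l p1 p2. (p1, p2) \<in> W l \<Longrightarrow> matches ru (l = 0) \<delta>1 \<delta>2 p1 p2
      (\<lambda>n p1' p2'. 0 < l + n \<and> (p1', p2') \<in> W (l + n - 1))"
  shows "simulation T {((p1, stk l \<delta>1), (p2, stk l \<delta>2)) | p1 p2 l. (p1, p2) \<in> W l}"
proof (rule simulationI)
  show "{((p1, stk l \<delta>1), (p2, stk l \<delta>2)) | p1 p2 l. (p1, p2) \<in> W l} \<subseteq> states T \<times> states T"
    using sub by (fastforce simp: states_T)
next
  have "\<exists>t'. ((p2, stk l \<delta>2), a, t') \<in> transitions T \<and>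
      (s', t') \<in> {((p1, stk l \<delta>1), (p2, stk l \<delta>2)) | p1 p2 l. (p1, p2) \<in> W l}"
    if W: "(p1, p2) \<in> W l" and tr: "((p1, stk l \<delta>1), a, s') \<in> transitions T" for p1 p2 l a s'
  proof -
    obtain r where r: "r \<in> set ru" "fires (l = 0) \<delta>1 p1 r" "act r = a" "s' = (tgt r, psh r @ tl (stk l \<delta>1))"
      using tr unfolding trans_stk by blast
    obtain r' where r': "r' \<in> set ru" "fires (l = 0) \<delta>2 p2 r'" "act r' = act r"
        "0 < l + length (psh r)" "(tgt r, tgt r') \<in> W (l + length (psh r) - 1)"
      using m[OF W] r(1,2) unfolding matches_def by blast
    have len: "length (psh r') = length (psh r)" using same_length[OF r'(1) r(1) r'(3)] .
    have "s' = (tgt r, stk (l + length (psh r) - 1) \<delta>1)" using next_stk[OF r(1,2) r'(4)] r(4) by simp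
    moreover have "((p2, stk l \<delta>2), a, (tgt r', stk (l + length (psh r) - 1) \<delta>2)) \<in> transitions T"
      unfolding trans_stk using r' r(3) next_stk[OF r'(1,2)] len by auto
    ultimately show ?thesis using r'(5) by blast
  qed
  then show "\<exists>t'. (t, a, t') \<in> transitions T \<and>
      (s', t') \<in> {((p1, stk l \<delta>1), (p2, stk l \<delta>2)) | p1 p2 l. (p1, p2) \<in> W l}"
    if "(s, t) \<in> {((p1, stk l \<delta>1), (p2, stk l \<delta>2)) | p1 p2 l. (p1, p2) \<in> W l}"
      "(s, a, s') \<in> transitions T" for s t a s'
    using that by blast
qed

text \<open>A return at level zero would need an answering return, and rules on Z cannot be returns,
  so both bases would begin with I. The assumption on the bases excludes this, so matched moves
  never leave the range of levels.\<close>

lemma levels_simulation: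
  assumes sim: "simulation T S" and S: "((p1, stk l \<delta>1), (p2, stk l \<delta>2)) \<in> S"
    and \<delta>: "\<not> (\<delta>1 \<noteq> [] \<and> hd \<delta>1 = sym_I \<and> \<delta>2 \<noteq> [] \<and> hd \<delta>2 = sym_I)"
  shows "matches ru (l = 0) \<delta>1 \<delta>2 p1 p2 (\<lambda>n p1' p2'. 0 < l + n \<and>
    ((p1', stk (l + n - 1) \<delta>1), (p2', stk (l + n - 1) \<delta>2)) \<in> S)"
  unfolding matches_def
proof (intro ballI impI)
  fix r assume r: "r \<in> set ru" "fires (l = 0) \<delta>1 p1 r"
  then have "((p1, stk l \<delta>1), act r, (tgt r, psh r @ tl (stk l \<delta>1))) \<in> transitions T"
    unfolding trans_stk by blast
  then obtain t' where t': "((p2, stk l \<delta>2), act r, t') \<in> transitions T"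
      "((tgt r, psh r @ tl (stk l \<delta>1)), t') \<in> S"
    using sim S unfolding simulation_def by blast
  obtain r' where r': "r' \<in> set ru" "fires (l = 0) \<delta>2 p2 r'" "act r' = act r"
      "t' = (tgt r', psh r' @ tl (stk l \<delta>2))"
    using t'(1) unfolding trans_stk by blast
  have len: "length (psh r') = length (psh r)" using same_length[OF r'(1) r(1) r'(3)] .
  have pos: "0 < l + length (psh r)"
  proof (rule ccontr)
    assume "\<not> 0 < l + length (psh r)"
    then have "l = 0" "psh r = []" "psh r' = []" using len by auto
    then show False using rule_shape[OF r(1)] rule_shape[OF r'(1)] r(2) r'(2) \<delta> by (auto simp: fires_def)
  qed
  show "\<exists>r'\<in>set ru. fires (l = 0) \<delta>2 p2 r' \<and> act r' = act r \<and> 0 < l + length (psh r) \<and>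
      ((tgt r, stk (l + length (psh r) - 1) \<delta>1), (tgt r', stk (l + length (psh r) - 1) \<delta>2)) \<in> S"
    using r' t'(2) next_stk[OF r pos] next_stk[OF r'(1,2)] len pos by (intro bexI[of _ r']) auto
qed

end

section \<open>Relations as sequences of levels\<close>

lemma in_level_shift:
  assumes "n \<le> 2"
  shows "in_level (if l = 0 then {} else Y (l - 1)) (Y l) (Y (Suc l)) n x \<longleftrightarrow> 0 < l + n \<and> x \<in> Y (l + n - 1)"
proof -
  have "n = 0 \<or> n = 1 \<or> n = 2" using assms by auto
  then show ?thesis by (auto simp: in_level_def)
qed

lemma matches_cong:
  assumes "\<And>r x y. r \<in> set ru \<Longrightarrow> f (length (psh r)) x y \<longleftrightarrow> g (length (psh r)) x y"
  shows "matches ru b \<delta>1 \<delta>2 p q f \<longleftrightarrow> matches ru b \<delta>1 \<delta>2 p q g"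
  unfolding matches_def using assms by blast

definition universe :: "nat \<Rightarrow> name list \<Rightarrow> atom list" where
  "universe k ctl = concat (map (\<lambda>t. concat (map (\<lambda>p. map (\<lambda>q. (t, p, q)) ctl) ctl)) [0, 1, 2, 3]) @
     map (\<lambda>j. (4 + j, [], [])) [0..<Suc k]"

lemma set_universe:
  "set (universe k ctl) = {0, 1, 2, 3} \<times> set ctl \<times> set ctl \<union> (\<lambda>j. (4 + j, [], [])) ` {..k}"
  by (auto simp: universe_def image_iff simp del: upt_Suc)

text \<open>Apart from level zero, no level knows its own number. The atom
  \<open>(4 + k, [], [])\<close> is therefore placed on level zero and counts down by one per level,
  until \<open>(4, [], [])\<close> on level \<open>k\<close> demands the initial pair there.\<close>

definition level_system :: "nat \<Rightarrow> (nat \<times> nat) list \<Rightarrow> nat list \<Rightarrow> rule_data list \<Rightarrow> name list \<Rightarrow> nat \<Rightarrow>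
    counter_symbol list \<Rightarrow> counter_symbol list \<Rightarrow> name \<Rightarrow> name \<Rightarrow> (nat \<Rightarrow> atom set) \<Rightarrow> bool" where
  "level_system \<kappa> incl ini ru ctl k \<alpha> \<beta> p0 q0 Y \<longleftrightarrow>
     (\<forall>l. Y l \<subseteq> set (universe k ctl)) \<and> (4 + k, [], []) \<in> Y 0 \<and>
     (\<forall>l. local_ok \<kappa> incl ini ru \<alpha> \<beta> p0 q0 (l = 0) (if l = 0 then {} else Y (l - 1)) (Y l) (Y (Suc l)))"

context v1ca
begin

lemma relations_to_levels:
  assumes R: "relational_system \<kappa> incl ini T (p0, stk k \<alpha>) (q0, stk k \<beta>) R"
    and pq: "p0 \<in> set ctl" "q0 \<in> set ctl" and incl: "set incl \<subseteq> {..<4} \<times> {..<4}" and ini: "set ini \<subseteq> {..<4}"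
    and \<delta>: "\<not> (\<alpha> \<noteq> [] \<and> hd \<alpha> = sym_I \<and> \<beta> \<noteq> [] \<and> hd \<beta> = sym_I)"
  shows "\<exists>Y. level_system \<kappa> incl ini ru ctl k \<alpha> \<beta> p0 q0 Y"
proof -
  \<comment> \<open>The slices of the four relations at level \<open>l\<close>, with the countdown
    atom that belongs to this level if \<open>l \<le> k\<close>.\<close>
  define Y where "Y l = {(t, p, q). t \<in> {0, 1, 2, 3} \<and> p \<in> set ctl \<and> q \<in> set ctl \<and>
      ((p, stk l \<alpha>), (q, stk l \<beta>)) \<in> R t} \<union> {(4 + j, [], []) | j. j + l = k}" for l
  have Y4: "(t, p, q) \<in> Y l \<longleftrightarrow> p \<in> set ctl \<and> q \<in> set ctl \<and> ((p, stk l \<alpha>), (q, stk l \<beta>)) \<in> R t"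
    if "t \<in> {0, 1, 2, 3}" for t p q l
    using that by (auto simp: Y_def)
  have ctl: "p \<in> set ctl" "q \<in> set ctl" if "((p, x), (q, y)) \<in> R t" "t \<in> {0, 1, 2, 3}" for p q x y t
    using R that unfolding relational_system_def simulation_def states_T by auto
  have "local_ok \<kappa> incl ini ru \<alpha> \<beta> p0 q0 (l = 0) (if l = 0 then {} else Y (l - 1)) (Y l) (Y (Suc l))" for l
    unfolding local_ok_def
  proof (rule ballI)
    fix a assume a: "a \<in> Y l"
    obtain t p q where tpq: "a = (t, p, q)" by (cases a)
    let ?in = "in_level (if l = 0 then {} else Y (l - 1)) (Y l) (Y (Suc l))"
    show "if fst a \<in> set [0, 1, 2, 3] then
       (fst a \<in> set [0, 2] \<longrightarrow> matches ru (l = 0) \<alpha> \<beta> (fst (snd a)) (snd (snd a))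
          (\<lambda>n p' q'. ?in n (fst a, p', q'))) \<and>
       (fst a \<in> set [1, 3] \<longrightarrow> matches ru (l = 0) \<beta> \<alpha> (snd (snd a)) (fst (snd a))
          (\<lambda>n q' p'. ?in n (fst a, p', q'))) \<and>
       (\<kappa> = 1 \<longrightarrow> (\<exists>r\<in>set ru. fires (l = 0) \<alpha> (fst (snd a)) r) =
          (\<exists>r\<in>set ru. fires (l = 0) \<beta> (snd (snd a)) r)) \<and>
       (\<kappa> = 2 \<longrightarrow> matches ru (l = 0) \<alpha> \<beta> (fst (snd a)) (snd (snd a)) (\<lambda>_ _ _. True) \<and>
          matches ru (l = 0) \<beta> \<alpha> (snd (snd a)) (fst (snd a)) (\<lambda>_ _ _. True)) \<and>
       (\<forall>i\<in>set incl. fst i = fst a \<longrightarrow> (snd i, snd a) \<in> Y l)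
     else if fst a = 4 then \<forall>t\<in>set ini. (t, p0, q0) \<in> Y l
     else (fst a - Suc 0, [], []) \<in> Y (Suc l)"
    proof (cases "t \<in> {0, 1, 2, 3}")
      case True
      have pR: "((p, stk l \<alpha>), (q, stk l \<beta>)) \<in> R t" "p \<in> set ctl" "q \<in> set ctl"
        using a True Y4[of t p q l] unfolding tpq by blast+
      have even: "matches ru (l = 0) \<alpha> \<beta> p q (\<lambda>n p' q'. ?in n (t, p', q'))" if "t \<in> {0, 2}"
      proof -
        have "simulation T (R t)" using R that by (auto simp: relational_system_def)
        from levels_simulation[OF this pR(1) \<delta>] show ?thesis
          using in_level_shift[OF psh_le] Y4[of t] ctl[of _ _ _ _ t] True
          unfolding matches_def by (metis (no_types, lifting))
      qed
      have odd: "matches ru (l = 0) \<beta> \<alpha> q p (\<lambda>n q' p'. ?in n (t, p', q'))" if "t \<in> {1, 3}"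
      proof -
        have 1: "simulation T ((R t)\<inverse>)" using R that by (auto simp: relational_system_def)
        have 2: "((q, stk l \<beta>), (p, stk l \<alpha>)) \<in> (R t)\<inverse>" using pR(1) by simp
        from levels_simulation[OF 1 2] \<delta> show ?thesis
          using in_level_shift[OF psh_le] Y4[of t] ctl[of _ _ _ _ t] True
          unfolding matches_def converse_iff by (metis (no_types, lifting))
      qed
      have k1: "(\<exists>r\<in>set ru. fires (l = 0) \<alpha> p r) = (\<exists>r\<in>set ru. fires (l = 0) \<beta> q r)" if "\<kappa> = 1"
      proof -
        have "enabled T (p, stk l \<alpha>) = {} \<longleftrightarrow> enabled T (q, stk l \<beta>) = {}"
          using relational_system_enabled(1)[OF R pR(1)] True that by (simp add: less_4)
        then show ?thesis by (auto simp: enabled_stk)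
      qed
      have k2: "enabled T (p, stk l \<alpha>) = enabled T (q, stk l \<beta>)" if "\<kappa> = 2"
        using relational_system_enabled(2)[OF R pR(1)] True that by (simp add: less_4)
      have incl': "(snd i, p, q) \<in> Y l" if i1: "i \<in> set incl" and i2: "fst i = t" for i
      proof -
        obtain t' where i: "i = (t, t')" using i2 by (cases i) auto
        have "t' < 4" "R t \<subseteq> R t'" using R i1 incl unfolding i relational_system_def by auto
        then show ?thesis using pR Y4[of t' p q l] unfolding less_4 i by auto
      qed
      show ?thesis using True even odd k1 k2 incl' unfolding tpq matches_enabled by auto
    next
      case False
      then obtain j where j: "t = 4 + j" "p = []" "q = []" "j + l = k" using a by (auto simp: tpq Y_def)
      have "(t', p0, q0) \<in> Y l" if "j = 0" "t' \<in> set ini" for t'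
      proof -
        have "((p0, stk k \<alpha>), (q0, stk k \<beta>)) \<in> R t'" using R that(2) by (simp add: relational_system_def)
        moreover have "t' \<in> {0, 1, 2, 3}" using that(2) ini by (auto simp: less_4[symmetric])
        ultimately show ?thesis using Y4[of t' p0 q0 l] pq j(4) that(1) by simp
      qed
      moreover have "(t - Suc 0, [], []) \<in> Y (Suc l)" if "j \<noteq> 0"
        using that j by (auto simp: Y_def intro!: exI[of _ "j - 1"])
      ultimately show ?thesis using False j(1) unfolding tpq by auto
    qed
  qed
  moreover have "Y l \<subseteq> set (universe k ctl)" for l
    unfolding set_universe by (auto simp: Y_def)
  moreover have "(4 + k, [], []) \<in> Y 0" by (simp add: Y_def)
  ultimately show ?thesis unfolding level_system_def by blast
qed

lemma levels_to_relations:
  assumes Y: "level_system \<kappa> incl ini ru ctl k \<alpha> \<beta> p0 q0 Y"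
    and incl: "set incl \<subseteq> {..<4} \<times> {..<4}" and ini: "set ini \<subseteq> {..<4}"
  shows "\<exists>R. relational_system \<kappa> incl ini T (p0, stk k \<alpha>) (q0, stk k \<beta>) R"
proof -
  define R where "R t = {((p, stk l \<alpha>), (q, stk l \<beta>)) | p q l. (t, p, q) \<in> Y l}" for t
  have loc: "local_ok \<kappa> incl ini ru \<alpha> \<beta> p0 q0 (l = 0) (if l = 0 then {} else Y (l - 1)) (Y l) (Y (Suc l))" for l
    using Y by (simp add: level_system_def)
  have inU: "Y l \<subseteq> set (universe k ctl)" for l using Y by (simp add: level_system_def)
  have sub: "p \<in> set ctl \<and> q \<in> set ctl" if "(t, p, q) \<in> Y l" "t < 4" for t p q l
    using inU[of l] that unfolding set_universe by auto
  note loc4 = loc[unfolded local_ok_def, rule_format]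
  have 1: "simulation T (R t)" if t: "t \<in> {0, 2}" for t
  proof -
    define W where "W l = {(p, q). (t, p, q) \<in> Y l}" for l
    have "simulation T {((p1, stk l \<alpha>), (p2, stk l \<beta>)) | p1 p2 l. (p1, p2) \<in> W l}"
    proof (rule simulation_levels)
      show "W l \<subseteq> set ctl \<times> set ctl" for l using sub t by (fastforce simp: W_def)
      fix l p q assume "(p, q) \<in> W l"
      then have "(t, p, q) \<in> Y l" by (simp add: W_def)
      from loc4[OF this] t have "matches ru (l = 0) \<alpha> \<beta> p q (\<lambda>n p' q'.
          in_level (if l = 0 then {} else Y (l - 1)) (Y l) (Y (Suc l)) n (t, p', q'))" by auto
      then show "matches ru (l = 0) \<alpha> \<beta> p q (\<lambda>n p1' p2'. 0 < l + n \<and> (p1', p2') \<in> W (l + n - 1))"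
        by (rule iffD1[OF matches_cong, rotated]) (use in_level_shift[OF psh_le] in \<open>simp add: W_def\<close>)
    qed
    then show ?thesis by (simp add: R_def W_def)
  qed
  have 2: "simulation T ((R t)\<inverse>)" if t: "t \<in> {1, 3}" for t
  proof -
    define W where "W l = {(q, p). (t, p, q) \<in> Y l}" for l
    have "simulation T {((p1, stk l \<beta>), (p2, stk l \<alpha>)) | p1 p2 l. (p1, p2) \<in> W l}"
    proof (rule simulation_levels)
      show "W l \<subseteq> set ctl \<times> set ctl" for l using sub t by (fastforce simp: W_def)
      fix l q p assume "(q, p) \<in> W l"
      then have "(t, p, q) \<in> Y l" by (simp add: W_def)
      from loc4[OF this] t have "matches ru (l = 0) \<beta> \<alpha> q p (\<lambda>n q' p'.
          in_level (if l = 0 then {} else Y (l - 1)) (Y l) (Y (Suc l)) n (t, p', q'))" by auto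
      then show "matches ru (l = 0) \<beta> \<alpha> q p (\<lambda>n p1' p2'. 0 < l + n \<and> (p1', p2') \<in> W (l + n - 1))"
        by (rule iffD1[OF matches_cong, rotated]) (use in_level_shift[OF psh_le] in \<open>simp add: W_def\<close>)
    qed
    moreover have "(R t)\<inverse> = {((p1, stk l \<beta>), (p2, stk l \<alpha>)) | p1 p2 l. (p1, p2) \<in> W l}"
      by (auto simp: R_def W_def)
    ultimately show ?thesis by simp
  qed
  have 3: "(\<kappa> = 1 \<longrightarrow> (enabled T s = {} \<longleftrightarrow> enabled T s' = {})) \<and> (\<kappa> = 2 \<longrightarrow> enabled T s = enabled T s')"
    if t: "t < 4" and s: "(s, s') \<in> R t" for t s s'
  proof -
    obtain p q l where pq: "s = (p, stk l \<alpha>)" "s' = (q, stk l \<beta>)" "(t, p, q) \<in> Y l"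
      using s by (auto simp: R_def)
    have m: "t \<in> set [0, 1, 2, 3]" using t by (simp add: less_4)
    have "\<kappa> = 1 \<longrightarrow> (\<exists>r\<in>set ru. fires (l = 0) \<alpha> p r) = (\<exists>r\<in>set ru. fires (l = 0) \<beta> q r)"
      "\<kappa> = 2 \<longrightarrow> matches ru (l = 0) \<alpha> \<beta> p q (\<lambda>_ _ _. True) \<and> matches ru (l = 0) \<beta> \<alpha> q p (\<lambda>_ _ _. True)"
      using loc4[OF pq(3)] m by (simp_all only: fst_conv snd_conv if_True, blast+)
    then show ?thesis unfolding pq matches_enabled by (auto simp: enabled_stk)
  qed
  have 4: "R t \<subseteq> R t'" if "(t, t') \<in> set incl" for t t'
  proof -
    have "t < 4" using that incl by auto
    then have m: "t \<in> set [0, 1, 2, 3]" by (simp add: less_4)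
    have "(t', p, q) \<in> Y l" if "(t, p, q) \<in> Y l" for p q l
    proof -
      have "\<forall>i\<in>set incl. fst i = t \<longrightarrow> (snd i, p, q) \<in> Y l"
        using loc4[OF that] m by (simp only: fst_conv snd_conv if_True) blast
      then show ?thesis using \<open>(t, t') \<in> set incl\<close> by auto
    qed
    then show ?thesis unfolding R_def by blast
  qed
  have 5: "((p0, stk k \<alpha>), (q0, stk k \<beta>)) \<in> R t" if "t \<in> set ini" for t
  proof -
    have "(4 + (k - l), [], []) \<in> Y l" if "l \<le> k" for l
      using that
    proof (induction l)
      case 0
      then show ?case using Y by (simp add: level_system_def)
    next
      case (Suc l)
      obtain j where j: "k - l = Suc j" "k - Suc l = j" using Suc.prems by (cases "k - l") auto
      have "(4 + Suc j, [], []) \<in> Y l" using Suc j(1) by simp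
      from loc4[OF this] show ?case by (simp add: j(2))
    qed
    from this[of k] have "(4, [], []) \<in> Y k" by simp
    from loc4[OF this] that have "(t, p0, q0) \<in> Y k" by simp
    then show ?thesis unfolding R_def by blast
  qed
  have "relational_system \<kappa> incl ini T (p0, stk k \<alpha>) (q0, stk k \<beta>) R"
    unfolding relational_system_def
  proof (intro conjI)
    show "\<forall>t<4. \<forall>(s, s')\<in>R t. (\<kappa> = 1 \<longrightarrow> (enabled T s = {} \<longleftrightarrow> enabled T s' = {})) \<and>
        (\<kappa> = 2 \<longrightarrow> enabled T s = enabled T s')"
      using 3 by fast
  qed (use 1 2 4 5 in blast)+
  then show ?thesis by blast
qed

end

section \<open>The initial stacks and the graph of level pairs\<close>

definition strip_step :: "nat \<times> counter_symbol list \<times> counter_symbol list \<Rightarrow>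
    nat \<times> counter_symbol list \<times> counter_symbol list" where
  "strip_step s = (if fst (snd s) \<noteq> [] \<and> hd (fst (snd s)) = sym_I \<and> snd (snd s) \<noteq> [] \<and>
       hd (snd (snd s)) = sym_I
     then (Suc (fst s), tl (fst (snd s)), tl (snd (snd s))) else s)"

text \<open>The length of the first stack bounds the number of common symbols I, so a fold over it
  provides enough rounds.\<close>

definition strip :: "counter_symbol list \<Rightarrow> counter_symbol list \<Rightarrow>
    nat \<times> counter_symbol list \<times> counter_symbol list" where
  "strip \<gamma> \<eta> = foldl (\<lambda>s _. strip_step s) (0, \<gamma>, \<eta>) \<gamma>"

lemma strip_fold:
  assumes "foldl (\<lambda>s _. strip_step s) (k, \<gamma>, \<eta>) ys = (k', \<alpha>, \<beta>)"
  shows "stk k \<gamma> = stk k' \<alpha> \<and> stk k \<eta> = stk k' \<beta> \<and>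
    (length \<gamma> \<le> length ys \<longrightarrow> \<not> (\<alpha> \<noteq> [] \<and> hd \<alpha> = sym_I \<and> \<beta> \<noteq> [] \<and> hd \<beta> = sym_I))"
  using assms
proof (induction ys arbitrary: k \<gamma> \<eta>)
  case (Cons y ys)
  show ?case
  proof (cases "\<gamma> \<noteq> [] \<and> hd \<gamma> = sym_I \<and> \<eta> \<noteq> [] \<and> hd \<eta> = sym_I")
    case True
    then obtain \<gamma>' \<eta>' where g: "\<gamma> = sym_I # \<gamma>'" "\<eta> = sym_I # \<eta>'" by (metis list.collapse)
    then have "foldl (\<lambda>s _. strip_step s) (Suc k, \<gamma>', \<eta>') ys = (k', \<alpha>, \<beta>)"
      using Cons.prems by (simp add: strip_step_def)
    from Cons.IH[OF this] g show ?thesis by (simp add: stk_def replicate_app_Cons_same)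
  next
    case False
    then have "strip_step (k, \<gamma>, \<eta>) = (k, \<gamma>, \<eta>)" by (auto simp: strip_step_def)
    moreover from this have "foldl (\<lambda>s _. strip_step s) (k, \<gamma>, \<eta>) ys = (k, \<gamma>, \<eta>)"
      by (induction ys) auto
    ultimately show ?thesis using Cons.prems False by simp
  qed
qed simp

lemma sz_stk: "sz \<alpha> \<le> sz (stk k \<alpha>)" "2 * k \<le> sz (stk k \<alpha>)"
  by (induction k) (auto simp: stk_def tr_counter_symbol_def btree_def)

lemma PT_strip:
  assumes "PT f" "PT g"
  shows "PT (\<lambda>x. strip (f x) (g x))"
proof (rule PT_comp2[OF _ assms])
  show "PT (\<lambda>z. strip (fst z) (snd z))"
    unfolding strip_def
  proof (rule PT_foldl)
    show "PT (\<lambda>z :: (counter_symbol list \<times> counter_symbol list) \<times>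
        (nat \<times> counter_symbol list \<times> counter_symbol list) \<times> counter_symbol. strip_step (fst (snd z)))"
      unfolding strip_step_def by (intro PT_intros)
    show "polyb (\<lambda>n. 3 * n + 3)" by (intro polyb_intros)
    fix z :: "counter_symbol list \<times> counter_symbol list" and i
    obtain k \<alpha> \<beta> where s: "foldl (\<lambda>s _. strip_step s) (0, fst z, snd z) (take i (fst z)) = (k, \<alpha>, \<beta>)"
      by (metis prod.collapse)
    from strip_fold[OF this] have "fst z = stk k \<alpha>" "snd z = stk k \<beta>" by (auto simp: stk_def)
    then have "sz \<alpha> \<le> sz (fst z)" "sz \<beta> \<le> sz (snd z)" "2 * k \<le> sz (fst z)" using sz_stk by metis+
    then show "sz (foldl (\<lambda>s _. strip_step s) (0, fst z, snd z) (take i (fst z))) \<le> 3 * sz z + 3"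
      unfolding s by (simp add: sz_nat tr_prod_def[of z])
  qed (intro PT_intros)+
qed

text \<open>The computable counterpart of \<open>presents_v1ca\<close> and of the membership of both
  configurations, as \<open>valid_data_iff\<close> shows. Reversal gives access to the last symbol
  of a word pushed by a rule on Z, which must be Z above nothing else.\<close>

definition valid_data :: "instance_data \<Rightarrow> bool" where
  "valid_data = (\<lambda>(ctl, ca, re, it, ru, c, d).
     (\<forall>a\<in>set ca. a \<notin> set re \<and> a \<notin> set it) \<and> (\<forall>a\<in>set re. a \<notin> set it) \<and>
     fst c \<in> set ctl \<and> fst d \<in> set ctl \<and>
     (\<forall>r\<in>set ru. src r \<in> set ctl \<and> tgt r \<in> set ctl \<and>
        (act r \<in> set ca \<or> act r \<in> set re \<or> act r \<in> set it) \<and>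
        (act r \<in> set ca \<longrightarrow> length (psh r) = 2) \<and> (act r \<in> set re \<longrightarrow> length (psh r) = 0) \<and>
        (act r \<in> set it \<longrightarrow> length (psh r) = 1) \<and>
        (if ssym r = sym_I then \<forall>s\<in>set (psh r). s = sym_I
         else psh r \<noteq> [] \<and> hd (rev (psh r)) = sym_Z \<and> (\<forall>s\<in>set (tl (rev (psh r))). s = sym_I))))"

lemma UNIV_symbol: "UNIV = {sym_I, sym_Z}"
  using counter_symbol.exhaust by auto

lemma valid_data_iff:
  "valid_data (ctl, ca, re, it, ru, c, d) \<longleftrightarrow>
    (let D = data_presentation (ctl, ca, re, it, ru, c, d) in presents_v1ca D \<and>
      c \<in> configurations (presented_pda D) \<and> d \<in> configurations (presented_pda D))"
proof -
  have shape: "(\<exists>\<delta>\<in>lists {sym_I}. X = sym_I \<and> \<gamma> = \<delta> \<or> X = sym_Z \<and> \<gamma> = \<delta> @ [sym_Z]) \<longleftrightarrow>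
      (if X = sym_I then \<forall>s\<in>set \<gamma>. s = sym_I
       else \<gamma> \<noteq> [] \<and> hd (rev \<gamma>) = sym_Z \<and> (\<forall>s\<in>set (tl (rev \<gamma>)). s = sym_I))"
    for X and \<gamma> :: "counter_symbol list"
  proof (cases X)
    case sym_Z
    have "(\<exists>\<delta>\<in>lists {sym_I}. \<gamma> = \<delta> @ [sym_Z]) \<longleftrightarrow>
        \<gamma> \<noteq> [] \<and> hd (rev \<gamma>) = sym_Z \<and> (\<forall>s\<in>set (tl (rev \<gamma>)). s = sym_I)"
      by (cases \<gamma> rule: rev_cases) (auto simp: in_lists_conv_set)
    then show ?thesis using sym_Z by simp
  qed (auto simp: in_lists_conv_set)
  have fin: "finite (UNIV :: counter_symbol set)" by (simp add: UNIV_symbol)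
  show ?thesis
    unfolding valid_data_def presents_v1ca_def visibly_one_counter_automaton_def
      one_counter_automaton_def visibly_pushdown_def pushdown_automaton_def presented_pda_def
      data_presentation_def configurations_def Let_def shape
    by (simp add: UNIV_symbol[symmetric] case_prod_beta ball_conj_distrib disjoint_iff mem_Times_iff shape
        fin, unfold Ball_def) (rule iffI; elim conjE; intro conjI; assumption)
qed

lemma PT_valid_data: "PT valid_data"
  unfolding valid_data_def case_prod_beta' by (intro PT_intros)

lemma PT_local_ok:
  assumes "PT ru" "PT \<alpha>" "PT \<beta>" "PT p0" "PT q0" "PT zt" "PT A" "PT B" "PT C"
  shows "PT (\<lambda>e. local_ok \<kappa> incl ini (ru e) (\<alpha> e) (\<beta> e) (p0 e) (q0 e) (zt e)
    (set (A e)) (set (B e)) (set (C e)))"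
  unfolding local_ok_def matches_def fires_def in_level_def
  by (intro PT_intros PT_comp[OF assms(1)] PT_comp[OF assms(2)] PT_comp[OF assms(3)]
      PT_comp[OF assms(4)] PT_comp[OF assms(5)] PT_comp[OF assms(6)] PT_comp[OF assms(7)]
      PT_comp[OF assms(8)] PT_comp[OF assms(9)])

text \<open>The input word is kept because validity includes that encoding the parsed data gives
  this word back; the last component holds the level and the bases of the stripped stacks.\<close>

type_synonym env = "bool list \<times> instance_data \<times> (nat \<times> counter_symbol list \<times> counter_symbol list)"

abbreviation "e_word (e :: env) \<equiv> fst e"
abbreviation "e_data (e :: env) \<equiv> fst (snd e)"
abbreviation "e_level (e :: env) \<equiv> fst (snd (snd e))"
abbreviation "e_alpha (e :: env) \<equiv> fst (snd (snd (snd e)))"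
abbreviation "e_beta (e :: env) \<equiv> snd (snd (snd (snd e)))"
abbreviation "d_ctl (x :: instance_data) \<equiv> fst x"
abbreviation "d_rules (x :: instance_data) \<equiv> fst (snd (snd (snd (snd x))))"
abbreviation "d_left (x :: instance_data) \<equiv> fst (snd (snd (snd (snd (snd x)))))"
abbreviation "d_right (x :: instance_data) \<equiv> snd (snd (snd (snd (snd (snd x)))))"

text \<open>A node consists of two consecutive levels, the lower one tagged with \<open>False\<close>.\<close>

definition lower :: "(bool \<times> 'u) list \<Rightarrow> 'u list" where
  "lower xs = map snd (filter (\<lambda>x. \<not> fst x) xs)"

definition upper :: "(bool \<times> 'u) list \<Rightarrow> 'u list" where
  "upper xs = map snd (filter fst xs)"

lemma set_lower: "set (lower xs) = {u. (False, u) \<in> set xs}"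
  and set_upper: "set (upper xs) = {u. (True, u) \<in> set xs}"
  by (auto simp: lower_def upper_def image_iff)

lemma PT_lower: "PT f \<Longrightarrow> PT (\<lambda>x. lower (f x :: (bool \<times> 'u::encodable) list))"
  unfolding lower_def by (intro PT_intros)

lemma PT_upper: "PT f \<Longrightarrow> PT (\<lambda>x. upper (f x :: (bool \<times> 'u::encodable) list))"
  unfolding upper_def by (intro PT_intros)

lemma PT_universe:
  assumes "PT f" "PT g"
  shows "PT (\<lambda>x. universe (f x) (g x))"
  unfolding universe_def by (intro PT_intros PT_comp[OF assms(1)] PT_comp[OF assms(2)])

definition local_env :: "nat \<Rightarrow> (nat \<times> nat) list \<Rightarrow> nat list \<Rightarrow> env \<Rightarrow> bool \<Rightarrow>
    atom set \<Rightarrow> atom set \<Rightarrow> atom set \<Rightarrow> bool" where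
  "local_env \<kappa> incl ini e = local_ok \<kappa> incl ini (d_rules (e_data e)) (e_alpha e) (e_beta e)
     (fst (d_left (e_data e))) (fst (d_right (e_data e)))"

text \<open>The conditions relate three consecutive levels, an edge only two nodes. As adjacent
  nodes overlap in one level, an edge covers three levels, provided that it checks that the shared
  level agrees. The lowest level is treated by \<open>start\<close>, with an empty set in place of
  the level below.\<close>

lemma level_system_PSPACE:
  "{w. let x = parse_data w; s = strip (snd (d_left x)) (snd (d_right x)) in
      enc_data x = w \<and> valid_data x \<and>
      (\<exists>Y. level_system \<kappa> incl ini (d_rules x) (d_ctl x) (fst s) (fst (snd s)) (snd (snd s))
        (fst (d_left x)) (fst (d_right x)) Y)} \<in> PSPACE" (is "?L \<in> PSPACE")
proof -
  define env :: "bool list \<Rightarrow> env" where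
    "env w = (w, parse_data w, strip (snd (d_left (parse_data w))) (snd (d_right (parse_data w))))" for w
  define valid where "valid e \<longleftrightarrow> enc_data (e_data e) = e_word e \<and> valid_data (e_data e)" for e
  define U where "U e = universe (e_level e) (d_ctl (e_data e))" for e
  define Us where "Us e = map (Pair False) (U e) @ map (Pair True) (U e)" for e
  let ?loc = "local_env \<kappa> incl ini"
  define start where "start e xs \<longleftrightarrow> (4 + e_level e, [], []) \<in> set (lower xs) \<and>
      ?loc e True (set []) (set (lower xs)) (set (upper xs))" for e and xs :: "(bool \<times> atom) list"
  define edge where "edge e xs ys \<longleftrightarrow> (\<forall>u\<in>set (U e). (u \<in> set (upper xs)) = (u \<in> set (lower ys))) \<and>
      ?loc e False (set (lower xs)) (set (upper xs)) (set (upper ys))" for e and xs ys :: "(bool \<times> atom) list"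
  define start' where "start' e X \<longleftrightarrow> (False, 4 + e_level e, [], []) \<in> X \<and>
      ?loc e True {} {u. (False, u) \<in> X} {u. (True, u) \<in> X}" for e and X :: "(bool \<times> atom) set"
  define edge' where "edge' e X X' \<longleftrightarrow> (\<forall>u\<in>set (U e). ((True, u) \<in> X) = ((False, u) \<in> X')) \<and>
      ?loc e False {u. (False, u) \<in> X} {u. (True, u) \<in> X} {u. (True, u) \<in> X'}"
    for e and X X' :: "(bool \<times> atom) set"
  have PTU: "PT U" unfolding U_def by (intro PT_universe PT_intros)
  have "{w. valid (env w) \<and> (\<exists>\<sigma>. (\<forall>i. \<sigma> i \<subseteq> set (Us (env w))) \<and> start' (env w) (\<sigma> 0) \<and>
    (\<forall>i. edge' (env w) (\<sigma> i) (\<sigma> (Suc i))))} \<in> PSPACE"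
  proof (rule PSPACE_subset_paths)
    show "PT env" unfolding env_def by (intro PT_intros PT_strip PT_comp[OF PT_parse_data])
    show "PT valid" unfolding valid_def
      by (intro PT_intros PT_comp[OF PT_enc_data] PT_comp[OF PT_valid_data])
    show "PT Us" unfolding Us_def by (intro PT_intros PT_comp[OF PTU])
    show "PT (\<lambda>z. start (fst z) (snd z))"
      unfolding start_def local_env_def by (intro PT_local_ok PT_intros PT_lower PT_upper)
    show "PT (\<lambda>z. edge (fst z) (fst (snd z)) (snd (snd z)))"
      unfolding edge_def local_env_def
      by (intro PT_local_ok PT_intros PT_lower PT_upper PT_comp[OF PTU])
    show "Us e \<noteq> []" for e by (simp add: Us_def U_def universe_def)
    show "start e xs \<longleftrightarrow> start' e (set xs)" for e xs
      unfolding start_def start'_def set_lower set_upper by simp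
    show "edge e xs ys \<longleftrightarrow> edge' e (set xs) (set ys)" for e xs ys
      unfolding edge_def edge'_def set_lower set_upper by simp
  qed
  also have "{w. valid (env w) \<and> (\<exists>\<sigma>. (\<forall>i. \<sigma> i \<subseteq> set (Us (env w))) \<and> start' (env w) (\<sigma> 0) \<and>
    (\<forall>i. edge' (env w) (\<sigma> i) (\<sigma> (Suc i))))} = ?L"
  proof (rule Collect_cong)
    fix w
    define e where "e = env w"
    let ?ls = "level_system \<kappa> incl ini (d_rules (e_data e)) (d_ctl (e_data e)) (e_level e) (e_alpha e)
      (e_beta e) (fst (d_left (e_data e))) (fst (d_right (e_data e)))"
    have "(\<exists>\<sigma>. (\<forall>i. \<sigma> i \<subseteq> set (Us e)) \<and> start' e (\<sigma> 0) \<and> (\<forall>i. edge' e (\<sigma> i) (\<sigma> (Suc i)))) \<longleftrightarrow> (\<exists>Y. ?ls Y)"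
    proof
      assume "\<exists>\<sigma>. (\<forall>i. \<sigma> i \<subseteq> set (Us e)) \<and> start' e (\<sigma> 0) \<and> (\<forall>i. edge' e (\<sigma> i) (\<sigma> (Suc i)))"
      then obtain \<sigma> where s: "\<And>i. \<sigma> i \<subseteq> set (Us e)" "start' e (\<sigma> 0)" "\<And>i. edge' e (\<sigma> i) (\<sigma> (Suc i))" by blast
      define Y where "Y i = {u. (False, u) \<in> \<sigma> i}" for i
      have YU: "Y i \<subseteq> set (U e)" for i using s(1)[of i] by (auto simp: Y_def Us_def)
      \<comment> \<open>Agreement on the overlap turns the sets \<open>\<sigma> i\<close> into a
        single sequence of levels.\<close>
      have up: "{u. (True, u) \<in> \<sigma> i} = Y (Suc i)" for i
      proof -
        have "{u. (True, u) \<in> \<sigma> i} \<subseteq> set (U e)" using s(1)[of i] by (auto simp: Us_def)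
        then show ?thesis using s(3)[of i] YU[of "Suc i"] by (auto simp: edge'_def Y_def)
      qed
      have loc: "?loc e (l = 0) (if l = 0 then {} else Y (l - 1)) (Y l) (Y (Suc l))" for l
      proof (cases l)
        case 0
        then show ?thesis using s(2) up[of 0] by (simp add: start'_def Y_def)
      next
        case (Suc i)
        then show ?thesis using s(3)[of i] unfolding edge'_def up by (simp add: Y_def)
      qed
      then have "?ls Y"
        unfolding level_system_def using YU s(2) unfolding U_def local_env_def start'_def by (simp add: Y_def)
      then show "\<exists>Y. ?ls Y" by blast
    next
      assume "\<exists>Y. ?ls Y"
      then obtain Y where Y: "?ls Y" ..
      define \<sigma> where "\<sigma> i = Pair False ` Y i \<union> Pair True ` Y (Suc i)" for i
      have YU: "Y i \<subseteq> set (U e)" for i using Y by (simp add: level_system_def U_def)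
      have loc: "?loc e (l = 0) (if l = 0 then {} else Y (l - 1)) (Y l) (Y (Suc l))" for l
        using Y by (simp add: level_system_def local_env_def)
      have sets: "{u. (False, u) \<in> \<sigma> i} = Y i" "{u. (True, u) \<in> \<sigma> i} = Y (Suc i)" for i
        by (auto simp: \<sigma>_def)
      have mem: "(True, u) \<in> \<sigma> i \<longleftrightarrow> u \<in> Y (Suc i)" "(False, u) \<in> \<sigma> i \<longleftrightarrow> u \<in> Y i" for i u
        by (auto simp: \<sigma>_def)
      have "\<sigma> i \<subseteq> set (Us e)" for i using YU[of i] YU[of "Suc i"] by (auto simp: \<sigma>_def Us_def)
      moreover have "start' e (\<sigma> 0)"
        using Y loc[of 0] unfolding start'_def sets mem by (simp add: level_system_def)
      moreover have "edge' e (\<sigma> i) (\<sigma> (Suc i))" for i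
        using loc[of "Suc i"] unfolding edge'_def sets mem by simp
      ultimately show "\<exists>\<sigma>. (\<forall>i. \<sigma> i \<subseteq> set (Us e)) \<and> start' e (\<sigma> 0) \<and> (\<forall>i. edge' e (\<sigma> i) (\<sigma> (Suc i)))" by blast
    qed
    then show "(valid (env w) \<and> (\<exists>\<sigma>. (\<forall>i. \<sigma> i \<subseteq> set (Us (env w))) \<and> start' (env w) (\<sigma> 0) \<and>
        (\<forall>i. edge' (env w) (\<sigma> i) (\<sigma> (Suc i))))) \<longleftrightarrow>
      (let x = parse_data w; s = strip (snd (d_left x)) (snd (d_right x)) in
      enc_data x = w \<and> valid_data x \<and>
      (\<exists>Y. level_system \<kappa> incl ini (d_rules x) (d_ctl x) (fst s) (fst (snd s)) (snd (snd s))
        (fst (d_left x)) (fst (d_right x)) Y))"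
      unfolding e_def[symmetric] by (simp add: valid_def e_def env_def Let_def)
  qed
  finally show ?thesis .
qed

theorem v1ca_problem_PSPACE:
  assumes rel: "\<And>T c d. rel T c d \<longleftrightarrow> (\<exists>R. relational_system \<kappa> incl ini T c d R)"
    and incl: "set incl \<subseteq> {..<4} \<times> {..<4}" and ini: "set ini \<subseteq> {..<4}"
  shows "v1ca_problem rel \<in> PSPACE"
proof -
  define Ls where "Ls x \<longleftrightarrow> (let s = strip (snd (d_left x)) (snd (d_right x)) in
      (\<exists>Y. level_system \<kappa> incl ini (d_rules x) (d_ctl x) (fst s) (fst (snd s)) (snd (snd s))
        (fst (d_left x)) (fst (d_right x)) Y))" for x
  have key: "rel (pda_lts (presented_pda (data_presentation x))) (d_left x) (d_right x) \<longleftrightarrow> Ls x"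
    if v: "valid_data x" for x
  proof -
    obtain ctl ca re it ru p0 \<gamma> q0 \<eta> where x: "x = (ctl, ca, re, it, ru, (p0, \<gamma>), (q0, \<eta>))"
      by (metis prod.collapse)
    let ?D = "data_presentation x"
    have pres: "presents_v1ca ?D" and pq: "p0 \<in> set ctl" "q0 \<in> set ctl"
      using v unfolding x valid_data_iff Let_def
      by (auto simp: configurations_def presented_pda_def data_presentation_def)
    interpret v1ca ?D by standard (rule pres)
    obtain k \<alpha> \<beta> where s: "strip \<gamma> \<eta> = (k, \<alpha>, \<beta>)" by (metis prod.collapse)
    have st: "\<gamma> = stk k \<alpha>" "\<eta> = stk k \<beta>" "\<not> (\<alpha> \<noteq> [] \<and> hd \<alpha> = sym_I \<and> \<beta> \<noteq> [] \<and> hd \<beta> = sym_I)"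
      using strip_fold[OF s[unfolded strip_def]] by (auto simp: stk_def)
    have D: "rule_list ?D = ru" "control_list ?D = ctl" by (simp_all add: x data_presentation_def)
    have "rel T (p0, \<gamma>) (q0, \<eta>) \<longleftrightarrow> (\<exists>Y. level_system \<kappa> incl ini ru ctl k \<alpha> \<beta> p0 q0 Y)"
      unfolding rel st(1,2)
      using relations_to_levels[of \<kappa> incl ini p0 k \<alpha> q0 \<beta>] levels_to_relations[of \<kappa> incl ini k \<alpha> \<beta> p0 q0]
        incl ini st(3) pq unfolding D by blast
    then show ?thesis by (simp add: Ls_def x s)
  qed
  have "v1ca_problem rel = {w. enc_data (parse_data w) = w \<and> valid_data (parse_data w) \<and> Ls (parse_data w)}"
  proof (intro equalityI subsetI)
    fix w assume "w \<in> v1ca_problem rel"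
    then obtain D c d where D: "w = enc_instance D c d" "presents_v1ca D"
        "c \<in> configurations (presented_pda D)" "d \<in> configurations (presented_pda D)"
        "rel (pda_lts (presented_pda D)) c d"
      by (auto simp: v1ca_problem_def)
    define x where "x = (control_list D, call_list D, return_list D, internal_list D, rule_list D, c, d)"
    have dp: "data_presentation x = D" by (simp add: x_def data_presentation_def)
    have w: "w = enc_data x" using D(1) dp by (simp add: x_def enc_data_eq)
    have v: "valid_data x" using D(2-4) dp unfolding x_def valid_data_iff by (simp add: Let_def)
    moreover have "Ls x" using key[OF v] D(5) dp by (simp add: x_def)
    ultimately show "w \<in> {w. enc_data (parse_data w) = w \<and> valid_data (parse_data w) \<and> Ls (parse_data w)}"
      by (simp add: w parse_enc_data)
  next
    fix w assume "w \<in> {w. enc_data (parse_data w) = w \<and> valid_data (parse_data w) \<and> Ls (parse_data w)}"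
    then have w: "enc_data (parse_data w) = w" "valid_data (parse_data w)" "Ls (parse_data w)" by auto
    obtain ctl ca re it ru c d where x: "parse_data w = (ctl, ca, re, it, ru, c, d)" by (metis prod.collapse)
    have "w = enc_instance (data_presentation (parse_data w)) c d" using w(1) unfolding x enc_data_eq ..
    moreover have "rel (pda_lts (presented_pda (data_presentation (parse_data w)))) c d"
      using key[OF w(2)] w(3) by (simp add: x)
    ultimately show "w \<in> v1ca_problem rel"
      using w(2) unfolding v1ca_problem_def x valid_data_iff Let_def by blast
  qed
  then show ?thesis using level_system_PSPACE[of \<kappa> incl ini] by (simp add: Ls_def Let_def)
qed

section \<open>Boolean systems as games\<close>

type_synonym clause = "nat list \<times> nat list list"

text \<open>A monotone Boolean system evaluated synchronously: clauses with the same head are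
  alternatives, the body of a clause is a conjunction. Values are recomputed at every step, so a
  variable true at time \<open>n\<close> may be false at \<open>n + 1\<close>, as needed for
  describing a changing machine configuration.\<close>

fun true_at :: "nat list list \<Rightarrow> clause list \<Rightarrow> nat \<Rightarrow> nat list set" where
  "true_at V0 Cl 0 = set V0"
| "true_at V0 Cl (Suc n) = {a. \<exists>bs. (a, bs) \<in> set Cl \<and> set bs \<subseteq> true_at V0 Cl n}"

text \<open>The detour via \<open>replicate\<close> matches the form in which unary words are known
  to be computable in polynomial time.\<close>

definition unary :: "nat \<Rightarrow> bool list" where
  "unary n = map (\<lambda>_. True) (replicate n False) @ [False]"

definition nm :: "nat list list \<Rightarrow> name" where
  "nm = enc_list (enc_list unary)"

lemma unary_simps: "unary 0 = [False]" "unary (Suc n) = True # unary n"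
  by (simp_all add: unary_def)

lemma self_delimiting_unary: "self_delimiting unary"
proof -
  have "unary x @ u = unary y @ v \<longrightarrow> x = y \<and> u = v" for x y u v
  proof (induction x arbitrary: y)
    case 0
    show ?case by (cases y) (simp_all add: unary_simps)
  next
    case (Suc x)
    show ?case using Suc.IH by (cases y) (simp_all add: unary_simps)
  qed
  then show ?thesis unfolding self_delimiting_def by blast
qed

lemma nm_inj [simp]: "nm x = nm y \<longleftrightarrow> x = y"
  using self_delimitingD[OF self_delimiting_enc_list[OF self_delimiting_enc_list[OF self_delimiting_unary]],
      of x "[]" y "[]"] by (simp add: nm_def)

lemma PT_nm: "PT nm"
proof -
  have "PT unary" unfolding unary_def by (intro PT_intros PT_replicate_False)
  then show ?thesis unfolding nm_def by (intro PT_enc_list)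
qed

text \<open>The attacker claims that a variable is true at the time given by the counter: it chooses a
  clause, the defender chooses a variable of this clause, and the counter is decremented. The choice of
  the defender is implemented by defender's forcing: every other move leads to identical
  configurations. The attacker's claim is checked at time 0 and the counter is set by the attacker.\<close>

definition c_start :: name where "c_start = nm [[5]]"
definition c_start' :: name where "c_start' = nm [[6]]"
definition c_left :: "nat list \<Rightarrow> name" where "c_left a = nm [[0], a]"
definition c_right :: "nat list \<Rightarrow> name" where "c_right a = nm [[1], a]"
definition c_ask :: "clause \<Rightarrow> name" where "c_ask z = nm ([2] # fst z # snd z)"
definition c_pick :: "nat list \<Rightarrow> clause \<Rightarrow> name" where "c_pick b z = nm ([3] # b # fst z # snd z)"

definition a_call :: name where "a_call = nm [[0]]"
definition a_claim :: name where "a_claim = nm [[1]]"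
definition a_zero :: name where "a_zero = nm [[4]]"
definition a_clause :: "clause \<Rightarrow> name" where "a_clause z = nm ([2] # fst z # snd z)"
definition a_ret :: "nat list \<Rightarrow> name" where "a_ret b = nm [[3], b]"

lemmas name_defs = c_start_def c_start'_def c_left_def c_right_def c_ask_def c_pick_def
  a_call_def a_claim_def a_zero_def a_clause_def a_ret_def

definition start_rules :: "nat list \<Rightarrow> rule_data list" where
  "start_rules g = concat (map (\<lambda>X. [(c_start, X, a_call, c_start, [sym_I, X]),
     (c_start', X, a_call, c_start', [sym_I, X]), (c_start, X, a_claim, c_left g, [X]),
     (c_start', X, a_claim, c_right g, [X])]) [sym_I, sym_Z])"

text \<open>Only the left side has this move, so at counter zero a true variable is exposed by an
  action that the right side cannot answer.\<close>

definition zero_rules :: "nat list list \<Rightarrow> rule_data list" where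
  "zero_rules V0 = map (\<lambda>a. (c_left a, sym_Z, a_zero, c_left a, [sym_Z])) V0"

text \<open>From a left state the attacker moves to \<open>c_ask z\<close>, which no right state can
  enter; the right side answers with some \<open>c_pick b z\<close>, and this is its choice of
  \<open>b\<close>. The left side can enter the same \<open>c_pick b z\<close>, which makes attacker
  moves on the right side worthless. After the choice, \<open>a_ret b\<close> leads on to the claim
  for \<open>b\<close>, while any other \<open>a_ret c\<close> leads both sides to
  \<open>c_left c\<close>. An empty clause admits no answer, in accordance with its body being
  true.\<close>

definition clause_rules :: "clause \<Rightarrow> rule_data list" where
  "clause_rules z = (c_left (fst z), sym_I, a_clause z, c_ask z, [sym_I]) #
     concat (map (\<lambda>b. [(c_left (fst z), sym_I, a_clause z, c_pick b z, [sym_I]),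
        (c_right (fst z), sym_I, a_clause z, c_pick b z, [sym_I]),
        (c_ask z, sym_I, a_ret b, c_left b, []), (c_pick b z, sym_I, a_ret b, c_right b, [])] @
        map (\<lambda>c. (c_pick b z, sym_I, a_ret c, c_left c, [])) (filter (\<lambda>c. c \<noteq> b) (snd z))) (snd z))"

definition clause_controls :: "clause \<Rightarrow> name list" where
  "clause_controls z = [c_left (fst z), c_right (fst z), c_ask z] @
     concat (map (\<lambda>b. [c_left b, c_right b, c_pick b z]) (snd z))"

definition game :: "nat list \<Rightarrow> nat list list \<Rightarrow> clause list \<Rightarrow> instance_data" where
  "game g V0 Cl = ([c_start, c_start', c_left g, c_right g] @ map c_left V0 @ concat (map clause_controls Cl),
     [a_call], concat (map (\<lambda>z. map a_ret (snd z)) Cl), [a_claim, a_zero] @ map a_clause Cl,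
     start_rules g @ zero_rules V0 @ concat (map clause_rules Cl), (c_start, [sym_Z]), (c_start', [sym_Z]))"

lemma PT_c_pick:
  assumes "PT f" "PT h"
  shows "PT (\<lambda>x. c_pick (f x) (h x))"
  unfolding c_pick_def by (intro PT_comp[OF PT_nm] PT_intros PT_comp[OF assms(1)] PT_comp[OF assms(2)])

lemma PT_game:
  assumes "PT V0" "PT Cl"
  shows "PT (\<lambda>x. game g (V0 x) (Cl x))"
proof -
  have n: "PT c_left" "PT c_right" "PT a_ret" "PT c_ask" "PT a_clause"
    unfolding name_defs by (intro PT_comp[OF PT_nm] PT_intros)+
  have r: "PT clause_rules" unfolding clause_rules_def
    by (intro PT_intros PT_comp[OF n(1)] PT_comp[OF n(2)] PT_comp[OF n(3)] PT_comp[OF n(4)]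
        PT_comp[OF n(5)] PT_c_pick)
  have c: "PT clause_controls" unfolding clause_controls_def
    by (intro PT_intros PT_comp[OF n(1)] PT_comp[OF n(2)] PT_comp[OF n(4)] PT_c_pick)
  show ?thesis unfolding game_def zero_rules_def
    by (intro PT_intros PT_comp[OF n(1)] PT_comp[OF n(3)] PT_comp[OF n(5)] PT_comp[OF r] PT_comp[OF c]
        PT_comp[OF assms(1)] PT_comp[OF assms(2)])
qed

lemma ruleE:
  assumes "r \<in> set (start_rules g @ zero_rules V0 @ concat (map clause_rules Cl))"
  obtains (call) X where "r = (c_start, X, a_call, c_start, [sym_I, X])"
  | (call') X where "r = (c_start', X, a_call, c_start', [sym_I, X])"
  | (claim) X where "r = (c_start, X, a_claim, c_left g, [X])"
  | (claim') X where "r = (c_start', X, a_claim, c_right g, [X])"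
  | (zero) a where "a \<in> set V0" "r = (c_left a, sym_Z, a_zero, c_left a, [sym_Z])"
  | (ask) z where "z \<in> set Cl" "r = (c_left (fst z), sym_I, a_clause z, c_ask z, [sym_I])"
  | (pick) z b where "z \<in> set Cl" "b \<in> set (snd z)" "r = (c_left (fst z), sym_I, a_clause z, c_pick b z, [sym_I])"
  | (pick') z b where "z \<in> set Cl" "b \<in> set (snd z)" "r = (c_right (fst z), sym_I, a_clause z, c_pick b z, [sym_I])"
  | (ret) z b where "z \<in> set Cl" "b \<in> set (snd z)" "r = (c_ask z, sym_I, a_ret b, c_left b, [])"
  | (ret') z b where "z \<in> set Cl" "b \<in> set (snd z)" "r = (c_pick b z, sym_I, a_ret b, c_right b, [])"
  | (ret_same) z b c where "z \<in> set Cl" "b \<in> set (snd z)" "c \<in> set (snd z)" "c \<noteq> b"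
      "r = (c_pick b z, sym_I, a_ret c, c_left c, [])"
proof -
  consider "r \<in> set (start_rules g)" | "r \<in> set (zero_rules V0)"
    | z where "z \<in> set Cl" "r \<in> set (clause_rules z)"
    using assms by auto
  then show thesis
  proof cases
    case 1
    then obtain X where "r \<in> set [(c_start, X, a_call, c_start, [sym_I, X]),
        (c_start', X, a_call, c_start', [sym_I, X]), (c_start, X, a_claim, c_left g, [X]),
        (c_start', X, a_claim, c_right g, [X])]"
      unfolding start_rules_def set_concat set_map by blast
    then show thesis using call call' claim claim' by (simp only: list.set insert_iff empty_iff) blast
  next
    case 2
    then show thesis using zero unfolding zero_rules_def by auto
  next
    case (3 z)
    have 1: "y \<in> set (x # concat (map f ys)) \<longleftrightarrow> y = x \<or> (\<exists>b\<in>set ys. y \<in> set (f b))"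
      for y x :: rule_data and f and ys :: "nat list list" by auto
    have 2: "y \<in> set ([x1, x2, x3, x4] @ map f (filter p ys)) \<longleftrightarrow>
        y = x1 \<or> y = x2 \<or> y = x3 \<or> y = x4 \<or> (\<exists>c\<in>set ys. p c \<and> y = f c)"
      for y x1 x2 x3 x4 :: rule_data and f p and ys :: "nat list list" by auto
    show thesis
      using 3(2) ask[OF 3(1)] pick[OF 3(1)] pick'[OF 3(1)] ret[OF 3(1)] ret'[OF 3(1)] ret_same[OF 3(1)]
      unfolding clause_rules_def 1 2 by blast
  qed
qed

lemma clause_ctl:
  assumes "z \<in> set Cl" "ctl = fst (game g V0 Cl)"
  shows "c_ask z \<in> set ctl" "c_left (fst z) \<in> set ctl" "c_right (fst z) \<in> set ctl"
    "b \<in> set (snd z) \<Longrightarrow> c_pick b z \<in> set ctl"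
    "b \<in> set (snd z) \<Longrightarrow> c_left b \<in> set ctl" "b \<in> set (snd z) \<Longrightarrow> c_right b \<in> set ctl"
proof -
  have "set (clause_controls z) \<subseteq> set ctl" using assms by (auto simp: game_def)
  then show "c_ask z \<in> set ctl" "c_left (fst z) \<in> set ctl" "c_right (fst z) \<in> set ctl"
    "b \<in> set (snd z) \<Longrightarrow> c_pick b z \<in> set ctl"
    "b \<in> set (snd z) \<Longrightarrow> c_left b \<in> set ctl" "b \<in> set (snd z) \<Longrightarrow> c_right b \<in> set ctl"
    by (auto simp: clause_controls_def)
qed

lemma valid_game: "valid_data (game g V0 Cl)"
proof -
  define ctl where "ctl = fst (game g V0 Cl)"
  define re where "re = concat (map (\<lambda>z. map a_ret (snd z)) Cl)"
  define it where "it = [a_claim, a_zero] @ map a_clause Cl"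
  let ?ru = "start_rules g @ zero_rules V0 @ concat (map clause_rules Cl)"
  note cc = clause_ctl[OF _ ctl_def]
  have base: "c_start \<in> set ctl" "c_start' \<in> set ctl" "c_left g \<in> set ctl" "c_right g \<in> set ctl"
    "\<And>a. a \<in> set V0 \<Longrightarrow> c_left a \<in> set ctl"
    by (auto simp: ctl_def game_def)
  have re: "a_ret b \<in> set re" if "z \<in> set Cl" "b \<in> set (snd z)" for z b using that by (auto simp: re_def)
  have nre: "a_call \<notin> set re" "a_claim \<notin> set re" "a_zero \<notin> set re" "a_clause z \<notin> set re" for z
    by (auto simp: re_def name_defs)
  have it: "a_claim \<in> set it" "a_zero \<in> set it" "z \<in> set Cl \<Longrightarrow> a_clause z \<in> set it" for z
    by (auto simp: it_def)
  have nit: "a_call \<notin> set it" "a_ret b \<notin> set it" for b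
    by (auto simp: it_def name_defs)
  have nca: "a_claim \<noteq> a_call" "a_zero \<noteq> a_call" "a_clause z \<noteq> a_call" "a_ret b \<noteq> a_call" for z b
    by (auto simp: name_defs)
  have X: "X \<noteq> sym_I \<Longrightarrow> X = sym_Z" for X by (cases X) auto
  have ok: "src r \<in> set ctl \<and> tgt r \<in> set ctl \<and>
        (act r \<in> set [a_call] \<or> act r \<in> set re \<or> act r \<in> set it) \<and>
        (act r \<in> set [a_call] \<longrightarrow> length (psh r) = 2) \<and> (act r \<in> set re \<longrightarrow> length (psh r) = 0) \<and>
        (act r \<in> set it \<longrightarrow> length (psh r) = 1) \<and>
        (if ssym r = sym_I then \<forall>s\<in>set (psh r). s = sym_I
         else psh r \<noteq> [] \<and> hd (rev (psh r)) = sym_Z \<and> (\<forall>s\<in>set (tl (rev (psh r))). s = sym_I))"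
    if "r \<in> set ?ru" for r
    using that by (cases rule: ruleE) (simp_all add: base cc re nre it nit nca X)
  have eq: "game g V0 Cl = (ctl, [a_call], re, it, ?ru, (c_start, [sym_Z]), (c_start', [sym_Z]))"
    by (simp add: game_def ctl_def re_def it_def)
  show ?thesis
    unfolding valid_data_def eq prod.case
  proof (intro conjI)
    show "\<forall>a\<in>set re. a \<notin> set it" using nit by (auto simp: re_def)
    show "\<forall>a\<in>set [a_call]. a \<notin> set re \<and> a \<notin> set it" using nre nit by simp
  qed (use base ok in \<open>simp_all only: fst_conv, blast\<close>)
qed

section \<open>Correctness of the game\<close>

locale game_automaton =
  fixes g :: "nat list" and V0 :: "nat list list" and Cl :: "clause list"
begin

definition "D = data_presentation (game g V0 Cl)"

sublocale v1ca D
proof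
  show "presents_v1ca D"
    using valid_game[of g V0 Cl] unfolding game_def D_def valid_data_iff Let_def by blast
qed

abbreviation "V \<equiv> true_at V0 Cl"

lemma ru_eq: "ru = start_rules g @ zero_rules V0 @ concat (map clause_rules Cl)"
  by (simp add: D_def game_def data_presentation_def)

lemma ctl_eq: "ctl = [c_start, c_start', c_left g, c_right g] @ map c_left V0 @ concat (map clause_controls Cl)"
  by (simp add: D_def game_def data_presentation_def)

lemma ctl_game: "ctl = fst (game g V0 Cl)"
  by (simp add: D_def game_def data_presentation_def)

abbreviation "st n \<equiv> stk n [sym_Z]"

lemma st_simps: "st 0 = [sym_Z]" "st (Suc n) = sym_I # st n" "st n \<noteq> []"
  by (auto simp: stk_def)

lemmas ruleE = ruleE[of _ g V0 Cl, folded ru_eq]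

lemma rule_in:
  "(c_start, X, a_call, c_start, [sym_I, X]) \<in> set ru"
  "(c_start', X, a_call, c_start', [sym_I, X]) \<in> set ru"
  "(c_start, X, a_claim, c_left g, [X]) \<in> set ru"
  "(c_start', X, a_claim, c_right g, [X]) \<in> set ru"
  "a \<in> set V0 \<Longrightarrow> (c_left a, sym_Z, a_zero, c_left a, [sym_Z]) \<in> set ru"
  "z \<in> set Cl \<Longrightarrow> (c_left (fst z), sym_I, a_clause z, c_ask z, [sym_I]) \<in> set ru"
  "z \<in> set Cl \<Longrightarrow> b \<in> set (snd z) \<Longrightarrow> (c_left (fst z), sym_I, a_clause z, c_pick b z, [sym_I]) \<in> set ru"
  "z \<in> set Cl \<Longrightarrow> b \<in> set (snd z) \<Longrightarrow> (c_right (fst z), sym_I, a_clause z, c_pick b z, [sym_I]) \<in> set ru"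
  "z \<in> set Cl \<Longrightarrow> b \<in> set (snd z) \<Longrightarrow> (c_ask z, sym_I, a_ret b, c_left b, []) \<in> set ru"
  "z \<in> set Cl \<Longrightarrow> b \<in> set (snd z) \<Longrightarrow> (c_pick b z, sym_I, a_ret b, c_right b, []) \<in> set ru"
  "z \<in> set Cl \<Longrightarrow> b \<in> set (snd z) \<Longrightarrow> c \<in> set (snd z) \<Longrightarrow> c \<noteq> b \<Longrightarrow>
    (c_pick b z, sym_I, a_ret c, c_left c, []) \<in> set ru"
proof -
  show "a \<in> set V0 \<Longrightarrow> (c_left a, sym_Z, a_zero, c_left a, [sym_Z]) \<in> set ru"
    by (simp add: ru_eq zero_rules_def)
  assume z: "z \<in> set Cl"
  have sub: "set (clause_rules z) \<subseteq> set ru" using z by (auto simp: ru_eq)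
  show "(c_left (fst z), sym_I, a_clause z, c_ask z, [sym_I]) \<in> set ru"
    using sub by (simp add: clause_rules_def)
  assume b: "b \<in> set (snd z)"
  show "(c_left (fst z), sym_I, a_clause z, c_pick b z, [sym_I]) \<in> set ru"
    "(c_right (fst z), sym_I, a_clause z, c_pick b z, [sym_I]) \<in> set ru"
    "(c_ask z, sym_I, a_ret b, c_left b, []) \<in> set ru"
    "(c_pick b z, sym_I, a_ret b, c_right b, []) \<in> set ru"
    using b by (auto intro!: subsetD[OF sub] simp: clause_rules_def)
  assume "c \<in> set (snd z)" "c \<noteq> b"
  then show "(c_pick b z, sym_I, a_ret c, c_left c, []) \<in> set ru"
    using b by (intro subsetD[OF sub]) (force simp: clause_rules_def)
qed (cases X; simp add: ru_eq start_rules_def)+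

lemma move: "(p, X, a, q, \<gamma>) \<in> set ru \<Longrightarrow> ((p, X # \<delta>), a, (q, \<gamma> @ \<delta>)) \<in> transitions T"
  unfolding trans_iff by (intro bexI[of _ "(p, X, a, q, \<gamma>)"]) auto

lemma moveE:
  assumes "((p, X # \<delta>), a, s') \<in> transitions T"
  obtains q \<gamma> where "(p, X, a, q, \<gamma>) \<in> set ru" "s' = (q, \<gamma> @ \<delta>)"
proof -
  obtain r where r: "r \<in> set ru" "src r = p" "act r = a" "X = ssym r" "s' = (tgt r, psh r @ \<delta>)"
    using assms unfolding trans_iff by auto
  then have "(p, X, a, tgt r, psh r) \<in> set ru" by (metis prod.collapse)
  then show thesis using r(5) that by blast
qed

lemma st_Cons: obtains X \<delta> where "st n = X # \<delta>" "st (Suc n) = sym_I # X # \<delta>"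
  by (cases "st n") (auto simp: st_simps)

text \<open>The attacker plays a clause for \<open>a\<close> whose body is true one time unit
  earlier. Whatever \<open>b\<close> the defender picks is true then, and \<open>a_ret b\<close>
  forces the pair for \<open>b\<close> with the counter decremented. An empty body leaves the
  defender without an answer, and so does \<open>a_zero\<close> at counter zero.\<close>

lemma true_not_simulated:
  assumes sim: "simulation T R" and "a \<in> V n"
  shows "((c_left a, st n), (c_right a, st n)) \<notin> R"
  using assms(2)
proof (induction n arbitrary: a)
  case 0
  show ?case
  proof
    assume R: "((c_left a, st 0), (c_right a, st 0)) \<in> R"
    have "((c_left a, st 0), a_zero, (c_left a, [sym_Z] @ [])) \<in> transitions T"
      unfolding st_simps using 0 by (intro move rule_in) simp
    from simulationD[OF sim R this] obtain t' where "((c_right a, [sym_Z]), a_zero, t') \<in> transitions T"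
      unfolding st_simps by blast
    then show False by (rule moveE) (erule ruleE; simp add: name_defs)
  qed
next
  case (Suc n)
  then obtain cl where cl: "(a, cl) \<in> set Cl" "set cl \<subseteq> V n" by auto
  let ?z = "(a, cl)"
  show ?case
  proof
    assume R: "((c_left a, st (Suc n)), (c_right a, st (Suc n))) \<in> R"
    have "((c_left a, st (Suc n)), a_clause ?z, (c_ask ?z, [sym_I] @ st n)) \<in> transitions T"
      unfolding st_simps using rule_in(6)[OF cl(1)] by (intro move) simp
    from simulationD[OF sim R this] obtain t' where
      t': "((c_right a, sym_I # st n), a_clause ?z, t') \<in> transitions T" "((c_ask ?z, sym_I # st n), t') \<in> R"
      unfolding st_simps by auto
    from t'(1) obtain b where b: "b \<in> set cl" "t' = (c_pick b ?z, sym_I # st n)"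
      by (rule moveE) (erule ruleE; auto simp: name_defs prod_eq_iff)
    have "((c_ask ?z, sym_I # st n), a_ret b, (c_left b, [] @ st n)) \<in> transitions T"
      using cl(1) b(1) by (intro move rule_in(9)) auto
    from simulationD[OF sim t'(2)[unfolded b(2)] this] obtain t'' where
      t'': "((c_pick b ?z, sym_I # st n), a_ret b, t'') \<in> transitions T" "((c_left b, st n), t'') \<in> R"
      by auto
    from t''(1) have "t'' = (c_right b, st n)"
      by (rule moveE) (erule ruleE; auto simp: name_defs prod_eq_iff)
    then show False using t''(2) Suc.IH[of b] b(1) cl(2) by auto
  qed
qed

text \<open>All answers of \<open>c_start'\<close> are forced: the attacker pumps the counter up to
  \<open>n\<close> with the defender following, and then claims.\<close>

lemma not_simulated:
  assumes "g \<in> V n"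
  shows "\<not> sim_preorder T (c_start, [sym_Z]) (c_start', [sym_Z])"
proof
  assume "sim_preorder T (c_start, [sym_Z]) (c_start', [sym_Z])"
  then obtain R where sim: "simulation T R" and R: "((c_start, st 0), (c_start', st 0)) \<in> R"
    by (auto simp: sim_preorder_def st_simps)
  have up: "((c_start, st m), (c_start', st m)) \<in> R" for m
  proof (induction m)
    case (Suc m)
    obtain X \<delta> where X: "st m = X # \<delta>" "st (Suc m) = sym_I # X # \<delta>" by (rule st_Cons)
    have "((c_start, X # \<delta>), a_call, (c_start, [sym_I, X] @ \<delta>)) \<in> transitions T"
      by (intro move rule_in(1))
    from simulationD[OF sim Suc[unfolded X] this] obtain t' where
      t': "((c_start', X # \<delta>), a_call, t') \<in> transitions T" "((c_start, sym_I # X # \<delta>), t') \<in> R" by auto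
    from t'(1) have "t' = (c_start', sym_I # X # \<delta>)"
      by (rule moveE) (erule ruleE; auto simp: name_defs)
    then show ?case using t'(2) X by simp
  qed (rule R)
  obtain X \<delta> where X: "st n = X # \<delta>" by (rule st_Cons)
  have "((c_start, X # \<delta>), a_claim, (c_left g, [X] @ \<delta>)) \<in> transitions T"
    by (intro move rule_in(3))
  from simulationD[OF sim up[of n, unfolded X] this] obtain t' where
    t': "((c_start', X # \<delta>), a_claim, t') \<in> transitions T" "((c_left g, X # \<delta>), t') \<in> R" by auto
  from t'(1) have "t' = (c_right g, X # \<delta>)"
    by (rule moveE) (erule ruleE; auto simp: name_defs)
  then show False using t'(2) X true_not_simulated[OF sim assms] by simp
qed

text \<open>Clause actions are internal, so the pairs in the last set still have the I on top that
  the next return removes; \<open>b \<notin> V n\<close> therefore refers to the counter after that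
  return.\<close>

definition B :: "((name \<times> counter_symbol list) \<times> (name \<times> counter_symbol list)) set" where
  "B = {((c_start, st n), (c_start', st n)) | n. True} \<union>
     {((c_left a, st n), (c_right a, st n)) | a n. a \<notin> V n \<and> c_left a \<in> set ctl \<and> c_right a \<in> set ctl} \<union>
     {((c_ask z, sym_I # st n), (c_pick b z, sym_I # st n)) | z b n.
       z \<in> set Cl \<and> b \<in> set (snd z) \<and> b \<notin> V n}"

lemma B_startI: "((c_start, st n), (c_start', st n)) \<in> B"
  unfolding B_def by blast

lemma B_varI: "a \<notin> V n \<Longrightarrow> c_left a \<in> set ctl \<Longrightarrow> c_right a \<in> set ctl \<Longrightarrow>
    ((c_left a, st n), (c_right a, st n)) \<in> B"
  unfolding B_def by blast

lemma B_askI: "z \<in> set Cl \<Longrightarrow> b \<in> set (snd z) \<Longrightarrow> b \<notin> V n \<Longrightarrow>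
    ((c_ask z, sym_I # st n), (c_pick b z, sym_I # st n)) \<in> B"
  unfolding B_def by blast

lemma B_cases:
  assumes "(s, t) \<in> B"
  obtains (B_start) n where "s = (c_start, st n)" "t = (c_start', st n)"
  | (B_var) a n where "s = (c_left a, st n)" "t = (c_right a, st n)" "a \<notin> V n" "c_left a \<in> set ctl"
      "c_right a \<in> set ctl"
  | (B_ask) z b n where "s = (c_ask z, sym_I # st n)" "t = (c_pick b z, sym_I # st n)" "z \<in> set Cl"
      "b \<in> set (snd z)" "b \<notin> V n"
  using assms unfolding B_def by blast

lemmas clause_ctl = clause_ctl[of _ Cl ctl g V0, OF _ ctl_game]

lemma B_states: "(s, t) \<in> B \<Longrightarrow> s \<in> states T \<and> t \<in> states T"
  by (erule B_cases) (simp_all add: states_T clause_ctl, simp_all add: ctl_eq)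

text \<open>The invariant is that the claim under discussion is false. The defender maintains it by
  picking a false variable of the clause played, and answers moves that ignore the pick by reaching
  the same configuration on both sides. Both sides are considered as the attacking one, since a
  bisimulation is wanted.\<close>

lemma B_step:
  assumes "\<forall>n. g \<notin> V n" "(s, t) \<in> B"
  shows "(s, a, s') \<in> transitions T \<Longrightarrow> \<exists>t'. (t, a, t') \<in> transitions T \<and> (s' = t' \<or> (s', t') \<in> B)"
    and "(t, a, t') \<in> transitions T \<Longrightarrow> \<exists>s'. (s, a, s') \<in> transitions T \<and> (s' = t' \<or> (s', t') \<in> B)"
proof -
  have gc: "c_left g \<in> set ctl" "c_right g \<in> set ctl" by (auto simp: ctl_eq)
  have "((s, a, s') \<in> transitions T \<longrightarrow> (\<exists>t'. (t, a, t') \<in> transitions T \<and> (s' = t' \<or> (s', t') \<in> B))) \<and>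
    ((t, a, t') \<in> transitions T \<longrightarrow> (\<exists>s'. (s, a, s') \<in> transitions T \<and> (s' = t' \<or> (s', t') \<in> B)))"
    using assms(2)
  proof (cases rule: B_cases)
    case (B_start n)
    obtain X \<delta> where X: "st n = X # \<delta>" "st (Suc n) = sym_I # X # \<delta>" by (rule st_Cons)
    have call: "((c_start, X # \<delta>), a_call, (c_start, sym_I # X # \<delta>)) \<in> transitions T"
      "((c_start', X # \<delta>), a_call, (c_start', sym_I # X # \<delta>)) \<in> transitions T"
      using move[OF rule_in(1)] move[OF rule_in(2)] by auto
    have claim: "((c_start, X # \<delta>), a_claim, (c_left g, X # \<delta>)) \<in> transitions T"
      "((c_start', X # \<delta>), a_claim, (c_right g, X # \<delta>)) \<in> transitions T"
      using move[OF rule_in(3)] move[OF rule_in(4)] by auto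
    have b1: "((c_start, sym_I # X # \<delta>), (c_start', sym_I # X # \<delta>)) \<in> B"
      using B_startI[of "Suc n"] X by simp
    have b2: "((c_left g, X # \<delta>), (c_right g, X # \<delta>)) \<in> B" using B_varI[of g n] X gc assms(1) by simp
    show ?thesis
    proof (intro conjI impI)
      assume "(s, a, s') \<in> transitions T"
      then have "a = a_call \<and> s' = (c_start, sym_I # X # \<delta>) \<or> a = a_claim \<and> s' = (c_left g, X # \<delta>)"
        unfolding B_start X by (elim moveE) (erule ruleE; auto simp: name_defs)
      then show "\<exists>t'. (t, a, t') \<in> transitions T \<and> (s' = t' \<or> (s', t') \<in> B)"
        unfolding B_start X using call(2) claim(2) b1 b2 by blast
    next
      assume "(t, a, t') \<in> transitions T"
      then have "a = a_call \<and> t' = (c_start', sym_I # X # \<delta>) \<or> a = a_claim \<and> t' = (c_right g, X # \<delta>)"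
        unfolding B_start X by (elim moveE) (erule ruleE; auto simp: name_defs)
      then show "\<exists>s'. (s, a, s') \<in> transitions T \<and> (s' = t' \<or> (s', t') \<in> B)"
        unfolding B_start X using call(1) claim(1) b1 b2 by blast
    qed
  next
    case (B_var v n)
    show ?thesis
    proof (cases n)
      \<comment> \<open>Neither side can move: \<open>zero_rules\<close> has rules for initially
        true variables only, and clauses need an I on top.\<close>
      case 0
      have "(s, a, s') \<notin> transitions T"
      proof
        assume "(s, a, s') \<in> transitions T"
        then show False unfolding B_var 0 st_simps
          by (elim moveE) (erule ruleE; use B_var(3) 0 in \<open>auto simp: name_defs\<close>)
      qed
      moreover have "(t, a, t') \<notin> transitions T"
      proof
        assume "(t, a, t') \<in> transitions T"
        then show False unfolding B_var 0 st_simps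
          by (elim moveE) (erule ruleE; auto simp: name_defs)
      qed
      ultimately show ?thesis by blast
    next
      case (Suc m)
      show ?thesis
      proof (intro conjI impI)
        assume "(s, a, s') \<in> transitions T"
        then consider z where "z \<in> set Cl" "fst z = v" "a = a_clause z" "s' = (c_ask z, sym_I # st m)"
          | z b where "z \<in> set Cl" "fst z = v" "b \<in> set (snd z)" "a = a_clause z" "s' = (c_pick b z, sym_I # st m)"
          unfolding B_var Suc st_simps
          by (elim moveE) (erule ruleE; auto simp: c_left_def c_right_def c_ask_def c_pick_def c_start_def c_start'_def)
        then show "\<exists>t'. (t, a, t') \<in> transitions T \<and> (s' = t' \<or> (s', t') \<in> B)"
        proof cases
          case 1
          have "(v, snd z) \<in> set Cl" using 1(1,2) by (metis prod.collapse)
          \<comment> \<open>If all variables of the clause were true at time \<open>m\<close>, the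
            clause would make \<open>v\<close> true at time \<open>Suc m\<close>.\<close>
          then obtain b where b: "b \<in> set (snd z)" "b \<notin> V m" using B_var(3) unfolding Suc by auto
          have "((c_right v, sym_I # st m), a, (c_pick b z, [sym_I] @ st m)) \<in> transitions T"
            using move[OF rule_in(8)[OF 1(1) b(1)]] 1 by simp
          moreover have "(s', (c_pick b z, sym_I # st m)) \<in> B" using B_askI[OF 1(1) b] 1(4) by simp
          ultimately show ?thesis unfolding B_var Suc st_simps by auto
        next
          case 2
          have "((c_right v, sym_I # st m), a, (c_pick b z, [sym_I] @ st m)) \<in> transitions T"
            using move[OF rule_in(8)[OF 2(1,3)]] 2 by simp
          then show ?thesis using 2 unfolding B_var Suc st_simps by auto
        qed
      next
        assume "(t, a, t') \<in> transitions T"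
        then obtain z b where z: "z \<in> set Cl" "fst z = v" "b \<in> set (snd z)" "a = a_clause z"
            "t' = (c_pick b z, sym_I # st m)"
          unfolding B_var Suc st_simps
          by (elim moveE) (erule ruleE; auto simp: c_left_def c_right_def c_ask_def c_pick_def c_start_def c_start'_def)
        have "((c_left v, sym_I # st m), a, (c_pick b z, [sym_I] @ st m)) \<in> transitions T"
          using move[OF rule_in(7)[OF z(1,3)]] z by simp
        then show "\<exists>s'. (s, a, s') \<in> transitions T \<and> (s' = t' \<or> (s', t') \<in> B)"
          using z unfolding B_var Suc st_simps by auto
      qed
    qed
  next
    case (B_ask z b n)
    have bB: "((c_left b, st n), (c_right b, st n)) \<in> B"
      using B_ask clause_ctl[OF B_ask(3)] by (intro B_varI) auto
    have ask: "((c_ask z, sym_I # st n), a_ret c, (c_left c, st n)) \<in> transitions T" if "c \<in> set (snd z)" for c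
      using move[OF rule_in(9)[OF B_ask(3) that], of "st n"] by simp
    have pick: "((c_pick b z, sym_I # st n), a_ret b, (c_right b, st n)) \<in> transitions T"
      using move[OF rule_in(10)[OF B_ask(3,4)], of "st n"] by simp
    have pick': "((c_pick b z, sym_I # st n), a_ret c, (c_left c, st n)) \<in> transitions T"
      if "c \<in> set (snd z)" "c \<noteq> b" for c
      using move[OF rule_in(11)[OF B_ask(3,4) that], of "st n"] by simp
    show ?thesis
    proof (intro conjI impI)
      assume "(s, a, s') \<in> transitions T"
      then obtain c where c: "c \<in> set (snd z)" "a = a_ret c" "s' = (c_left c, st n)"
        unfolding B_ask
        by (elim moveE) (erule ruleE; auto simp: c_left_def c_right_def c_ask_def c_pick_def c_start_def c_start'_def)
      then show "\<exists>t'. (t, a, t') \<in> transitions T \<and> (s' = t' \<or> (s', t') \<in> B)"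
        unfolding B_ask using pick pick'[of c] bB by (cases "c = b") auto
    next
      assume "(t, a, t') \<in> transitions T"
      then have "a = a_ret b \<and> t' = (c_right b, st n) \<or>
          (\<exists>c. c \<in> set (snd z) \<and> c \<noteq> b \<and> a = a_ret c \<and> t' = (c_left c, st n))"
        unfolding B_ask
        by (elim moveE) (erule ruleE; auto simp: c_left_def c_right_def c_ask_def c_pick_def c_start_def c_start'_def)
      then show "\<exists>s'. (s, a, s') \<in> transitions T \<and> (s' = t' \<or> (s', t') \<in> B)"
        unfolding B_ask using ask bB B_ask(4) by blast
    qed
  qed
  then show "(s, a, s') \<in> transitions T \<Longrightarrow> \<exists>t'. (t, a, t') \<in> transitions T \<and> (s' = t' \<or> (s', t') \<in> B)"
    and "(t, a, t') \<in> transitions T \<Longrightarrow> \<exists>s'. (s, a, s') \<in> transitions T \<and> (s' = t' \<or> (s', t') \<in> B)"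
    by blast+
qed

lemma all_bisimilar:
  assumes g: "\<forall>n. g \<notin> V n"
  shows "bisimilar T (c_start, [sym_Z]) (c_start', [sym_Z])"
proof -
  let ?R = "Id_on (states T) \<union> B \<union> B\<inverse>"
  have "simulation T ?R"
  proof (rule simulationI)
    show "?R \<subseteq> states T \<times> states T" using B_states by auto
    have in_states: "s' \<in> states T" if tr: "(s, a, s') \<in> transitions T" for s a s'
    proof -
      obtain p \<delta> where s: "s = (p, \<delta>)" by (cases s)
      obtain r where "r \<in> set ru" "s' = (tgt r, psh r @ tl \<delta>)" using tr unfolding s trans_iff by blast
      then show ?thesis using rule_props(2)[of "src r" "ssym r" "act r" "tgt r" "psh r"] by (simp add: states_T)
    qed
    fix s t a s' assume st: "(s, t) \<in> ?R" and tr: "(s, a, s') \<in> transitions T"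
    consider "s = t" | "(s, t) \<in> B" | "(t, s) \<in> B" using st by auto
    then show "\<exists>t'. (t, a, t') \<in> transitions T \<and> (s', t') \<in> ?R"
    proof cases
      case 1
      then show ?thesis using tr in_states[OF tr] by blast
    next
      case 2
      from B_step(1)[OF g this tr] show ?thesis using in_states[OF tr] by blast
    next
      case 3
      from B_step(2)[OF g this tr] show ?thesis using in_states[OF tr] by blast
    qed
  qed
  moreover have "?R\<inverse> = ?R" by (simp add: converse_Un Un_ac)
  moreover have "((c_start, [sym_Z]), (c_start', [sym_Z])) \<in> ?R" using B_startI[of 0] by (simp add: st_simps)
  ultimately show ?thesis unfolding bisimilar_def bisimulation_def by (intro exI[of _ ?R] conjI)
qed

end

section \<open>The spectrum between bisimilarity and the simulation preorder\<close>

definition coarser :: "('s, 'a) behavioural_relation \<Rightarrow> ('s, 'a) behavioural_relation \<Rightarrow> bool" where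
  "coarser rel rel' \<longleftrightarrow> (\<forall>T s t. rel' T s t \<longrightarrow> rel T s t)"

lemma bisimulation_enabled:
  assumes "simulation T R" "R\<inverse> = R" "(s, t) \<in> R"
  shows "enabled T s = enabled T t"
proof -
  have "(t, s) \<in> R" using assms(2,3) by auto
  then show ?thesis
    using simulationD[OF assms(1,3)] simulationD[OF assms(1)] unfolding enabled_def by blast
qed

lemma relation_spectrum:
  fixes rel :: "('a, 'b) behavioural_relation"
  assumes "rel \<in> {sim_preorder, sim_equiv, completed_sim_preorder, completed_sim_equiv,
    ready_sim_preorder, ready_sim_equiv, two_nested_sim_preorder, two_nested_sim_equiv, bisimilar}"
  shows "coarser rel bisimilar \<and> coarser sim_preorder rel"
proof -
  have "coarser (sim_preorder :: ('a, 'b) behavioural_relation) bisimilar" "coarser (sim_preorder :: ('a, 'b) behavioural_relation) completed_sim_preorder"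
    "coarser (sim_preorder :: ('a, 'b) behavioural_relation) ready_sim_preorder" "coarser (sim_preorder :: ('a, 'b) behavioural_relation) two_nested_sim_preorder"
    "coarser (sim_preorder :: ('a, 'b) behavioural_relation) sim_equiv" "coarser (sim_preorder :: ('a, 'b) behavioural_relation) sim_preorder"
    by (auto simp: coarser_def sim_preorder_def bisimilar_def bisimulation_def completed_sim_preorder_def
        completed_simulation_def ready_sim_preorder_def ready_simulation_def two_nested_sim_preorder_def
        two_nested_simulation_def sim_equiv_def)
  moreover from this have "coarser (sim_preorder :: ('a, 'b) behavioural_relation) completed_sim_equiv" "coarser (sim_preorder :: ('a, 'b) behavioural_relation) ready_sim_equiv"
    "coarser (sim_preorder :: ('a, 'b) behavioural_relation) two_nested_sim_equiv"
    by (auto simp: coarser_def completed_sim_equiv_def ready_sim_equiv_def two_nested_sim_equiv_def)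
  note coarse = calculation this
  have sym: "bisimilar T t s" if "bisimilar T s t" for T :: "('a, 'b) lts" and s t
    using that by (auto simp: bisimilar_def bisimulation_def)
  have pre: "sim_preorder T s t \<and> completed_sim_preorder T s t \<and> ready_sim_preorder T s t \<and>
      two_nested_sim_preorder T s t" if "bisimilar T s t" for T :: "('a, 'b) lts" and s t
  proof -
    obtain R where R: "simulation T R" "R\<inverse> = R" "(s, t) \<in> R"
      using \<open>bisimilar T s t\<close> by (auto simp: bisimilar_def bisimulation_def)
    have e: "enabled T s = enabled T t" if "(s, t) \<in> R" for s t using bisimulation_enabled[OF R(1,2) that] .
    have "completed_simulation T R" unfolding completed_simulation_def using R(1) e by fast
    moreover have "ready_simulation T R" unfolding ready_simulation_def using R(1) e by fast
    moreover have "two_nested_simulation T R" unfolding two_nested_simulation_def using R(1,2) by blast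
    ultimately show ?thesis
      unfolding sim_preorder_def completed_sim_preorder_def ready_sim_preorder_def two_nested_sim_preorder_def
      using R(1,3) by blast
  qed
  have fine: "coarser rel' bisimilar" if "\<And>T s t. bisimilar T s t \<Longrightarrow> rel' T s t"
    for rel' :: "('a, 'b) behavioural_relation"
    using that by (simp add: coarser_def)
  have "coarser (sim_preorder :: ('a, 'b) behavioural_relation) bisimilar"
    "coarser (completed_sim_preorder :: ('a, 'b) behavioural_relation) bisimilar"
    "coarser (ready_sim_preorder :: ('a, 'b) behavioural_relation) bisimilar"
    "coarser (two_nested_sim_preorder :: ('a, 'b) behavioural_relation) bisimilar"
    "coarser (sim_equiv :: ('a, 'b) behavioural_relation) bisimilar"
    "coarser (completed_sim_equiv :: ('a, 'b) behavioural_relation) bisimilar"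
    "coarser (ready_sim_equiv :: ('a, 'b) behavioural_relation) bisimilar"
    "coarser (two_nested_sim_equiv :: ('a, 'b) behavioural_relation) bisimilar"
    "coarser (bisimilar :: ('a, 'b) behavioural_relation) bisimilar"
    by (rule fine; use pre sym in \<open>simp add: sim_equiv_def completed_sim_equiv_def ready_sim_equiv_def
        two_nested_sim_equiv_def\<close>)+
  then show ?thesis using assms coarse by auto
qed

section \<open>Hardness: space-bounded Turing machines as boolean systems\<close>

lemma PT_drop_var:
  assumes "PT f" "PT g"
  shows "PT (\<lambda>x. drop (f x) (g x :: 'b::encodable list))"
proof (rule PT_comp2[OF _ assms])
  have fl: "foldl (\<lambda>a y. tl a) (xs :: 'b list) (ys :: bool list) = drop (length ys) xs" for xs ys
    by (induction ys arbitrary: xs) (auto simp: drop_Suc)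
  have "PT (\<lambda>z :: nat \<times> 'b list. foldl (\<lambda>a y. tl a) (snd z) (replicate (fst z) False))"
  proof (rule PT_foldl[OF _ _ _ polyb_id])
    fix z :: "nat \<times> 'b list" and i
    show "sz (foldl (\<lambda>a y. tl a) (snd z) (take i (replicate (fst z) False))) \<le> sz z"
      using sz_drop[of "min i (fst z)" "snd z"] by (simp add: fl tr_prod_def[of z])
  qed (intro PT_intros PT_replicate_False)+
  then show "PT (\<lambda>z :: nat \<times> 'b list. drop (fst z) (snd z))" by (simp add: fl)
qed

fun tuples :: "nat \<Rightarrow> 'a list \<Rightarrow> 'a list list" where
  "tuples 0 ys = [[]]"
| "tuples (Suc k) ys = concat (map (\<lambda>y. map (\<lambda>t. y # t) (tuples k ys)) ys)"

lemma set_tuples: "xs \<in> set (tuples k ys) \<longleftrightarrow> length xs = k \<and> set xs \<subseteq> set ys"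
proof (induction k arbitrary: xs)
  case (Suc k)
  then show ?case by (cases xs) (auto simp: image_iff)
qed auto

lemma PT_tuples:
  assumes "PT f"
  shows "PT (\<lambda>x. tuples k (f x))"
proof (induction k)
  case (Suc k)
  show ?case unfolding tuples.simps by (intro PT_intros PT_comp[OF Suc] PT_comp[OF assms])
qed (simp add: PT_const)

lemma polyb_poly_nat: "polyb (poly (p :: nat poly))"
proof (induction p)
  case 0
  show ?case by (simp add: polyb_const)
next
  case (pCons a p)
  have "polyb (\<lambda>n. a + n * poly p n)" by (intro polyb_intros pCons.IH)
  then show ?case by (simp add: poly_pCons[abs_def])
qed

definition v_state :: "nat \<Rightarrow> nat list \<Rightarrow> nat list" where "v_state q js = 0 # q # js"
definition v_cell :: "nat \<Rightarrow> nat \<Rightarrow> nat \<Rightarrow> nat list" where "v_cell i j x = [1, i, j, x]"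
definition v_goal :: "nat list" where "v_goal = [2]"

lemmas v_defs = v_state_def v_cell_def v_goal_def

text \<open>Since the number of tapes is fixed, all tuples of head positions can be enumerated.\<close>

definition total_delta :: "tm \<Rightarrow> nat \<Rightarrow> nat list \<Rightarrow> nat \<times> (nat \<times> head_move) list" where
  "total_delta M q xs = (if q \<in> {accept_state M, reject_state M} then (q, map (\<lambda>x. (x, Move_Stay)) xs)
     else delta M q xs)"

text \<open>A view contains all that determines the next step. \<open>hd (drop i js)\<close> is
  \<open>js ! i\<close> for positions within the tuple, expressed by functions known to be
  computable: \<open>js\<close> depends on the input, whereas \<open>q\<close> and \<open>xs\<close>
  range over constants.\<close>

definition view :: "nat \<Rightarrow> nat \<Rightarrow> nat list \<Rightarrow> nat list \<Rightarrow> nat list list" where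
  "view k q xs js = v_state q js # map (\<lambda>i. v_cell i (hd (drop i js)) (xs ! i)) [0..<k]"

text \<open>The new state and the written cells follow from the complete view. A cell away from the
  head keeps its content; its clause refers to the state variable too, because this is what
  certifies that the head is elsewhere.\<close>

definition view_clauses :: "tm \<Rightarrow> nat \<Rightarrow> nat list \<Rightarrow> nat \<Rightarrow> nat list \<Rightarrow> clause list" where
  "view_clauses M q xs s js =
     (v_state (fst (total_delta M q xs))
        (map (\<lambda>i. move_head (snd (snd (total_delta M q xs) ! i)) (hd (drop i js))) [0..<ntapes M]),
      view (ntapes M) q xs js) #
     map (\<lambda>i. (v_cell i (hd (drop i js)) (fst (snd (total_delta M q xs) ! i)), view (ntapes M) q xs js))
       [0..<ntapes M] @
     concat (map (\<lambda>i. concat (map (\<lambda>x. map (\<lambda>j. (v_cell i j x, [v_state q js, v_cell i j x]))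
       (filter (\<lambda>j. j \<noteq> hd (drop i js)) [0..<s])) [0..<nsyms M])) [0..<ntapes M])"

text \<open>For fixed \<open>M\<close> the control states and the tuples of symbols are constants,
  and there are \<open>s ^ ntapes M\<close> tuples of head positions, hence polynomially many
  clauses when \<open>s\<close> is polynomial.\<close>

definition run_clauses :: "tm \<Rightarrow> nat \<Rightarrow> clause list" where
  "run_clauses M s =
     concat (map (\<lambda>c. concat (map (\<lambda>js. view_clauses M (fst c) (snd c) s js) (tuples (ntapes M) [0..<s])))
       (concat (map (\<lambda>q. map (Pair q) (tuples (ntapes M) [0..<nsyms M])) [0..<nstates M]))) @
     map (\<lambda>js. (v_goal, [v_state (reject_state M) js])) (tuples (ntapes M) [0..<s])"

definition run_start :: "tm \<Rightarrow> bool list \<Rightarrow> nat \<Rightarrow> nat list list" where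
  "run_start M w s = v_state (start_state M) (replicate (ntapes M) 0) #
     map (\<lambda>j. v_cell 0 j (if j \<in> set [0..<length w] then (if hd (drop j w) then 2 else 1) else 0)) [0..<s] @
     concat (map (\<lambda>i. map (\<lambda>j. v_cell i j 0) [0..<s]) [1..<ntapes M])"

lemma PT_v:
  assumes "PT f" "PT g" "PT h"
  shows "PT (\<lambda>x. v_cell (f x) (g x) (h x))"
  unfolding v_defs by (intro PT_intros assms)

lemma PT_v_state:
  assumes "PT f" "PT g"
  shows "PT (\<lambda>x. v_state (f x) (g x))"
  unfolding v_defs by (intro PT_intros assms)

lemma PT_move_head: "PT f \<Longrightarrow> PT (\<lambda>x. move_head d (f x))"
proof (cases d)
  case Move_Left
  assume "PT f"
  then show ?thesis unfolding Move_Left using PT_pred[of f] by simp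
qed (auto intro: PT_add PT_Suc PT_const)

lemma PT_view: "PT f \<Longrightarrow> PT (\<lambda>x. view k q xs (f x))"
  unfolding view_def
  by (intro PT_Cons PT_map_consts PT_v PT_v_state PT_const PT_hd PT_drop_var)

lemma PT_view_clauses:
  assumes "PT f" "PT g"
  shows "PT (\<lambda>x. view_clauses M q xs (f x) (g x))"
proof -
  have "PT (\<lambda>z :: nat \<times> nat list. view_clauses M q xs (fst z) (snd z))"
    unfolding view_clauses_def
    by (intro PT_Cons PT_append PT_Pair PT_concat PT_map_consts PT_v PT_v_state PT_const PT_hd PT_drop_var
        PT_view PT_move_head PT_fst PT_snd PT_id PT_map PT_filter PT_not PT_eq PT_upt)
  from PT_comp2[OF this assms] show ?thesis .
qed

lemma PT_run_clauses:
  assumes "PT f"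
  shows "PT (\<lambda>x. run_clauses M (f x))"
proof -
  have "PT (\<lambda>s. run_clauses M s)"
    unfolding run_clauses_def
    by (intro PT_append PT_concat PT_map_consts PT_map PT_view_clauses PT_fst PT_Pair PT_const PT_Cons PT_v_state PT_tuples
        PT_upt PT_snd PT_id)
  from PT_comp[OF this assms] show ?thesis .
qed

lemma PT_run_start:
  assumes "PT f" "PT g"
  shows "PT (\<lambda>x. run_start M (f x) (g x))"
proof -
  have "PT (\<lambda>z. run_start M (fst z) (snd z))"
    unfolding run_start_def
    by (intro PT_v PT_v_state PT_drop_var PT_intros)
  from PT_comp2[OF this assms] show ?thesis .
qed

text \<open>A halted machine repeats its configuration; \<open>total_delta\<close> expresses this as
  writing back the scanned symbols, so that one form of clause covers all times.\<close>

lemma tm_step_total: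
  assumes "length (snd c) = ntapes M"
  shows "tm_step M c = (let (q, acts) = total_delta M (fst c) (map (\<lambda>(f, i). f i) (snd c))
    in (q, map2 tape_action acts (snd c)))"
proof (cases "halted M c")
  case True
  have "map2 tape_action (map (\<lambda>x. (x, Move_Stay)) (map (\<lambda>(f, i). f i) T)) T = T" for T :: "tape list"
    by (induction T) auto
  then show ?thesis using True by (simp add: tm_step_def total_delta_def halted_def)
next
  case False
  then show ?thesis by (simp add: tm_step_def total_delta_def halted_def)
qed

section \<open>The run of a machine as the values of the system\<close>

definition wf_config :: "tm \<Rightarrow> tm_config \<Rightarrow> bool" where
  "wf_config M c \<longleftrightarrow> fst c < nstates M \<and> length (snd c) = ntapes M \<and>
     (\<forall>i<ntapes M. \<forall>j. fst (snd c ! i) j < nsyms M)"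

lemma total_delta_props:
  assumes "turing_machine M" "q < nstates M" "length xs = ntapes M" "\<forall>x\<in>set xs. x < nsyms M"
  shows "fst (total_delta M q xs) < nstates M" "length (snd (total_delta M q xs)) = ntapes M"
    "\<forall>a\<in>set (snd (total_delta M q xs)). fst a < nsyms M"
proof -
  have d: "fst (delta M q xs) < nstates M \<and>
      length (snd (delta M q xs)) = ntapes M \<and> (\<forall>(y, d)\<in>set (snd (delta M q xs)). y < nsyms M)"
    using assms unfolding turing_machine_def by blast
  then have "\<forall>a\<in>set (snd (delta M q xs)). fst a < nsyms M" by fastforce
  with d show "fst (total_delta M q xs) < nstates M" "length (snd (total_delta M q xs)) = ntapes M"
    "\<forall>a\<in>set (snd (total_delta M q xs)). fst a < nsyms M"
    using assms unfolding total_delta_def by auto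
qed

lemma reads_wf:
  assumes "wf_config M c"
  shows "length (map (\<lambda>(f, i). f i) (snd c)) = ntapes M" "\<forall>x\<in>set (map (\<lambda>(f, i). f i) (snd c)). x < nsyms M"
  using assms by (auto simp: wf_config_def in_set_conv_nth split: prod.splits) (metis fst_conv)

lemma step_nth:
  assumes "turing_machine M" "wf_config M c"
  defines "d \<equiv> total_delta M (fst c) (map (\<lambda>(f, i). f i) (snd c))"
  shows "fst (tm_step M c) = fst d" "length (snd (tm_step M c)) = ntapes M"
    "i < ntapes M \<Longrightarrow> fst (snd (tm_step M c) ! i) =
      (fst (snd c ! i)) (snd (snd c ! i) := fst (snd d ! i))"
    "i < ntapes M \<Longrightarrow> snd (snd (tm_step M c) ! i) = move_head (snd (snd d ! i)) (snd (snd c ! i))"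
proof -
  have len: "length (snd c) = ntapes M" using assms(2) by (simp add: wf_config_def)
  have ld: "length (snd d) = ntapes M"
    unfolding d_def using assms(2) reads_wf[OF assms(2)]
    by (intro total_delta_props[OF assms(1)]) (auto simp: wf_config_def)
  have eq: "tm_step M c = (fst d, map2 tape_action (snd d) (snd c))"
    using tm_step_total[OF len] by (simp add: d_def case_prod_beta)
  show "fst (tm_step M c) = fst d" "length (snd (tm_step M c)) = ntapes M" using len ld by (simp_all add: eq)
  have ta: "fst (tape_action a t) = (fst t)(snd t := fst a)" "snd (tape_action a t) = move_head (snd a) (snd t)"
    for a t by (cases a; cases t; simp)+
  show "i < ntapes M \<Longrightarrow> fst (snd (tm_step M c) ! i) = (fst (snd c ! i)) (snd (snd c ! i) := fst (snd d ! i))"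
    "i < ntapes M \<Longrightarrow> snd (snd (tm_step M c) ! i) = move_head (snd (snd d ! i)) (snd (snd c ! i))"
    using len ld by (simp_all add: eq ta)
qed

lemma wf_step:
  assumes "turing_machine M" "wf_config M c"
  shows "wf_config M (tm_step M c)"
proof -
  let ?d = "total_delta M (fst c) (map (\<lambda>(f, i). f i) (snd c))"
  note p = total_delta_props[OF assms(1) _ reads_wf[OF assms(2)], of "fst c"]
  have q: "fst c < nstates M" using assms(2) by (simp add: wf_config_def)
  have "fst (snd ?d ! i) < nsyms M" if "i < ntapes M" for i
    using p(2,3)[OF q] that by (metis nth_mem)
  then show ?thesis
    using step_nth[OF assms] p(1)[OF q] assms(2) by (simp add: wf_config_def)
qed

lemma wf_initial: "turing_machine M \<Longrightarrow> wf_config M (initial_config M w)"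
  by (auto simp: wf_config_def initial_config_def turing_machine_def nth_Cons' bit_symbol_def)

lemma tm_run_Suc: "tm_run M w (Suc n) = tm_step M (tm_run M w n)"
  by (simp add: tm_run_def)

lemma wf_run: "turing_machine M \<Longrightarrow> wf_config M (tm_run M w n)"
  by (induction n) (auto simp: tm_run_Suc wf_step, simp add: tm_run_def wf_initial)

locale bounded_run =
  fixes M :: tm and w :: "bool list" and s :: nat
  assumes tm: "turing_machine M"
    and bound: "\<And>n i. i < ntapes M \<Longrightarrow> snd (snd (tm_run M w n) ! i) < s"
begin

abbreviation "k \<equiv> ntapes M"
abbreviation "V \<equiv> true_at (run_start M w s) (run_clauses M s)"
abbreviation "cf n \<equiv> tm_run M w n"
abbreviation "heads n \<equiv> map snd (snd (cf n))"
abbreviation "reads n \<equiv> map (\<lambda>(f, i). f i) (snd (cf n))"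
abbreviation "cell n i j \<equiv> fst (snd (cf n) ! i) j"

lemma run_props: "fst (cf n) < nstates M" "length (snd (cf n)) = k" "i < k \<Longrightarrow> cell n i j < nsyms M"
  using wf_run[OF tm, of w n] by (auto simp: wf_config_def)

lemma heads_tuple: "heads n \<in> set (tuples k [0..<s])"
proof -
  have "x < s" if x: "x \<in> set (heads n)" for x
  proof -
    obtain i where "i < length (heads n)" "heads n ! i = x" using x by (metis in_set_conv_nth)
    then show ?thesis using bound[of i n] run_props(2)[of n] by (metis length_map nth_map)
  qed
  then have "set (heads n) \<subseteq> {0..<s}" by (intro subsetI) simp
  then show ?thesis using run_props(2)[of n] by (simp add: set_tuples)
qed

lemma reads_tuple: "reads n \<in> set (tuples k [0..<nsyms M])"
  using reads_wf[OF wf_run[OF tm, of w n]] by (auto simp: set_tuples)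

lemma reads_nth: "i < k \<Longrightarrow> reads n ! i = cell n i (heads n ! i)"
  using run_props(2)[of n] by (simp add: case_prod_beta)

lemma mem_clauses:
  "(a, cl) \<in> set (run_clauses M s) \<longleftrightarrow>
    (\<exists>q xs js. q < nstates M \<and> xs \<in> set (tuples k [0..<nsyms M]) \<and> js \<in> set (tuples k [0..<s]) \<and>
      (a, cl) \<in> set (view_clauses M q xs s js)) \<or>
    (\<exists>js \<in> set (tuples k [0..<s]). a = v_goal \<and> cl = [v_state (reject_state M) js])"
  unfolding run_clauses_def by (auto simp: image_iff Bex_def)

lemma mem_view:
  assumes "length js = k"
  shows "(a, cl) \<in> set (view_clauses M q xs s js) \<longleftrightarrow>
    a = v_state (fst (total_delta M q xs))
        (map (\<lambda>i. move_head (snd (snd (total_delta M q xs) ! i)) (js ! i)) [0..<k]) \<and> cl = view k q xs js \<or>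
    (\<exists>i<k. a = v_cell i (js ! i) (fst (snd (total_delta M q xs) ! i)) \<and> cl = view k q xs js) \<or>
    (\<exists>i<k. \<exists>x<nsyms M. \<exists>j<s. j \<noteq> js ! i \<and> a = v_cell i j x \<and> cl = [v_state q js, v_cell i j x])"
proof -
  have h: "hd (drop i js) = js ! i" if "i < k" for i using that assms by (simp add: hd_drop_conv_nth)
  have m: "map (\<lambda>i. move_head (snd (snd (total_delta M q xs) ! i)) (hd (drop i js))) [0..<k] =
      map (\<lambda>i. move_head (snd (snd (total_delta M q xs) ! i)) (js ! i)) [0..<k]"
    using h by simp
  have 1: "y \<in> set (x # map f [0..<k] @ concat (map g [0..<k])) \<longleftrightarrow>
      y = x \<or> (\<exists>i<k. y = f i) \<or> (\<exists>i<k. y \<in> set (g i))" for y x :: clause and f g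
    by (auto simp: image_iff)
  have 2: "y \<in> set (concat (map (\<lambda>x. map (f x) (filter P [0..<s])) [0..<l])) \<longleftrightarrow>
      (\<exists>x<l. \<exists>j<s. P j \<and> y = f x j)" for y :: clause and f P l
    by (auto simp: image_iff)
  show ?thesis unfolding view_clauses_def m 1 2 by (simp add: h cong: conj_cong)
qed

lemma set_view: "length js = k \<Longrightarrow> set (view k q xs js) = insert (v_state q js) ((\<lambda>i. v_cell i (js ! i) (xs ! i)) ` {..<k})"
  unfolding view_def by (auto simp: hd_drop_conv_nth image_iff)

text \<open>Both directions are required: a true variable that does not describe the run could make
  the goal true without a rejection.\<close>

definition tracks :: "nat \<Rightarrow> bool" where
  "tracks n \<longleftrightarrow> (\<forall>q js. v_state q js \<in> V n \<longleftrightarrow> q = fst (cf n) \<and> js = heads n) \<and>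
     (\<forall>i j x. v_cell i j x \<in> V n \<longleftrightarrow> i < k \<and> j < s \<and> x = cell n i j)"

text \<open>Heads stay below \<open>s\<close>, so the scanned cells are among those described, and
  each of these has exactly one true content.\<close>

lemma view_true:
  assumes "tracks n" "length js = k" "length xs = k"
  shows "set (view k q xs js) \<subseteq> V n \<longleftrightarrow> q = fst (cf n) \<and> js = heads n \<and> xs = reads n"
proof -
  have "(\<forall>i<k. v_cell i (heads n ! i) (xs ! i) \<in> V n) \<longleftrightarrow> xs = reads n"
  proof -
    have "v_cell i (heads n ! i) (xs ! i) \<in> V n \<longleftrightarrow> xs ! i = reads n ! i" if "i < k" for i
      using assms(1) that bound[OF that, of n] run_props(2)[of n] reads_nth[OF that, of n]
      unfolding tracks_def by simp
    then show ?thesis using assms(3) run_props(2)[of n] by (auto simp: list_eq_iff_nth_eq)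
  qed
  moreover have "v_state q js \<in> V n \<longleftrightarrow> q = fst (cf n) \<and> js = heads n" using assms(1) by (simp add: tracks_def)
  ultimately show ?thesis unfolding set_view[OF assms(2)] by auto
qed

lemma tracks_0: "tracks 0"
proof -
  have k: "k \<ge> 1" using tm by (simp add: turing_machine_def)
  have c0: "fst (cf 0) = start_state M" "heads 0 = replicate k 0"
    using k by (auto simp: tm_run_def initial_config_def replicate_Suc[symmetric] simp del: replicate_Suc)
  have cells: "cell 0 i j = (if i = 0 \<and> j < length w then bit_symbol (w ! j) else 0)" if "i < k" for i j
    using that by (auto simp: tm_run_def initial_config_def nth_Cons')
  have sym: "(if j \<in> set [0..<length w] then (if hd (drop j w) then 2 else 1) else 0) = cell 0 0 j" for j
    using k cells[of 0 j] by (auto simp: hd_drop_conv_nth bit_symbol_def)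
  have V0: "V 0 = insert (v_state (start_state M) (replicate k 0))
      ((\<lambda>j. v_cell 0 j (cell 0 0 j)) ` {..<s} \<union> (\<Union>i\<in>{1..<k}. (\<lambda>j. v_cell i j 0) ` {..<s}))"
    unfolding true_at.simps run_start_def sym by (auto simp: atLeast0LessThan)
  have "v_cell i j x \<in> V 0 \<longleftrightarrow> i < k \<and> j < s \<and> x = cell 0 i j" for i j x
  proof (cases "i = 0")
    case True
    then show ?thesis using k unfolding V0 by (auto simp: v_defs)
  next
    case False
    then show ?thesis using cells[of i j] unfolding V0 by (auto simp: v_defs image_iff)
  qed
  moreover have "v_state q js \<in> V 0 \<longleftrightarrow> q = fst (cf 0) \<and> js = heads 0" for q js
    unfolding V0 c0 by (auto simp: v_defs)
  ultimately show ?thesis unfolding tracks_def by blast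
qed

text \<open>A clause whose body is a view can fire for the actual view only, so it yields what the
  transition function prescribes. The clauses that copy a cell apply away from the heads, and the
  two kinds together cover every cell below \<open>s\<close>.\<close>

lemma tracks_Suc:
  assumes t: "tracks n"
  shows "tracks (Suc n)"
proof -
  let ?d = "total_delta M (fst (cf n)) (reads n)"
  note st = step_nth[OF tm wf_run[OF tm, of w n], folded tm_run_Suc]
  have hl: "length (heads n) = k" "length (reads n) = k" using run_props(2)[of n] by auto
  have heads': "heads (Suc n) = map (\<lambda>i. move_head (snd (snd ?d ! i)) (heads n ! i)) [0..<k]"
    using st run_props(2)[of n] by (auto simp: list_eq_iff_nth_eq)
  have view_ok: "set (view k q xs js) \<subseteq> V n \<longleftrightarrow> q = fst (cf n) \<and> js = heads n \<and> xs = reads n"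
    if "xs \<in> set (tuples k [0..<nsyms M])" "js \<in> set (tuples k [0..<s])" for q xs js
    using view_true[OF t] that by (simp add: set_tuples)
  have vt: "set (view k (fst (cf n)) (reads n) (heads n)) \<subseteq> V n"
    using view_ok[OF reads_tuple heads_tuple] by simp
  have jl: "length js = k" if "js \<in> set (tuples k [0..<s])" for js using that by (simp add: set_tuples)
  have "v_state q1 js1 \<in> V (Suc n) \<longleftrightarrow> q1 = fst (cf (Suc n)) \<and> js1 = heads (Suc n)" for q1 js1
  proof
    assume "v_state q1 js1 \<in> V (Suc n)"
    then obtain cl where cl: "(v_state q1 js1, cl) \<in> set (run_clauses M s)" "set cl \<subseteq> V n" by auto
    from cl(1) obtain q xs js where q: "xs \<in> set (tuples k [0..<nsyms M])" "js \<in> set (tuples k [0..<s])"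
        "(v_state q1 js1, cl) \<in> set (view_clauses M q xs s js)"
      unfolding mem_clauses by (auto simp: v_defs)
    from q(3) have v: "v_state q1 js1 = v_state (fst (total_delta M q xs))
        (map (\<lambda>i. move_head (snd (snd (total_delta M q xs) ! i)) (js ! i)) [0..<k])" "cl = view k q xs js"
      unfolding mem_view[OF jl[OF q(2)]] by (auto simp: v_cell_def v_state_def)
    have "q = fst (cf n)" "js = heads n" "xs = reads n" using view_ok[OF q(1,2)] cl(2) v(2) by auto
    then show "q1 = fst (cf (Suc n)) \<and> js1 = heads (Suc n)" using v(1) heads' st(1) by (simp add: v_state_def)
  next
    assume q1: "q1 = fst (cf (Suc n)) \<and> js1 = heads (Suc n)"
    have "(v_state q1 js1, view k (fst (cf n)) (reads n) (heads n)) \<in> set (run_clauses M s)"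
      unfolding mem_clauses
    proof (intro disjI1 exI conjI)
      show "(v_state q1 js1, view k (fst (cf n)) (reads n) (heads n)) \<in>
          set (view_clauses M (fst (cf n)) (reads n) s (heads n))"
        unfolding mem_view[OF hl(1)] using q1 heads' st(1) by (intro disjI1) simp
    qed (rule run_props(1) reads_tuple heads_tuple)+
    then show "v_state q1 js1 \<in> V (Suc n)" using vt unfolding true_at.simps by blast
  qed
  moreover have "v_cell i j x \<in> V (Suc n) \<longleftrightarrow> i < k \<and> j < s \<and> x = cell (Suc n) i j" for i j x
  proof
    assume "v_cell i j x \<in> V (Suc n)"
    then obtain cl where cl: "(v_cell i j x, cl) \<in> set (run_clauses M s)" "set cl \<subseteq> V n" by auto
    from cl(1) obtain q xs js where q: "xs \<in> set (tuples k [0..<nsyms M])" "js \<in> set (tuples k [0..<s])"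
        "(v_cell i j x, cl) \<in> set (view_clauses M q xs s js)"
      unfolding mem_clauses by (auto simp: v_defs)
    from q(3) consider "i < k" "j = js ! i" "x = fst (snd (total_delta M q xs) ! i)" "cl = view k q xs js"
      | "i < k" "j < s" "j \<noteq> js ! i" "cl = [v_state q js, v_cell i j x]"
      unfolding mem_view[OF jl[OF q(2)]] by (auto simp: v_cell_def v_state_def)
    then show "i < k \<and> j < s \<and> x = cell (Suc n) i j"
    proof cases
      case 1
      have e: "q = fst (cf n)" "js = heads n" "xs = reads n" using view_ok[OF q(1,2)] cl(2) 1(4) by auto
      have hi: "heads n ! i = snd (snd (cf n) ! i)" using 1(1) run_props(2)[of n] by simp
      show ?thesis using 1 st(3)[OF 1(1)] bound[OF 1(1), of n] unfolding e hi by simp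
    next
      case 2
      have e: "js = heads n" "x = cell n i j" using t cl(2) 2(4) unfolding tracks_def by auto
      have hi: "heads n ! i = snd (snd (cf n) ! i)" using 2(1) run_props(2)[of n] by simp
      show ?thesis using 2 st(3)[OF 2(1)] unfolding e hi by simp
    qed
  next
    assume i: "i < k \<and> j < s \<and> x = cell (Suc n) i j"
    have hi: "heads n ! i = snd (snd (cf n) ! i)" using i run_props(2)[of n] by simp
    show "v_cell i j x \<in> V (Suc n)"
    proof (cases "j = heads n ! i")
      case True
      have "(v_cell i j x, view k (fst (cf n)) (reads n) (heads n)) \<in> set (run_clauses M s)"
        unfolding mem_clauses
      proof (intro disjI1 exI conjI)
        have "x = fst (snd ?d ! i)" using i True hi st(3)[of i] by simp
        then show "(v_cell i j x, view k (fst (cf n)) (reads n) (heads n)) \<in>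
            set (view_clauses M (fst (cf n)) (reads n) s (heads n))"
          unfolding mem_view[OF hl(1)] using i True by blast
      qed (rule run_props(1) reads_tuple heads_tuple)+
      then show ?thesis using vt unfolding true_at.simps by blast
    next
      case False
      have x: "x = cell n i j" using i False hi st(3)[of i] by simp
      have "(v_cell i j x, [v_state (fst (cf n)) (heads n), v_cell i j x]) \<in> set (run_clauses M s)"
        unfolding mem_clauses
      proof (intro disjI1 exI conjI)
        have "x < nsyms M" using x run_props(3) i by simp
        then show "(v_cell i j x, [v_state (fst (cf n)) (heads n), v_cell i j x]) \<in>
            set (view_clauses M (fst (cf n)) (reads n) s (heads n))"
          unfolding mem_view[OF hl(1)] using i False by blast
      qed (rule run_props(1) reads_tuple heads_tuple)+
      moreover have "v_state (fst (cf n)) (heads n) \<in> V n" "v_cell i j x \<in> V n"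
        using t i x unfolding tracks_def by auto
      ultimately show ?thesis by auto
    qed
  qed
  ultimately show ?thesis unfolding tracks_def by blast
qed

lemma tracks: "tracks n"
  by (induction n) (auto intro: tracks_0 tracks_Suc)

text \<open>The goal becomes true one time unit after a rejecting state is reached; it is absent
  from the start values, hence false at time zero.\<close>

lemma goal_iff: "(\<exists>n. v_goal \<in> V n) \<longleftrightarrow> (\<exists>n. fst (cf n) = reject_state M)"
proof
  assume "\<exists>n. v_goal \<in> V n"
  then obtain n where n: "v_goal \<in> V n" ..
  show "\<exists>n. fst (cf n) = reject_state M"
  proof (cases n)
    case 0
    then show ?thesis using n by (auto simp: run_start_def v_defs)
  next
    case (Suc m)
    then obtain cl where cl: "(v_goal, cl) \<in> set (run_clauses M s)" "set cl \<subseteq> V m" using n by auto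
    have "\<not> (v_goal, cl) \<in> set (view_clauses M q xs s js)" if "js \<in> set (tuples k [0..<s])" for q xs js
      using mem_view[of js v_goal cl q xs] that by (auto simp: set_tuples v_defs)
    then obtain js where "cl = [v_state (reject_state M) js]" using cl(1) unfolding mem_clauses by auto
    then have "v_state (reject_state M) js \<in> V m" using cl(2) by simp
    then have "fst (cf m) = reject_state M" using tracks[of m] unfolding tracks_def by simp
    then show ?thesis ..
  qed
next
  assume "\<exists>n. fst (cf n) = reject_state M"
  then obtain n where n: "fst (cf n) = reject_state M" ..
  have "(v_goal, [v_state (reject_state M) (heads n)]) \<in> set (run_clauses M s)"
    unfolding mem_clauses using heads_tuple by blast
  moreover have "v_state (reject_state M) (heads n) \<in> V n" using tracks[of n] n unfolding tracks_def by simp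
  ultimately have "v_goal \<in> V (Suc n)" by auto
  then show "\<exists>n. v_goal \<in> V n" ..
qed

end

section \<open>The reduction\<close>

lemma halted_forever:
  assumes "halted M (tm_run M w n)" "n \<le> m"
  shows "tm_run M w m = tm_run M w n"
  using assms(2)
proof (induction m rule: dec_induct)
  case (step m)
  then show ?case using assms(1) by (simp add: tm_run_Suc tm_step_def)
qed simp

text \<open>Once halted, a run is constant, so rejecting at one time and accepting at another cannot
  both happen.\<close>

lemma rejects_iff:
  assumes "turing_machine M" "decides M L"
  shows "(\<exists>n. fst (tm_run M w n) = reject_state M) \<longleftrightarrow> w \<notin> L"
proof -
  obtain t where t: "halted M (tm_run M w t)" "fst (tm_run M w t) = accept_state M \<longleftrightarrow> w \<in> L"
    using assms(2) unfolding decides_def by blast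
  show ?thesis
  proof
    assume "\<exists>n. fst (tm_run M w n) = reject_state M"
    then obtain n where n: "fst (tm_run M w n) = reject_state M" ..
    then have "halted M (tm_run M w n)" by (simp add: halted_def)
    then have "tm_run M w n = tm_run M w t"
      using halted_forever[of M w n "max n t"] halted_forever[OF t(1), of "max n t"] by simp
    then show "w \<notin> L" using t(2) n assms(1) by (auto simp: turing_machine_def)
  next
    assume "w \<notin> L"
    then have "fst (tm_run M w t) = reject_state M" using t by (auto simp: halted_def)
    then show "\<exists>n. fst (tm_run M w n) = reject_state M" ..
  qed
qed

text \<open>Injectivity of \<open>enc_instance\<close> ensures that the word is the code of the game
  and of no other instance, so membership depends on the two start configurations of the game
  alone.\<close>

lemma game_in_problem_iff:
  assumes "coarser rel bisimilar" "coarser sim_preorder rel"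
  shows "enc_data (game g V0 Cl) \<in> v1ca_problem rel \<longleftrightarrow> (\<forall>n. g \<notin> true_at V0 Cl n)"
proof -
  interpret game_automaton g V0 Cl .
  let ?c = "(c_start, [sym_Z])" and ?d = "(c_start', [sym_Z])"
  have enc: "enc_data (game g V0 Cl) = enc_instance D ?c ?d"
    unfolding D_def game_def enc_data_eq ..
  have conf: "?c \<in> configurations (presented_pda D)" "?d \<in> configurations (presented_pda D)"
    using valid_game[of g V0 Cl] unfolding game_def D_def valid_data_iff Let_def by auto
  have "enc_data (game g V0 Cl) \<in> v1ca_problem rel \<longleftrightarrow> rel T ?c ?d"
  proof
    assume "enc_data (game g V0 Cl) \<in> v1ca_problem rel"
    then obtain D' c' d' where d: "enc_instance D ?c ?d = enc_instance D' c' d'"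
        "rel (pda_lts (presented_pda D')) c' d'"
      unfolding v1ca_problem_def enc by blast
    then show "rel T ?c ?d" using enc_instance_inj[OF d(1)] by auto
  next
    assume "rel T ?c ?d"
    then show "enc_data (game g V0 Cl) \<in> v1ca_problem rel"
      unfolding v1ca_problem_def enc using pres conf by blast
  qed
  also have "\<dots> \<longleftrightarrow> (\<forall>n. g \<notin> V n)"
    using assms not_simulated all_bisimilar unfolding coarser_def by blast
  finally show ?thesis .
qed

theorem v1ca_problem_hard:
  assumes "coarser rel bisimilar" "coarser sim_preorder rel"
  shows "PSPACE_hard (v1ca_problem rel)"
  unfolding PSPACE_hard_def
proof
  fix L assume "L \<in> PSPACE"
  then obtain M and p :: "nat poly" where M: "turing_machine M" "decides M L" "runs_in_space M (poly p)"
    unfolding PSPACE_def by blast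
  obtain e where e: "\<And>n. poly p n \<le> (n + 2) ^ e" using polyb_poly_nat[of p] unfolding polyb_def by blast
  \<comment> \<open>The space bound is enlarged to a power with fixed exponent, which is computable
    by \<open>PT_power\<close>; a longer tape segment does no harm.\<close>
  define s where "s w = (length w + 2) ^ e" for w :: "bool list"
  define red where "red w = enc_data (game v_goal (run_start M w (s w)) (run_clauses M (s w)))" for w
  have PTs: "PT s" unfolding s_def by (intro PT_power PT_add PT_length PT_id PT_const)
  have "PT red" unfolding red_def
    by (intro PT_comp[OF PT_enc_data] PT_game PT_run_start PT_run_clauses PT_id PTs)
  moreover have "w \<in> L \<longleftrightarrow> red w \<in> v1ca_problem rel" for w
  proof -
    interpret bounded_run M w "s w"
    proof
      show "turing_machine M" by (rule M)
      fix n i assume "i < ntapes M"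
      then have "snd (tm_run M w n) ! i \<in> set (snd (tm_run M w n))"
        using wf_run[OF M(1), of w n] by (simp add: wf_config_def)
      then have "snd (snd (tm_run M w n) ! i) < poly p (length w)"
        using M(3) unfolding runs_in_space_def by fastforce
      then show "snd (snd (tm_run M w n) ! i) < s w" using e[of "length w"] unfolding s_def by linarith
    qed
    show ?thesis unfolding red_def game_in_problem_iff[OF assms]
      using goal_iff rejects_iff[OF M(1,2), of w] by blast
  qed
  ultimately show "polytime_reducible L (v1ca_problem rel)"
    unfolding polytime_reducible_def using polytime_computable_PT by blast
qed

theorem theorem3p9:
  "\<forall>rel \<in> {sim_preorder, sim_equiv,
            completed_sim_preorder, completed_sim_equiv,
            ready_sim_preorder, ready_sim_equiv,
            two_nested_sim_preorder, two_nested_sim_equiv,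
            bisimilar}.
     PSPACE_complete (v1ca_problem rel)"
proof
  fix rel :: "((name, counter_symbol) pda_config, name) behavioural_relation"
  assume rel: "rel \<in> {sim_preorder, sim_equiv, completed_sim_preorder, completed_sim_equiv,
    ready_sim_preorder, ready_sim_equiv, two_nested_sim_preorder, two_nested_sim_equiv, bisimilar}"
  have "PSPACE_hard (v1ca_problem rel)"
    using relation_spectrum[OF rel] by (intro v1ca_problem_hard) auto
  moreover have "v1ca_problem rel \<in> PSPACE"
    using rel v1ca_problem_PSPACE[OF system_sim] v1ca_problem_PSPACE[OF system_sim_equiv]
      v1ca_problem_PSPACE[OF system_completed] v1ca_problem_PSPACE[OF system_completed_equiv]
      v1ca_problem_PSPACE[OF system_ready] v1ca_problem_PSPACE[OF system_ready_equiv]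
      v1ca_problem_PSPACE[OF system_two_nested] v1ca_problem_PSPACE[OF system_two_nested_equiv]
      v1ca_problem_PSPACE[OF system_bisimilar]
    by auto
  ultimately show "PSPACE_complete (v1ca_problem rel)" by (simp add: PSPACE_complete_def)
qed

end
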